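(* Let $A\subset \mathbb{R}^{d+1}$ be a compact $C^\infty$-smooth $d$-dimensional manifold without boundary, let $s>0$ with $d-1\leqslant s<d$, and let $\mu_s$ be the $s$-equilibrium measure on $A$. Then $\mu_s$ is uniformly upper $d$-regular on $A$; i.e., there is a constant $c$ such that $\mu_s(B(x,r))\leqslant c\,r^d$ for all $x\in A$ and all $r>0$.
   Context: $d\geqslant 1$ is an integer; the manifold is an embedded submanifold of $\mathbb{R}^{d+1}$; $B(x,r)$ is the open ball of center $x$ and radius $r$. For a finite nonnegative Borel measure $\mu$ supported on a compact set $A$, $I_s[\mu]:=\int_A\int_A |x-y|^{-s}\,d\mu(y)\,d\mu(x)$, and $W_s(A):=\inf I_s[\mu]$ over all probability measures $\mu$ supported on $A$. If $W_s(A)<\infty$, there is a unique probability measure $\mu_s$ supported on $A$ attaining $W_s(A)$, called the $s$-equilibrium measure on $A$. *)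

theory Defs
  imports "HOL-Probability.Probability_Measure"
begin

(* C^k on a set S, meant for open S: f is differentiable on S and each directional derivative
   of f is again of class C^(k-1). *)
primrec C_k_on :: "nat \<Rightarrow> 'a::euclidean_space set \<Rightarrow> ('a \<Rightarrow> 'b::euclidean_space) \<Rightarrow> bool" where
  "C_k_on 0 S f \<longleftrightarrow> continuous_on S f"
| "C_k_on (Suc k) S f \<longleftrightarrow>
     (\<forall>x\<in>S. f differentiable (at x)) \<and>
     (\<forall>v. C_k_on k S (\<lambda>x. frechet_derivative f (at x) v))"

definition C_infinity_on :: "'a::euclidean_space set \<Rightarrow> ('a \<Rightarrow> 'b::euclidean_space) \<Rightarrow> bool" where
  "C_infinity_on S f \<longleftrightarrow> (\<forall>k. C_k_on k S f)"

definition C_infinity_diffeomorphism ::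
  "'a::euclidean_space set \<Rightarrow> 'b::euclidean_space set \<Rightarrow> ('a \<Rightarrow> 'b) \<Rightarrow> ('b \<Rightarrow> 'a) \<Rightarrow> bool" where
  "C_infinity_diffeomorphism U V \<phi> \<psi> \<longleftrightarrow>
     open U \<and> open V \<and> homeomorphism U V \<phi> \<psi> \<and> C_infinity_on U \<phi> \<and> C_infinity_on V \<psi>"

(* Embedded k-dimensional submanifold (without boundary) of the ambient Euclidean space:
   around each point of A, an ambient smooth chart straightens A to an open piece of a
   k-dimensional linear subspace. *)
definition smooth_submanifold :: "nat \<Rightarrow> 'a::euclidean_space set \<Rightarrow> bool" where
  "smooth_submanifold k A \<longleftrightarrow>
     (\<forall>p\<in>A. \<exists>U V \<phi> \<psi> (L :: 'a set).
        p \<in> U \<and> C_infinity_diffeomorphism U V \<phi> \<psi> \<and>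
        subspace L \<and> dim L = k \<and> \<phi> ` (U \<inter> A) = V \<inter> L)"

definition prob_measure_on :: "'a::euclidean_space set \<Rightarrow> 'a measure \<Rightarrow> bool" where
  "prob_measure_on A M \<longleftrightarrow> prob_space M \<and> sets M = sets borel \<and> emeasure M (- A) = 0"

(* The diagonal value has to be given separately: HOL has 0 powr (-s) = 0, whereas the kernel
   |x-y|^(-s) is infinite at x = y. *)
definition riesz_kernel :: "real \<Rightarrow> 'a::euclidean_space \<Rightarrow> 'a \<Rightarrow> ennreal" where
  "riesz_kernel s x y = (if x = y then \<infinity> else ennreal (norm (x - y) powr (- s)))"

definition riesz_energy :: "real \<Rightarrow> 'a::euclidean_space set \<Rightarrow> 'a measure \<Rightarrow> ennreal" where
  "riesz_energy s A M = (\<integral>\<^sup>+x\<in>A. (\<integral>\<^sup>+y\<in>A. riesz_kernel s x y \<partial>M) \<partial>M)"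

definition wiener_energy :: "real \<Rightarrow> 'a::euclidean_space set \<Rightarrow> ennreal" where
  "wiener_energy s A = (INF M\<in>{M. prob_measure_on A M}. riesz_energy s A M)"

definition equilibrium_measure :: "real \<Rightarrow> 'a::euclidean_space set \<Rightarrow> 'a measure \<Rightarrow> bool" where
  "equilibrium_measure s A M \<longleftrightarrow>
     wiener_energy s A < \<infinity> \<and> prob_measure_on A M \<and> riesz_energy s A M = wiener_energy s A"

definition uniformly_upper_regular :: "nat \<Rightarrow> 'a::euclidean_space set \<Rightarrow> 'a measure \<Rightarrow> bool" where
  "uniformly_upper_regular k A M \<longleftrightarrow>
     (\<exists>c::real. \<forall>x\<in>A. \<forall>r>0. measure M (ball x r) \<le> c * r ^ k)"

end

theory Submission
  imports Defs "HOL-Probability.Probability"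
begin

text \<open>
  Let U be the potential of the equilibrium measure \<mu>, let W be its energy, and put \<beta> = d - s, so
  that 0 < \<beta> \<le> 1.  Varying the energy gives \<integral>U d\<nu> \<ge> W \<nu>(A) for every measure \<nu> of finite energy on
  A, and U \<le> W holds \<mu>-almost everywhere.  Let x be a point of A with U(x) \<le> W, let n be a unit normal
  of A at x, and let q = x + t n.  Comparing the kernels with poles x and q on A shows that
  t^(-s) \<mu>(B(x,t)) is at most a constant times W - U(q) + t, so everything reduces to the bound
  W - U(q) = O(t^\<beta>).

  The comparison measures live on the unit sphere S tangent to A at x.  By rotation invariance the
  uniform measure of S has constant potential on S; the inversion with centre q that preserves S turns
  it into the measure \<tau> on S obtained by sweeping the unit mass at q onto S, whose potential on S is
  the kernel with pole q.  This needs no change of variables, only the formula for the distance of two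
  inverted points.

  Pushing \<tau> along the direction n from S to A gives a measure on A whose potential exceeds the kernel
  with pole q by a factor of at most 1 + O(t^(3\<beta>/5)), and with it the crude bound
  W - U(q) = O(t^(3\<beta>/5)).  A point of S at distance r from x has distance O(r^2) from A, so there
  W - U = O(r^(6\<beta>/5)).  Integrating this against \<tau>, whose density decays like t^\<beta> r^(-d-\<beta>), gives
  O(t^\<beta>), because 6/5 > 1.
\<close>

section \<open>Riesz potentials and the variational inequality\<close>

text \<open>Test measures for the energy must live on \<open>A\<close>, while a swept point mass has
  a closed form only on a sphere. Pushing it to \<open>A\<close> is too lossy for the sharp order
  t^\<beta>, and one variation alone therefore stops short. The loss is recovered by feedback: the
  crude bound is evaluated at points of the sphere, whose distance to \<open>A\<close> is quadratic
  in their distance to x, and this doubles its exponent. Any crude exponent above \<beta>/2 would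
  do; 3/5 results from splitting at the radius t^(1/3) and from a moment exponent kept a little
  below \<beta>. In the second pass the swept measure stays on the sphere: the pointwise lower bound
  there takes the place of the variational inequality, and its potential on \<open>A\<close> exceeds
  the kernel only by a factor 1 + O(t). The assumption d - 1 \<le> s says \<beta> \<le> 1, so that
  errors of order t are also of order t^\<beta>. A tangent sphere serves better than the tangent
  plane because it is compact, carries an explicit equilibrium measure and is mapped to itself by an
  inversion about q.\<close>

definition rker :: "real \<Rightarrow> real \<Rightarrow> ennreal" where
  "rker s r = (if r = 0 then \<infinity> else ennreal (r powr (- s)))"

definition rpot :: "real \<Rightarrow> 'a::euclidean_space measure \<Rightarrow> 'a \<Rightarrow> ennreal" where
  "rpot s M x = (\<integral>\<^sup>+y. rker s (dist x y) \<partial>M)"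

lemma riesz_kernel_eq: "riesz_kernel s x y = rker s (dist x y)"
  by (simp add: riesz_kernel_def rker_def dist_norm)

lemma rker_antimono: "0 \<le> s \<Longrightarrow> 0 \<le> a \<Longrightarrow> a \<le> b \<Longrightarrow> rker s b \<le> rker s a"
  by (auto simp: rker_def intro!: ennreal_leI powr_mono2')

lemma rker_mult: "0 < c \<Longrightarrow> 0 \<le> r \<Longrightarrow> rker s (c * r) = ennreal (c powr (- s)) * rker s r"
  by (auto simp: rker_def powr_mult ennreal_mult ennreal_mult_top)

lemma rker_le_scaled:
  assumes "0 \<le> s" "0 < c" "0 \<le> b" "c * b \<le> a"
  shows "rker s a \<le> ennreal (c powr (- s)) * rker s b"
  using rker_antimono[of s "c * b" a] rker_mult[of c b s] assms by simp

lemma rker_pos: "0 < rker s r"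
  by (auto simp: rker_def)

lemma rker_eq_ennreal: "r \<noteq> 0 \<Longrightarrow> rker s r = ennreal (r powr (- s))"
  by (simp add: rker_def)

lemma rker_measurable [measurable]: "rker s \<in> borel_measurable borel"
  unfolding rker_def by measurable

lemma rpot_measurable:
  assumes "finite_measure M" "sets M = sets (borel :: 'a::euclidean_space measure)"
  shows "rpot s M \<in> borel_measurable borel"
proof -
  interpret finite_measure M by fact
  note [measurable_cong] = assms(2)
  show ?thesis unfolding rpot_def by measurable
qed

text \<open>Fubini for a symmetric kernel. It turns the integral of the equilibrium potential
  against a test measure into the integral of the test potential against the equilibrium measure,
  which is how every comparison below is read.\<close>

lemma rpot_sym:
  fixes M N :: "'a::euclidean_space measure"
  assumes "finite_measure M" "sets M = sets borel" "finite_measure N" "sets N = sets borel"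
  shows "(\<integral>\<^sup>+x. rpot s M x \<partial>N) = (\<integral>\<^sup>+x. rpot s N x \<partial>M)"
proof -
  interpret M: finite_measure M by fact
  interpret N: finite_measure N by fact
  interpret P: pair_sigma_finite M N ..
  note [measurable_cong] = assms(2,4)
  have "(\<integral>\<^sup>+ y. \<integral>\<^sup>+ x. rker s (dist x y) \<partial>M \<partial>N) = (\<integral>\<^sup>+ x. \<integral>\<^sup>+ y. rker s (dist x y) \<partial>N \<partial>M)"
    by (rule P.Fubini') measurable
  then show ?thesis unfolding rpot_def by (simp add: dist_commute)
qed

lemma AE_supported: 
  assumes "sets M = sets borel" "emeasure M (- A) = 0" "A \<in> sets borel"
  shows "AE x in M. x \<in> A"
  by (rule AE_I[where N="- A"]) (use assms in \<open>auto dest: sets_eq_imp_space_eq\<close>)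

lemma riesz_energy_eq:
  assumes "sets M = sets borel" "emeasure M (- A) = 0" "A \<in> sets borel"
  shows "riesz_energy s A M = (\<integral>\<^sup>+x. rpot s M x \<partial>M)"
proof -
  have ae: "AE x in M. x \<in> A" by (rule AE_supported) fact+
  have 1: "(\<integral>\<^sup>+y\<in>A. riesz_kernel s x y \<partial>M) = rpot s M x" for x
    unfolding rpot_def by (rule nn_integral_cong_AE) (use ae in \<open>auto simp: riesz_kernel_eq\<close>)
  show ?thesis unfolding riesz_energy_def 1
    by (rule nn_integral_cong_AE) (use ae in auto)
qed

section \<open>Convex combinations of measures and their energy\<close>

text \<open>The convex combination with weight \<open>1 - e\<close> on \<open>M\<close> and
  \<open>e\<close> on \<open>N\<close>, encoded as a coin toss that selects the measure: the laws of
  \<open>bind\<close> then supply the integral formula.\<close>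

definition mix :: "real \<Rightarrow> 'a::euclidean_space measure \<Rightarrow> 'a measure \<Rightarrow> 'a measure" where
  "mix e M N = measure_pmf (bernoulli_pmf e) \<bind> (\<lambda>b. if b then N else M)"

lemma
  fixes M N :: "'a::euclidean_space measure"
  assumes "prob_space M" "sets M = sets borel" "prob_space N" "sets N = sets borel" "0 \<le> e" "e \<le> 1"
  shows sets_mix: "sets (mix e M N) = sets borel"
    and nn_integral_mix: "f \<in> borel_measurable borel \<Longrightarrow>
      (\<integral>\<^sup>+x. f x \<partial>mix e M N) = ennreal e * (\<integral>\<^sup>+x. f x \<partial>N) + ennreal (1 - e) * (\<integral>\<^sup>+x. f x \<partial>M)"
proof -
  have sp: "M \<in> space (subprob_algebra borel)" "N \<in> space (subprob_algebra borel)"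
    using assms by (auto simp: space_subprob_algebra intro: prob_space_imp_subprob_space)
  have ms: "(\<lambda>b. if b then N else M) \<in> measurable (measure_pmf (bernoulli_pmf e)) (subprob_algebra borel)"
    using sp by auto
  show "sets (mix e M N) = sets borel"
    unfolding mix_def using assms by (intro sets_bind) auto
  assume f: "f \<in> borel_measurable borel"
  show "(\<integral>\<^sup>+x. f x \<partial>mix e M N) = ennreal e * (\<integral>\<^sup>+x. f x \<partial>N) + ennreal (1 - e) * (\<integral>\<^sup>+x. f x \<partial>M)"
    unfolding mix_def nn_integral_bind[OF f ms]
    using assms by (simp add: nn_integral_bernoulli_pmf mult.commute)
qed

lemma prob_measure_on_mix:
  assumes "prob_measure_on A M" "prob_measure_on A N" "0 \<le> e" "e \<le> 1" "A \<in> sets borel"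
  shows "prob_measure_on A (mix e M N)"
proof -
  have a: "prob_space M" "sets M = sets borel" "prob_space N" "sets N = sets borel"
    using assms by (auto simp: prob_measure_on_def)
  have em: "emeasure (mix e M N) B = ennreal e * emeasure N B + ennreal (1 - e) * emeasure M B"
    if "B \<in> sets borel" for B
    using nn_integral_mix[OF a assms(3,4), of "indicator B"] that a sets_mix[OF a assms(3,4)]
    by simp
  have "emeasure (mix e M N) (- A) = 0"
    using assms by (subst em) (auto simp: prob_measure_on_def)
  moreover have "emeasure (mix e M N) UNIV = 1"
  proof -
    have "emeasure M UNIV = 1" "emeasure N UNIV = 1"
      using a by (metis prob_space.emeasure_space_1 sets_eq_imp_space_eq space_borel)+
    then show ?thesis using assms by (subst em) (auto simp flip: ennreal_plus)
  qed
  ultimately show ?thesis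
    using sets_mix[OF a assms(3,4)] 
    by (auto simp: prob_measure_on_def sets_eq_imp_space_eq intro!: prob_spaceI)
qed

lemma rpot_mix:
  assumes "prob_space M" "sets M = sets borel" "prob_space N" "sets N = sets borel" "0 \<le> e" "e \<le> 1"
  shows "rpot s (mix e M N) x = ennreal e * rpot s N x + ennreal (1 - e) * rpot s M x"
  unfolding rpot_def by (rule nn_integral_mix[OF assms]) measurable

lemma energy_mix:
  fixes M N :: "'a::euclidean_space measure"
  assumes a: "prob_space M" "sets M = sets borel" "prob_space N" "sets N = sets borel" "0 \<le> e" "e \<le> 1"
  shows "(\<integral>\<^sup>+x. rpot s (mix e M N) x \<partial>mix e M N) =
     ennreal (e\<^sup>2) * (\<integral>\<^sup>+x. rpot s N x \<partial>N) + ennreal (2 * e * (1 - e)) * (\<integral>\<^sup>+x. rpot s M x \<partial>N)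
     + ennreal ((1 - e)\<^sup>2) * (\<integral>\<^sup>+x. rpot s M x \<partial>M)"
proof -
  have f: "finite_measure M" "finite_measure N" using a by (auto simp: prob_space_def)
  have m: "rpot s M \<in> borel_measurable borel" "rpot s N \<in> borel_measurable borel"
    using a f by (auto intro: rpot_measurable)
  have m': "rpot s M \<in> borel_measurable M" "rpot s N \<in> borel_measurable M"
    "rpot s M \<in> borel_measurable N" "rpot s N \<in> borel_measurable N" 
    using m a measurable_cong_sets by blast+
  have sy: "(\<integral>\<^sup>+x. rpot s N x \<partial>M) = (\<integral>\<^sup>+x. rpot s M x \<partial>N)"
    by (rule rpot_sym) (use f a in auto)
  have "(\<integral>\<^sup>+x. rpot s (mix e M N) x \<partial>mix e M N) =
     ennreal e * (\<integral>\<^sup>+x. ennreal e * rpot s N x + ennreal (1 - e) * rpot s M x \<partial>N) +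
     ennreal (1 - e) * (\<integral>\<^sup>+x. ennreal e * rpot s N x + ennreal (1 - e) * rpot s M x \<partial>M)"
    unfolding rpot_mix[OF a] by (rule nn_integral_mix[OF a]) (use m in measurable)
  also have "\<dots> = ennreal e * (ennreal e * (\<integral>\<^sup>+x. rpot s N x \<partial>N) + ennreal (1 - e) * (\<integral>\<^sup>+x. rpot s M x \<partial>N)) +
     ennreal (1 - e) * (ennreal e * (\<integral>\<^sup>+x. rpot s M x \<partial>N) + ennreal (1 - e) * (\<integral>\<^sup>+x. rpot s M x \<partial>M))"
    using m' by (simp add: nn_integral_add nn_integral_cmult sy)
  also have "\<dots> = (ennreal e * ennreal e) * (\<integral>\<^sup>+x. rpot s N x \<partial>N) 
     + (ennreal e * ennreal (1 - e) + ennreal (1 - e) * ennreal e) * (\<integral>\<^sup>+x. rpot s M x \<partial>N)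
     + (ennreal (1 - e) * ennreal (1 - e)) * (\<integral>\<^sup>+x. rpot s M x \<partial>M)"
    by (simp add: distrib_left distrib_right mult.assoc add.assoc)
  also have "ennreal e * ennreal (1 - e) + ennreal (1 - e) * ennreal e = ennreal (2 * e * (1 - e))"
  proof -
    have "0 \<le> e * (1 - e)" using a by simp
    then show ?thesis using a by (simp flip: ennreal_mult ennreal_plus add: mult.commute)
  qed
  also have "ennreal e * ennreal e = ennreal (e\<^sup>2)"
    using a by (simp flip: ennreal_mult add: power2_eq_square)
  also have "ennreal (1 - e) * ennreal (1 - e) = ennreal ((1 - e)\<^sup>2)"
    using a by (simp flip: ennreal_mult add: power2_eq_square)
  finally show ?thesis .
qed

section \<open>First variation of the energy\<close>

text \<open>The terms of order zero in \<open>e\<close> cancel; after division by \<open>e\<close>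
  the limit from the right at 0 leaves 2w \<le> 2j.\<close>

lemma quadratic_variation:
  fixes w j i :: real
  assumes "\<And>e. 0 < e \<Longrightarrow> e < 1 \<Longrightarrow> w \<le> e\<^sup>2 * i + 2 * e * (1 - e) * j + (1 - e)\<^sup>2 * w"
  shows "w \<le> j"
proof -
  have *: "w * (2 - e) \<le> e * i + 2 * (1 - e) * j" if "0 < e" "e < 1" for e
  proof -
    have "e * (w * (2 - e)) \<le> e * (e * i + 2 * (1 - e) * j)"
      using assms[OF that] by (simp add: power2_eq_square algebra_simps)
    then show ?thesis using that by (simp del: mult_le_cancel_left_pos add: mult_le_cancel_left)
  qed
  have "((\<lambda>e. w * (2 - e)) \<longlongrightarrow> w * (2 - 0)) (at_right 0)"
       "((\<lambda>e. e * i + 2 * (1 - e) * j) \<longlongrightarrow> 0 * i + 2 * (1 - 0) * j) (at_right 0)"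
    by (auto intro!: tendsto_eq_intros)
  moreover have "\<forall>\<^sub>F e in at_right 0. w * (2 - e) \<le> e * i + 2 * (1 - e) * j"
    using * by (auto simp: eventually_at_right_field intro!: exI[of _ 1])
  ultimately have "w * (2 - 0) \<le> 0 * i + 2 * (1 - 0) * j"
    by (intro tendsto_le[of "at_right (0::real)"]) auto
  then show ?thesis by simp
qed

lemma equilibrium_variation_prob:
  fixes M N :: "'a::euclidean_space measure"
  assumes eq: "equilibrium_measure s A M" and A: "A \<in> sets borel"
    and N: "prob_measure_on A N" and fin: "(\<integral>\<^sup>+x. rpot s N x \<partial>N) < \<infinity>"
  shows "wiener_energy s A \<le> (\<integral>\<^sup>+x. rpot s M x \<partial>N)"
proof (cases "(\<integral>\<^sup>+x. rpot s M x \<partial>N) = \<infinity>")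
  case False
  have M: "prob_measure_on A M" and W: "wiener_energy s A < \<infinity>"
    and IM: "riesz_energy s A M = wiener_energy s A"
    using eq by (auto simp: equilibrium_measure_def)
  have a: "prob_space M" "sets M = sets borel" "prob_space N" "sets N = sets borel"
    using M N by (auto simp: prob_measure_on_def)
  obtain w where w: "wiener_energy s A = ennreal w" "w \<ge> 0"
    using W by (cases "wiener_energy s A") auto
  obtain j where j: "(\<integral>\<^sup>+x. rpot s M x \<partial>N) = ennreal j" "j \<ge> 0"
    using False by (cases "(\<integral>\<^sup>+x. rpot s M x \<partial>N)") auto
  obtain i where i: "(\<integral>\<^sup>+x. rpot s N x \<partial>N) = ennreal i" "i \<ge> 0"
    using fin by (cases "(\<integral>\<^sup>+x. rpot s N x \<partial>N)") auto
  have IM': "(\<integral>\<^sup>+x. rpot s M x \<partial>M) = ennreal w"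
    using riesz_energy_eq[of M A s] IM w A M by (auto simp: prob_measure_on_def)
  have "w \<le> j"
  proof (rule quadratic_variation[where i=i])
    fix e :: real assume e: "0 < e" "e < 1"
    have p: "prob_measure_on A (mix e M N)"
      by (rule prob_measure_on_mix) (use M N e A in auto)
    have "ennreal w \<le> riesz_energy s A (mix e M N)"
      unfolding w(1)[symmetric] wiener_energy_def using p by (intro INF_lower) auto
    also have "\<dots> = (\<integral>\<^sup>+x. rpot s (mix e M N) x \<partial>mix e M N)"
      by (rule riesz_energy_eq) (use p A in \<open>auto simp: prob_measure_on_def\<close>)
    also have "\<dots> = ennreal (e\<^sup>2 * i + 2 * e * (1 - e) * j + (1 - e)\<^sup>2 * w)"
      using e i j w
      by (subst energy_mix) (auto simp: a IM' simp flip: ennreal_mult ennreal_plus)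
    finally show "w \<le> e\<^sup>2 * i + 2 * e * (1 - e) * j + (1 - e)\<^sup>2 * w"
      using e i j w by (subst (asm) ennreal_le_iff) auto
  qed
  then show ?thesis using w j by (simp add: ennreal_leI)
qed auto

text \<open>Follows from the probability case by scaling. The unnormalised form allows restrictions
  and pushforwards to be tested as they come, with their mass entering only as a factor.\<close>

lemma equilibrium_variation:
  fixes M N :: "'a::euclidean_space measure"
  assumes eq: "equilibrium_measure s A M" and A: "A \<in> sets borel"
    and N: "finite_measure N" "sets N = sets borel" "emeasure N (- A) = 0"
    and fin: "(\<integral>\<^sup>+x. rpot s N x \<partial>N) < \<infinity>"
  shows "wiener_energy s A * emeasure N UNIV \<le> (\<integral>\<^sup>+x. rpot s M x \<partial>N)"
proof (cases "emeasure N UNIV = 0")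
  case False
  interpret finite_measure N by fact
  have spN: "space N = UNIV" by (simp add: sets_eq_imp_space_eq[OF N(2)])
  obtain m where m: "emeasure N UNIV = ennreal m" "m \<ge> 0"
    using emeasure_finite by (cases "emeasure N UNIV") (auto simp: spN top_unique)
  then have m0: "m > 0" using False by (cases "m = 0") auto
  define c where "c = ennreal (1 / m)"
  have M: "prob_measure_on A M" and f: "finite_measure M" using eq by (auto simp: equilibrium_measure_def prob_measure_on_def prob_space_def)
  have sm: "(\<integral>\<^sup>+x. f x \<partial>scale_measure c N) = c * (\<integral>\<^sup>+x. f x \<partial>N)" if "f \<in> borel_measurable borel" for f
    using that N by (intro nn_integral_scale_measure) (auto cong: measurable_cong_sets)
  have p: "prob_measure_on A (scale_measure c N)"
    using N m m0 A unfolding prob_measure_on_def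
    by (auto intro!: prob_spaceI simp: space_scale_measure c_def spN simp flip: ennreal_mult)
  have mN: "rpot s N \<in> borel_measurable borel" "rpot s M \<in> borel_measurable borel"
    using N M f by (auto intro!: rpot_measurable simp: prob_measure_on_def)
  have mN': "rpot s N \<in> borel_measurable N" using mN N measurable_cong_sets by blast
  have "rpot s (scale_measure c N) x = c * rpot s N x" for x
    unfolding rpot_def by (rule sm) measurable
  then have "(\<integral>\<^sup>+x. rpot s (scale_measure c N) x \<partial>scale_measure c N) = c * (c * (\<integral>\<^sup>+x. rpot s N x \<partial>N))"
    using mN mN' by (simp add: sm nn_integral_cmult)
  also have "\<dots> < \<infinity>" using fin by (simp add: c_def ennreal_mult_less_top)
  finally have "wiener_energy s A \<le> (\<integral>\<^sup>+x. rpot s M x \<partial>scale_measure c N)"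
    using equilibrium_variation_prob[OF eq A p] by simp
  also have "\<dots> = c * (\<integral>\<^sup>+x. rpot s M x \<partial>N)" by (rule sm) (rule mN)
  finally have "wiener_energy s A * ennreal m \<le> c * (\<integral>\<^sup>+x. rpot s M x \<partial>N) * ennreal m"
    by (rule mult_right_mono) simp
  also have "\<dots> = (c * ennreal m) * (\<integral>\<^sup>+x. rpot s M x \<partial>N)" by (simp add: ac_simps)
  also have "c * ennreal m = 1" using m0 by (simp add: c_def flip: ennreal_mult)
  finally show ?thesis using m by simp
qed simp

text \<open>Testing with the restriction of the measure to the set where the potential is below the
  energy \<open>w\<close> shows that this set is null. The mean of the potential is
  \<open>w\<close>, so it cannot exceed \<open>w\<close> on a set of positive measure
  either.\<close>

lemma equilibrium_potential_le:
  fixes M :: "'a::euclidean_space measure"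
  assumes eq: "equilibrium_measure s A M" and A: "A \<in> sets borel"
  shows "AE x in M. rpot s M x \<le> wiener_energy s A"
proof -
  have M: "prob_measure_on A M" and W: "wiener_energy s A < \<infinity>"
    and IM: "riesz_energy s A M = wiener_energy s A"
    using eq by (auto simp: equilibrium_measure_def)
  interpret prob_space M using M by (simp add: prob_measure_on_def)
  have sM [measurable_cong]: "sets M = sets borel" using M by (simp add: prob_measure_on_def)
  have spM: "space M = UNIV" by (simp add: sets_eq_imp_space_eq[OF sM])
  have mp [measurable]: "rpot s M \<in> borel_measurable borel" 
    by (rule rpot_measurable) (use sM in \<open>auto simp: finite_measure_axioms\<close>)
  have IM': "(\<integral>\<^sup>+x. rpot s M x \<partial>M) = wiener_energy s A"
    using riesz_energy_eq[of M A s] IM A M by (auto simp: prob_measure_on_def)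
  define w where "w = wiener_energy s A"
  have ge: "AE x in M. w \<le> rpot s M x"
  proof (rule ccontr)
    assume n: "\<not> (AE x in M. w \<le> rpot s M x)"
    define E where "E = {x. rpot s M x < w}"
    have E [measurable]: "E \<in> sets borel" unfolding E_def by measurable
    \<comment> \<open>This restriction is dominated by \<open>M\<close>, so its energy is at most
      that of \<open>M\<close> and hence finite, as the variational inequality demands.\<close>
    define N where "N = density M (indicator E)"
    have NI: "(\<integral>\<^sup>+x. f x \<partial>N) = (\<integral>\<^sup>+x. f x * indicator E x \<partial>M)" if "f \<in> borel_measurable borel" for f
      unfolding N_def using that by (subst nn_integral_density) (auto simp: mult.commute)
    have sN: "sets N = sets borel" by (simp add: N_def sM)
    have eN: "emeasure N B = emeasure M (B \<inter> E)" if "B \<in> sets borel" for B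
      using NI[of "indicator B"] that sN sM by (simp flip: indicator_inter_arith)
    have Nf: "finite_measure N"
      by (rule finite_measureI) (simp add: N_def spM eN[unfolded N_def])
    have N0: "emeasure N (- A) = 0"
    proof -
      have "emeasure M (- A \<inter> E) \<le> emeasure M (- A)" using A sM by (intro emeasure_mono) auto
      then show ?thesis using eN[of "- A"] A M by (auto simp: prob_measure_on_def)
    qed
    have "rpot s N x \<le> rpot s M x" for x
    proof -
      have "rpot s N x = (\<integral>\<^sup>+y. rker s (dist x y) * indicator E y \<partial>M)"
        unfolding rpot_def by (rule NI) measurable
      also have "\<dots> \<le> rpot s M x" unfolding rpot_def
        by (intro nn_integral_mono) (auto simp: indicator_def)
      finally show ?thesis .
    qed
    then have "(\<integral>\<^sup>+x. rpot s N x \<partial>N) \<le> (\<integral>\<^sup>+x. rpot s M x \<partial>N)" by (intro nn_integral_mono)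
    also have "\<dots> = (\<integral>\<^sup>+x. rpot s M x * indicator E x \<partial>M)" by (rule NI) measurable
    also have "\<dots> \<le> (\<integral>\<^sup>+x. rpot s M x \<partial>M)" by (intro nn_integral_mono) (auto simp: indicator_def)
    also have "\<dots> < \<infinity>" using IM' W by simp
    finally have "w * emeasure N UNIV \<le> (\<integral>\<^sup>+x. rpot s M x \<partial>N)"
      unfolding w_def by (intro equilibrium_variation[OF eq A Nf sN N0])
    then have le: "(\<integral>\<^sup>+x. w * indicator E x \<partial>M) \<le> (\<integral>\<^sup>+x. rpot s M x * indicator E x \<partial>M)"
      using eN[of UNIV] by (simp add: NI nn_integral_cmult_indicator sM)
    have "(\<integral>\<^sup>+x. rpot s M x * indicator E x \<partial>M) < (\<integral>\<^sup>+x. w * indicator E x \<partial>M)"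
    proof (rule nn_integral_less)
      show "(\<integral>\<^sup>+x. rpot s M x * indicator E x \<partial>M) \<noteq> \<infinity>"
        using \<open>(\<integral>\<^sup>+x. rpot s M x * indicator E x \<partial>M) \<le> (\<integral>\<^sup>+x. rpot s M x \<partial>M)\<close> IM' W 
        by (auto simp: top_unique)
      show "AE x in M. rpot s M x * indicator E x \<le> w * indicator E x"
        by (auto simp: E_def indicator_def)
      show "\<not> (AE x in M. w * indicator E x \<le> rpot s M x * indicator E x)"
      proof
        assume "AE x in M. w * indicator E x \<le> rpot s M x * indicator E x"
        then have "AE x in M. w \<le> rpot s M x"
        proof eventually_elim
          case (elim x)
          show ?case
          proof (cases "x \<in> E")
            case True
            then show ?thesis using elim by simp
          next
            case False
            then show ?thesis by (simp add: E_def)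
          qed
        qed
        with n show False by simp
      qed
    qed measurable
    with le show False by simp
  qed
  \<comment> \<open>The lower bound \<open>ge\<close> holds almost everywhere and the total mass is
    1, so a strict excess on a non-null set would push the integral of the potential above
    \<open>w\<close>.\<close>
  show ?thesis
  proof (rule ccontr)
    assume n: "\<not> (AE x in M. rpot s M x \<le> wiener_energy s A)"
    have "(\<integral>\<^sup>+x. w \<partial>M) < (\<integral>\<^sup>+x. rpot s M x \<partial>M)"
      using ge n W by (intro nn_integral_less) (auto simp: w_def emeasure_space_1)
    then show False using IM' by (simp add: w_def emeasure_space_1)
  qed
qed

section \<open>Flatness of a compact hypersurface\<close>

text \<open>\<open>n\<close> is a unit normal at \<open>x\<close>: near \<open>x\<close> the set deviates quadratically from the hyperplane orthogonal to
  \<open>n\<close> and lies over every point of it.  Uniqueness of the point over \<open>x + v\<close> is never needed.\<close>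

definition flat_at :: "'a::euclidean_space set \<Rightarrow> real \<Rightarrow> real \<Rightarrow> 'a \<Rightarrow> 'a \<Rightarrow> bool" where
  "flat_at A C \<delta> x n \<longleftrightarrow> norm n = 1 \<and> (\<forall>y\<in>A. \<bar>(y - x) \<bullet> n\<bar> \<le> C * (norm (y - x))\<^sup>2) \<and>
     (\<forall>v. v \<bullet> n = 0 \<and> norm v \<le> \<delta> \<longrightarrow> (\<exists>g. \<bar>g\<bar> \<le> C * (norm v)\<^sup>2 \<and> x + v + g *\<^sub>R n \<in> A))"

text \<open>The orientation of the normal is free; later it is chosen to point from a nearest point
  of \<open>A\<close> towards the given point.\<close>

lemma flat_at_uminus: "flat_at A C \<delta> x n \<Longrightarrow> flat_at A C \<delta> x (- n)"
  unfolding flat_at_def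
  apply (intro conjI)
  subgoal by simp
  subgoal by simp
  subgoal
    apply (intro allI impI)
    subgoal for v
      apply (elim conjE)
      apply (drule spec[of _ v])
      apply (erule impE, simp)
      apply (erule exE)
      subgoal for g by (rule exI[of _ "- g"]) simp
      done
    done
  done

lemma flat_at_mono: 
  assumes "flat_at A C \<delta> x n" "C \<le> C'" "\<delta>' \<le> \<delta>"
  shows "flat_at A C' \<delta>' x n"
proof -
  have "C * (norm z)\<^sup>2 \<le> C' * (norm z)\<^sup>2" for z :: 'a
    using assms by (intro mult_right_mono) auto
  then show ?thesis using assms unfolding flat_at_def
    by (meson order.trans)
qed

section \<open>A local defining function with Lipschitz gradient\<close>

text \<open>The operator norm of the derivative is at most the sum of the norms of its values on the
  basis. That sum is continuous, hence bounded on the compact ball, and convexity of the ball gives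
  the Lipschitz bound.\<close>

lemma C_1_lipschitz:
  fixes g :: "'a::euclidean_space \<Rightarrow> 'b::euclidean_space"
  assumes "C_k_on (Suc 0) U g" "cball p \<epsilon> \<subseteq> U"
  shows "\<exists>B. \<forall>x\<in>cball p \<epsilon>. \<forall>y\<in>cball p \<epsilon>. norm (g x - g y) \<le> B * norm (x - y)"
proof -
  define D where "D = (\<lambda>u h. frechet_derivative g (at u) h)"
  have D: "(g has_derivative D u) (at u)" if "u \<in> U" for u
    using assms that by (auto simp: D_def frechet_derivative_works)
  have cont: "continuous_on (cball p \<epsilon>) (\<lambda>u. D u v)" for v
    using assms by (auto simp: D_def intro: continuous_on_subset)
  then have "continuous_on (cball p \<epsilon>) (\<lambda>u. \<Sum>b\<in>Basis. norm (D u b))"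
    by (intro continuous_intros) auto
  then have "bounded ((\<lambda>u. \<Sum>b\<in>Basis. norm (D u b)) ` cball p \<epsilon>)"
    by (intro compact_imp_bounded compact_continuous_image) auto
  then obtain B where B: "\<forall>z\<in>(\<lambda>u. \<Sum>b\<in>Basis. norm (D u b)) ` cball p \<epsilon>. norm z \<le> B"
    unfolding bounded_iff by blast
  have B: "(\<Sum>b\<in>Basis. norm (D u b)) \<le> B" if "u \<in> cball p \<epsilon>" for u
    using B[rule_format, OF imageI[OF that]] by simp
  have on: "onorm (D u) \<le> B" if "u \<in> cball p \<epsilon>" for u
  proof (rule onorm_le)
    fix h
    have lin: "linear (D u)" using has_derivative_linear[OF D[OF subsetD[OF assms(2) that]]] .
    have "D u h = D u (\<Sum>b\<in>Basis. (h \<bullet> b) *\<^sub>R b)" by (simp add: euclidean_representation)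
    also have "\<dots> = (\<Sum>b\<in>Basis. (h \<bullet> b) *\<^sub>R D u b)"
      using lin by (simp add: linear_sum linear_scale o_def)
    finally have "norm (D u h) \<le> (\<Sum>b\<in>Basis. \<bar>h \<bullet> b\<bar> * norm (D u b))"
      using norm_sum[of "\<lambda>b. (h \<bullet> b) *\<^sub>R D u b" Basis] by simp
    also have "\<dots> \<le> (\<Sum>b\<in>Basis. norm h * norm (D u b))"
      by (intro sum_mono mult_right_mono Basis_le_norm) auto
    also have "\<dots> = (\<Sum>b\<in>Basis. norm (D u b)) * norm h"
      by (simp add: sum_distrib_left mult.commute)
    also have "\<dots> \<le> B * norm h" using B[OF that] by (intro mult_right_mono) auto
    finally show "norm (D u h) \<le> B * norm h" .
  qed
  show ?thesis
  proof (intro exI ballI)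
    fix x y assume "x \<in> cball p \<epsilon>" "y \<in> cball p \<epsilon>"
    then show "norm (g x - g y) \<le> B * norm (x - y)"
      using on has_derivative_at_withinI[OF D[OF subsetD[OF assms(2)]]]
      by (intro differentiable_bound[of "cball p \<epsilon>" g D]) auto
  qed
qed

text \<open>In codimension one the model subspace is a hyperplane with some normal \<open>m\<close>,
  so the single function \<open>m \<bullet> \<phi> u\<close> cuts out \<open>A\<close> locally. Its
  gradient is Lipschitz because the chart is twice continuously differentiable.\<close>

lemma defining_function:
  fixes A :: "'a::euclidean_space set"
  assumes sm: "smooth_submanifold d A" and dim: "DIM('a) = d + 1" and p: "p \<in> A"
  shows "\<exists>\<epsilon> F G B. 0 < \<epsilon> \<and> G p \<noteq> 0 \<and>
    (\<forall>u\<in>cball p \<epsilon>. (F has_derivative (\<lambda>h. G u \<bullet> h)) (at u) \<and> (u \<in> A \<longleftrightarrow> F u = (0::real))) \<and>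
    (\<forall>u\<in>cball p \<epsilon>. \<forall>w\<in>cball p \<epsilon>. norm (G u - G w) \<le> B * norm (u - w))"
proof -
  obtain U V \<phi> \<psi> and L :: "'a set" where pU: "p \<in> U" and diff: "C_infinity_diffeomorphism U V \<phi> \<psi>"
    and L: "subspace L" "dim L = d" and im: "\<phi> ` (U \<inter> A) = V \<inter> L"
    using sm p unfolding smooth_submanifold_def by blast
  have U: "open U" and V: "open V" and hom: "homeomorphism U V \<phi> \<psi>"
    and C\<phi>: "C_infinity_on U \<phi>" and C\<psi>: "C_infinity_on V \<psi>"
    using diff by (auto simp: C_infinity_diffeomorphism_def)
  have "dim L < DIM('a)" using L dim by simp
  then obtain m where m: "m \<noteq> 0" "span L \<subseteq> {x. m \<bullet> x = 0}"
    using lowdim_subset_hyperplane by blast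
  have Lm: "L = {x. m \<bullet> x = 0}"
  proof (rule subspace_dim_equal)
    show "L \<subseteq> {x. m \<bullet> x = 0}" using m(2) L by (metis span_eq_iff)
    show "dim {x. m \<bullet> x = 0} \<le> dim L" using m L dim by (simp add: dim_hyperplane)
  qed (use L in \<open>auto simp: subspace_hyperplane\<close>)
  have inA: "u \<in> A \<longleftrightarrow> m \<bullet> \<phi> u = 0" if "u \<in> U" for u
  proof
    assume "u \<in> A" then show "m \<bullet> \<phi> u = 0" using im that Lm by blast
  next
    assume "m \<bullet> \<phi> u = 0"
    then have "\<phi> u \<in> V \<inter> L" using hom that Lm by (auto simp: homeomorphism_def)
    then have "\<phi> u \<in> \<phi> ` (U \<inter> A)" using im by simp
    then obtain w where w: "w \<in> U" "w \<in> A" "\<phi> u = \<phi> w" by blast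
    then have "u = w" using homeomorphism_apply1[OF hom] that by metis
    then show "u \<in> A" using w by simp
  qed
  obtain \<epsilon> where \<epsilon>: "\<epsilon> > 0" "cball p \<epsilon> \<subseteq> U" using U pU open_contains_cball by blast
  define D where "D = (\<lambda>u h. frechet_derivative \<phi> (at u) h)"
  have C2: "C_k_on (Suc (Suc 0)) U \<phi>" using C\<phi> unfolding C_infinity_on_def by blast
  have D: "(\<phi> has_derivative D u) (at u)" if "u \<in> U" for u
    using C2 that by (auto simp: D_def frechet_derivative_works)
  have lin: "linear (D u)" if "u \<in> U" for u using D[OF that] by (rule has_derivative_linear)
  have "\<exists>B. \<forall>x\<in>cball p \<epsilon>. \<forall>y\<in>cball p \<epsilon>. norm (D x b - D y b) \<le> B * norm (x - y)" for b
    unfolding D_def by (rule C_1_lipschitz[OF _ \<epsilon>(2)]) (use C2 in auto)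
  then obtain B where B: "\<And>b x y. x\<in>cball p \<epsilon> \<Longrightarrow> y\<in>cball p \<epsilon> \<Longrightarrow> norm (D x b - D y b) \<le> B b * norm (x - y)"
    by metis
  define G where "G = (\<lambda>u. \<Sum>b\<in>Basis. (m \<bullet> D u b) *\<^sub>R b)"
  define F where "F = (\<lambda>u. m \<bullet> \<phi> u)"
  have Gh: "G u \<bullet> h = m \<bullet> D u h" if "u \<in> U" for u h
  proof -
    have "m \<bullet> D u h = m \<bullet> D u (\<Sum>b\<in>Basis. (h \<bullet> b) *\<^sub>R b)" by (simp add: euclidean_representation)
    also have "\<dots> = (\<Sum>b\<in>Basis. (h \<bullet> b) * (m \<bullet> D u b))"
      using lin[OF that] by (simp add: linear_sum linear_scale o_def inner_sum_right)
    finally show ?thesis by (simp add: G_def inner_sum_right mult.commute inner_commute[of _ h])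
  qed
  have FD: "(F has_derivative (\<lambda>h. G u \<bullet> h)) (at u)" if "u \<in> U" for u
    unfolding Gh[OF that] F_def by (rule bounded_linear.has_derivative[OF bounded_linear_inner_right D[OF that]])
  \<comment> \<open>The chain rule applied to \<open>\<psi> \<circ> \<phi>\<close> makes the
    derivative of the chart injective, hence surjective. A vector mapped to \<open>m\<close> pairs
    with \<open>G p\<close> to the square of the norm of \<open>m\<close>, which is not 0.\<close>
  have Gp: "G p \<noteq> 0"
  proof
    assume G0: "G p = 0"
    have "(\<psi> has_derivative (\<lambda>h. frechet_derivative \<psi> (at (\<phi> p)) h)) (at (\<phi> p))"
    proof -
      have "\<phi> p \<in> V" using hom pU by (auto simp: homeomorphism_def)
      moreover have "C_k_on (Suc 0) V \<psi>" using C\<psi> unfolding C_infinity_on_def by blast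
      ultimately have "\<psi> differentiable (at (\<phi> p))" by simp
      then show ?thesis by (simp add: frechet_derivative_works)
    qed
    from diff_chain_at[OF D[OF pU] this]
    have "((\<psi> \<circ> \<phi>) has_derivative (frechet_derivative \<psi> (at (\<phi> p)) \<circ> D p)) (at p)" by (simp add: o_def)
    moreover have "((\<psi> \<circ> \<phi>) has_derivative id) (at p)"
    proof -
      have "(id has_derivative id) (at p)" by (rule has_derivative_id)
      then show ?thesis
        by (rule has_derivative_transform_within_open[OF _ U pU]) (use hom in \<open>auto simp: homeomorphism_def\<close>)
    qed
    ultimately have inv: "frechet_derivative \<psi> (at (\<phi> p)) \<circ> D p = id" by (rule has_derivative_unique)
    have "inj (D p)"
    proof (rule injI)
      fix x y assume "D p x = D p y"
      then have "(frechet_derivative \<psi> (at (\<phi> p)) \<circ> D p) x = (frechet_derivative \<psi> (at (\<phi> p)) \<circ> D p) y" by simp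
      then show "x = y" by (simp only: inv id_apply)
    qed
    then have "surj (D p)" by (intro linear_injective_imp_surjective[OF lin[OF pU]]) auto
    then obtain h where "D p h = m" by (metis surjD)
    then show False using Gh[OF pU, of h] G0 m by simp
  qed
  have Glip: "norm (G u - G w) \<le> (\<Sum>b\<in>Basis. norm m * B b) * norm (u - w)"
    if "u \<in> cball p \<epsilon>" "w \<in> cball p \<epsilon>" for u w
  proof -
    have "G u - G w = (\<Sum>b\<in>Basis. (m \<bullet> (D u b - D w b)) *\<^sub>R b)"
      by (simp add: G_def sum_subtractf inner_diff_right scaleR_diff_left)
    then have "norm (G u - G w) \<le> (\<Sum>b\<in>Basis. norm ((m \<bullet> (D u b - D w b)) *\<^sub>R b))"
      by (simp only: norm_sum)
    also have "\<dots> \<le> (\<Sum>b\<in>Basis. norm m * B b * norm (u - w))"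
    proof (rule sum_mono)
      fix b :: 'a assume "b \<in> Basis"
      then have "norm ((m \<bullet> (D u b - D w b)) *\<^sub>R b) \<le> norm m * norm (D u b - D w b)"
        by (simp add: Cauchy_Schwarz_ineq2)
      also have "\<dots> \<le> norm m * (B b * norm (u - w))"
        using B[OF that] by (intro mult_left_mono) auto
      finally show "norm ((m \<bullet> (D u b - D w b)) *\<^sub>R b) \<le> norm m * B b * norm (u - w)" by (simp add: mult.assoc)
    qed
    finally show ?thesis by (simp add: sum_distrib_right)
  qed
  show ?thesis
  proof (intro exI conjI ballI)
    show "0 < \<epsilon>" by (rule \<epsilon>)
    show "G p \<noteq> 0" by (rule Gp)
    fix u assume u: "u \<in> cball p \<epsilon>"
    then have uU: "u \<in> U" using \<epsilon> by blast
    show "(F has_derivative (\<lambda>h. G u \<bullet> h)) (at u)" by (rule FD[OF uU])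
    show "u \<in> A \<longleftrightarrow> F u = 0" unfolding F_def by (rule inA[OF uU])
    fix w assume "w \<in> cball p \<epsilon>"
    then show "norm (G u - G w) \<le> (\<Sum>b\<in>Basis. norm m * B b) * norm (u - w)" by (rule Glip[OF u])
  qed
qed

text \<open>Mean value inequality on the segment for \<open>F\<close> minus its linear part at
  \<open>u\<close>: the remaining gradient \<open>G z - G u\<close> is at most \<open>B\<close>
  times the length of the segment.\<close>

lemma taylor_quadratic:
  fixes F :: "'a::euclidean_space \<Rightarrow> real"
  assumes S: "convex S" "u \<in> S" "w \<in> S"
    and F: "\<And>u. u \<in> S \<Longrightarrow> (F has_derivative (\<lambda>h. G u \<bullet> h)) (at u)"
    and G: "\<And>u w. u \<in> S \<Longrightarrow> w \<in> S \<Longrightarrow> norm (G u - G w) \<le> B * norm (u - w)" and "0 \<le> B"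
  shows "\<bar>F w - F u - G u \<bullet> (w - u)\<bar> \<le> B * (norm (w - u))\<^sup>2"
proof -
  have seg: "closed_segment u w \<subseteq> S" using S by (simp add: closed_segment_subset)
  have "norm ((F w - G u \<bullet> w) - (F u - G u \<bullet> u)) \<le> (B * norm (w - u)) * norm (w - u)"
  proof (rule differentiable_bound[of "closed_segment u w" "\<lambda>z. F z - G u \<bullet> z" "\<lambda>z h. (G z - G u) \<bullet> h"])
    fix z assume z: "z \<in> closed_segment u w"
    then have zS: "z \<in> S" using seg by auto
    show "((\<lambda>z. F z - G u \<bullet> z) has_derivative (\<lambda>h. (G z - G u) \<bullet> h)) (at z within closed_segment u w)"
      by (rule has_derivative_at_withinI) (auto intro!: derivative_eq_intros F zS simp: inner_diff_left)
    have "norm (z - u) \<le> norm (w - u)"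
      using segment_bound(1)[OF z] by (simp add: norm_minus_commute)
    then have nG: "norm (G z - G u) \<le> B * norm (w - u)"
      using G[OF zS S(2)] \<open>0 \<le> B\<close> mult_left_mono order_trans by blast
    show "onorm (\<lambda>h. (G z - G u) \<bullet> h) \<le> B * norm (w - u)"
    proof (rule onorm_le)
      fix h
      have "norm ((G z - G u) \<bullet> h) \<le> norm (G z - G u) * norm h" by (simp add: Cauchy_Schwarz_ineq2)
      also have "\<dots> \<le> (B * norm (w - u)) * norm h" using nG by (intro mult_right_mono) auto
      finally show "norm ((G z - G u) \<bullet> h) \<le> B * norm (w - u) * norm h" .
    qed
  qed auto
  then show ?thesis by (simp add: inner_diff_right power2_eq_square algebra_simps)
qed

text \<open>In codimension one the chart makes \<open>A\<close> locally the zero set of a single function \<open>F\<close> with non-zero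
  gradient, so the points of \<open>A\<close> over the tangent hyperplane come from the intermediate value theorem.\<close>

lemma flat_near:
  fixes A :: "'a::euclidean_space set"
  assumes "smooth_submanifold d A" "DIM('a) = d + 1" "p \<in> A"
  shows "\<exists>\<epsilon>>0. \<exists>C. \<exists>\<delta>>0. \<forall>x\<in>A \<inter> ball p \<epsilon>. \<exists>n. flat_at A C \<delta> x n"
proof -
  obtain \<epsilon>0 F G B0 where e0: "0 < \<epsilon>0" and Gp: "G p \<noteq> 0"
    and F0: "\<And>u. u\<in>cball p \<epsilon>0 \<Longrightarrow> (F has_derivative (\<lambda>h. G u \<bullet> h)) (at u)" 
    and FA0: "\<And>u. u\<in>cball p \<epsilon>0 \<Longrightarrow> u \<in> A \<longleftrightarrow> F u = (0::real)"
    and G0: "\<And>u w. u\<in>cball p \<epsilon>0 \<Longrightarrow> w\<in>cball p \<epsilon>0 \<Longrightarrow> norm (G u - G w) \<le> B0 * norm (u - w)"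
    using defining_function[OF assms] by blast
  define B where "B = \<bar>B0\<bar> + 1"
  have B: "B > 0" by (simp add: B_def)
  define b where "b = norm (G p) / 2"
  have b: "b > 0" using Gp by (simp add: b_def)
  \<comment> \<open>On a ball of this radius the gradient varies by at most \<open>b\<close>, half
    its norm at \<open>p\<close>, so its norm stays at least \<open>b\<close>.\<close>
  define \<epsilon> where "\<epsilon> = min \<epsilon>0 (b / B)"
  have e: "\<epsilon> > 0" "\<epsilon> \<le> \<epsilon>0" "B * \<epsilon> \<le> b" using e0 b B by (auto simp: \<epsilon>_def min_def field_simps)
  have sub: "cball p \<epsilon> \<subseteq> cball p \<epsilon>0" using e by (simp add: subset_cball)
  note F = F0[OF subsetD[OF sub]] and FA = FA0[OF subsetD[OF sub]]
  have G: "norm (G u - G w) \<le> B * norm (u - w)" if "u \<in> cball p \<epsilon>" "w \<in> cball p \<epsilon>" for u w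
  proof -
    have "norm (G u - G w) \<le> B0 * norm (u - w)" using G0 that sub by blast
    also have "\<dots> \<le> B * norm (u - w)" by (intro mult_right_mono) (auto simp: B_def)
    finally show ?thesis .
  qed
  have taylor: "\<bar>F w - F u - G u \<bullet> (w - u)\<bar> \<le> B * (norm (w - u))\<^sup>2"
    if "u \<in> cball p \<epsilon>" "w \<in> cball p \<epsilon>" for u w
    by (rule taylor_quadratic[of "cball p \<epsilon>"]) (use that F G B in auto)
  have Gb: "norm (G u) \<ge> b" if "u \<in> cball p \<epsilon>" for u
  proof -
    have "norm (G u - G p) \<le> B * norm (u - p)" using G that e by auto
    also have "\<dots> \<le> B * \<epsilon>" using that B by (auto simp: dist_norm norm_minus_commute)
    finally have "norm (G u - G p) \<le> b" using e by simp
    moreover have "norm (G p) \<le> norm (G u) + norm (G u - G p)"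
      by (metis norm_minus_commute norm_triangle_sub)
    ultimately show ?thesis by (simp add: b_def)
  qed
  \<comment> \<open>Chosen so that \<open>b * M\<close> is at least \<open>2 * B\<close>: at height
    \<open>M * (norm v)\<^sup>2\<close> the linear term of \<open>F\<close> then dominates the
    Taylor remainder.\<close>
  define M where "M = 2 * B / b + 1"
  have M: "M > 0" "b * M \<ge> 2 * B" using B b by (auto simp: M_def field_simps add_pos_nonneg)
  \<comment> \<open>The summand \<open>2 / \<epsilon>\<close> serves points \<open>y\<close> of
    \<open>A\<close> outside the chart ball: they have distance at least
    \<open>\<epsilon> / 2\<close> from \<open>x\<close>, so the plain bound by
    \<open>norm (y - x)\<close> is already quadratic there.\<close>
  define C where "C = M + 2 / \<epsilon>"
  \<comment> \<open>The bound \<open>1 / M\<close> makes \<open>T\<close> at most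
    \<open>norm v\<close>, and \<open>\<epsilon> / 4\<close> then keeps the vertical segment of
    half-length \<open>T\<close> over \<open>x + v\<close> inside the ball.\<close>
  define \<delta> where "\<delta> = min (\<epsilon> / 4) (1 / M)"
  have \<delta>: "\<delta> > 0" using e M by (simp add: \<delta>_def)
  have CM: "M \<le> C" "2 / \<epsilon> \<le> C" using M e by (auto simp: C_def)
  show ?thesis
  proof (rule exI[of _ "\<epsilon> / 2"], intro conjI, simp add: e, rule exI[of _ C], rule exI[of _ \<delta>], intro conjI \<delta> ballI)
    fix x assume x: "x \<in> A \<inter> ball p (\<epsilon> / 2)"
    then have xp: "dist p x < \<epsilon> / 2" and xc: "x \<in> cball p \<epsilon>" using e by auto
    have Fx: "F x = 0" using FA xc x by auto
    define n where "n = G x /\<^sub>R norm (G x)"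
    have gx: "norm (G x) \<ge> b" "norm (G x) > 0" using Gb[OF xc] b by auto
    have Gn: "G x = norm (G x) *\<^sub>R n" using gx by (simp add: n_def)
    have nn: "norm n = 1" using gx by (simp add: n_def)
    have 1: "\<bar>(y - x) \<bullet> n\<bar> \<le> C * (norm (y - x))\<^sup>2" if y: "y \<in> A" for y
    proof (cases "y \<in> cball p \<epsilon>")
      case True
      then have "F y = 0" using FA y by auto
      then have "\<bar>G x \<bullet> (y - x)\<bar> \<le> B * (norm (y - x))\<^sup>2" using taylor[OF xc True] Fx by simp
      then have "norm (G x) * \<bar>(y - x) \<bullet> n\<bar> \<le> B * (norm (y - x))\<^sup>2"
        using gx by (subst (asm) Gn) (simp add: abs_mult inner_commute)
      moreover have "b * \<bar>(y - x) \<bullet> n\<bar> \<le> norm (G x) * \<bar>(y - x) \<bullet> n\<bar>" using gx by (intro mult_right_mono) auto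
      ultimately have "b * \<bar>(y - x) \<bullet> n\<bar> \<le> B * (norm (y - x))\<^sup>2" by linarith
      then have "\<bar>(y - x) \<bullet> n\<bar> \<le> (B / b) * (norm (y - x))\<^sup>2" using b by (simp add: field_simps)
      also have "\<dots> \<le> C * (norm (y - x))\<^sup>2"
      proof (intro mult_right_mono)
        have "B / b \<le> 2 * B / b" using B b by (simp add: field_simps)
        then show "B / b \<le> C" using CM B b by (simp add: M_def)
      qed auto
      finally show ?thesis .
    next
      case False
      then have "\<epsilon> / 2 \<le> norm (y - x)"
        using xp dist_triangle[of p y x] by (simp add: dist_norm norm_minus_commute)
      then have "1 \<le> (2 / \<epsilon>) * norm (y - x)" using e by (simp add: field_simps)
      then have "norm (y - x) * 1 \<le> norm (y - x) * ((2 / \<epsilon>) * norm (y - x))" by (intro mult_left_mono) auto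
      moreover have "\<bar>(y - x) \<bullet> n\<bar> \<le> norm (y - x)" using Cauchy_Schwarz_ineq2[of "y - x" n] nn by simp
      ultimately have "\<bar>(y - x) \<bullet> n\<bar> \<le> (2 / \<epsilon>) * (norm (y - x))\<^sup>2" by (simp add: power2_eq_square algebra_simps)
      also have "\<dots> \<le> C * (norm (y - x))\<^sup>2" using CM by (intro mult_right_mono) auto
      finally show ?thesis .
    qed
    have 2: "\<exists>g. \<bar>g\<bar> \<le> C * (norm v)\<^sup>2 \<and> x + v + g *\<^sub>R n \<in> A" if v: "v \<bullet> n = 0" "norm v \<le> \<delta>" for v
    proof -
      define T where "T = M * (norm v)\<^sup>2"
      have T0: "T \<ge> 0" using M by (simp add: T_def)
      have Mv: "M * norm v \<le> 1"
      proof -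
        have "norm v \<le> 1 / M" using v by (simp add: \<delta>_def)
        then show ?thesis using M by (simp add: field_simps)
      qed
      have Tv: "T \<le> norm v" using mult_right_mono[OF Mv, of "norm v"] by (simp add: T_def power2_eq_square algebra_simps)
      have inc: "x + v + g *\<^sub>R n \<in> cball p \<epsilon>" if "\<bar>g\<bar> \<le> T" for g
      proof -
        have "norm (v + g *\<^sub>R n) \<le> norm v + \<bar>g\<bar>" using norm_triangle_ineq[of v "g *\<^sub>R n"] nn by simp
        also have "\<dots> \<le> \<epsilon> / 2" using that Tv v by (simp add: \<delta>_def)
        finally have "dist x (x + v + g *\<^sub>R n) \<le> \<epsilon> / 2"
          by (subst dist_commute) (simp add: dist_norm add.assoc)
        then show ?thesis using xp dist_triangle[of p "x + v + g *\<^sub>R n" x] by simp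
      qed
      define f where "f = (\<lambda>g. F (x + v + g *\<^sub>R n))"
      have fg: "\<bar>f g - norm (G x) * g\<bar> \<le> 2 * B * (norm v)\<^sup>2" if "\<bar>g\<bar> \<le> T" for g
      proof -
        have "(norm (v + g *\<^sub>R n))\<^sup>2 = (norm v)\<^sup>2 + g\<^sup>2"
          using v nn by (simp add: power2_norm_eq_inner inner_add_left inner_add_right inner_commute[of n v] norm_eq_1)
             (simp add: power2_eq_square)
        also have "g\<^sup>2 \<le> (norm v)\<^sup>2" using that Tv by (simp flip: abs_le_square_iff)
        finally have sq: "(norm (v + g *\<^sub>R n))\<^sup>2 \<le> 2 * (norm v)\<^sup>2" by simp
        have "G x \<bullet> (v + g *\<^sub>R n) = norm (G x) * g"
          using v nn by (subst Gn) (simp add: inner_add_right inner_commute norm_eq_1)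
        then have "\<bar>f g - norm (G x) * g\<bar> \<le> B * (norm (v + g *\<^sub>R n))\<^sup>2"
          using taylor[OF xc inc[OF that]] Fx by (simp add: f_def add.assoc)
        also have "\<dots> \<le> B * (2 * (norm v)\<^sup>2)" using sq B by (intro mult_left_mono) auto
        finally show ?thesis by simp
      qed
      have GT: "norm (G x) * T \<ge> 2 * B * (norm v)\<^sup>2"
      proof -
        have "2 * B * (norm v)\<^sup>2 \<le> b * M * (norm v)\<^sup>2" using M by (intro mult_right_mono) auto
        also have "\<dots> = b * T" by (simp add: T_def)
        also have "\<dots> \<le> norm (G x) * T" using gx T0 by (intro mult_right_mono) auto
        finally show ?thesis .
      qed
      have f1: "f T \<ge> 0" using fg[of T] GT T0 by simp
      have f2: "f (- T) \<le> 0" using fg[of "- T"] GT T0 by simp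
      have "continuous_on {- T..T} f" unfolding f_def
      proof (rule continuous_on_compose2[of "cball p \<epsilon>" F])
        show "continuous_on (cball p \<epsilon>) F"
          using F by (meson has_derivative_continuous continuous_at_imp_continuous_on)
      qed (use inc in \<open>auto intro!: continuous_intros\<close>)
      then obtain g where g: "- T \<le> g" "g \<le> T" "f g = 0"
        using IVT'[of f "- T" 0 T] f1 f2 T0 by auto
      have "x + v + g *\<^sub>R n \<in> A" using FA[OF inc[of g]] g by (auto simp: f_def)
      moreover have "\<bar>g\<bar> \<le> C * (norm v)\<^sup>2"
      proof -
        have "\<bar>g\<bar> \<le> T" using g by auto
        also have "\<dots> \<le> C * (norm v)\<^sup>2" unfolding T_def using CM by (intro mult_right_mono) auto
        finally show ?thesis .
      qed
      ultimately show ?thesis by blast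
    qed
    show "\<exists>n. flat_at A C \<delta> x n" unfolding flat_at_def using nn 1 2 by blast
  qed
qed

text \<open>A finite subcover gives uniform constants by taking a maximum and a minimum. The
  inserted 1 gives \<open>C' \<ge> 1\<close> and keeps both sets nonempty when \<open>A\<close> is
  empty.\<close>

lemma compact_submanifold_flat:
  fixes A :: "'a::euclidean_space set"
  assumes "smooth_submanifold d A" "DIM('a) = d + 1" "compact A"
  shows "\<exists>C\<ge>1. \<exists>\<delta>>0. \<forall>x\<in>A. \<exists>n. flat_at A C \<delta> x n"
proof -
  have "\<forall>p\<in>A. \<exists>\<epsilon> C \<delta>. \<epsilon> > 0 \<and> \<delta> > 0 \<and> (\<forall>x\<in>A \<inter> ball p \<epsilon>. \<exists>n. flat_at A C \<delta> x n)"
    using flat_near[OF assms(1,2)] by blast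
  then obtain \<epsilon> C \<delta> where *: "\<And>p. p \<in> A \<Longrightarrow> \<epsilon> p > 0 \<and> \<delta> p > (0::real) \<and> (\<forall>x\<in>A \<inter> ball p (\<epsilon> p). \<exists>n. flat_at A (C p) (\<delta> p) x n)"
    by metis
  obtain K where K: "finite K" "K \<subseteq> A" "A \<subseteq> (\<Union>p\<in>K. ball p (\<epsilon> p))"
  proof (rule compactE_image[OF assms(3), of A "\<lambda>p. ball p (\<epsilon> p)"])
    show "A \<subseteq> (\<Union>p\<in>A. ball p (\<epsilon> p))" using * by fastforce
  qed auto
  define C' where "C' = Max (insert 1 (C ` K))"
  define \<delta>' where "\<delta>' = Min (insert 1 (\<delta> ` K))"
  have "C' \<ge> 1" "\<And>p. p \<in> K \<Longrightarrow> C p \<le> C'" using K by (auto simp: C'_def)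
  moreover have "\<delta>' > 0" "\<And>p. p \<in> K \<Longrightarrow> \<delta>' \<le> \<delta> p" using K * by (auto simp: \<delta>'_def subset_iff)
  moreover have "\<exists>n. flat_at A C' \<delta>' x n" if x: "x \<in> A" for x
  proof -
    obtain p where p: "p \<in> K" "x \<in> ball p (\<epsilon> p)" using K(3) x by auto
    then have "p \<in> A" using K by blast
    then obtain n where "flat_at A (C p) (\<delta> p) x n" using *[of p] x p by blast
    then have "flat_at A C' \<delta>' x n" 
      by (rule flat_at_mono) (use calculation p in auto)
    then show ?thesis by blast
  qed
  ultimately show ?thesis by blast
qed

section \<open>The uniform measure of the sphere\<close>

lemma ball_borel [measurable]: "ball (p :: 'a::metric_space) r \<in> sets borel"
  by simp

lemma lborel_distr_minus: "distr lborel borel (\<lambda>y. x - y) = (lborel :: 'a::euclidean_space measure)"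
  using lborel_affine[of "-1" x] by (simp add: density_1)

text \<open>Uniqueness of Haar measure: both sides of the Fubini identity below are products of the measures of
  \<open>A\<close> and of the unit ball, which \<open>f\<close> preserves.\<close>

lemma lborel_linear_involution:
  fixes f :: "'a::euclidean_space \<Rightarrow> 'a"
  assumes lin: "linear f" and inv: "\<And>x. f (f x) = x" and nrm: "\<And>x. norm (f x) = norm x"
  shows "distr lborel borel f = lborel"
proof (rule measure_eqI)
  fix A :: "'a set" assume "A \<in> sets (distr lborel borel f)"
  then have A [measurable]: "A \<in> sets borel" by simp
  have [measurable]: "f \<in> borel_measurable borel"
    by (intro borel_measurable_continuous_onI linear_continuous_on linear_conv_bounded_linear[THEN iffD1] lin)
  define B :: "'a set" where "B = ball 0 1"
  have B [measurable]: "B \<in> sets borel" by (simp add: B_def)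
  have trans: "(\<integral>\<^sup>+y. h (c + y) \<partial>lborel) = (\<integral>\<^sup>+y. h y \<partial>lborel)" if [measurable]: "h \<in> borel_measurable borel" for h and c :: 'a
    by (subst lborel_distr_plus[symmetric, of c]) (simp add: nn_integral_distr)
  have refl: "(\<integral>\<^sup>+y. h (c - y) \<partial>lborel) = (\<integral>\<^sup>+y. h y \<partial>lborel)" if [measurable]: "h \<in> borel_measurable borel" for h and c :: 'a
    by (subst lborel_distr_minus[symmetric, of c]) (simp add: nn_integral_distr)
  let ?I = "\<lambda>S x. indicator S (x::'a) :: ennreal"
  have nu: "emeasure (distr lborel borel f) S = (\<integral>\<^sup>+x. ?I S (f x) \<partial>lborel)" if [measurable]: "S \<in> sets borel" for S
    by (simp add: nn_integral_distr flip: nn_integral_indicator)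
  have "(\<integral>\<^sup>+x. (\<integral>\<^sup>+y. ?I A (f x) * ?I B (f x + y) \<partial>lborel) \<partial>lborel) = (\<integral>\<^sup>+x. ?I A (f x) \<partial>lborel) * emeasure lborel B"
    by (simp add: nn_integral_cmult nn_integral_multc trans[of "?I B"])
  moreover have "(\<integral>\<^sup>+x. (\<integral>\<^sup>+y. ?I A (f x) * ?I B (f x + y) \<partial>lborel) \<partial>lborel) =
      (\<integral>\<^sup>+y. (\<integral>\<^sup>+x. ?I A (f x) * ?I B (f x + y) \<partial>lborel) \<partial>lborel)"
    by (rule lborel_pair.Fubini'[symmetric]) measurable
  moreover have "(\<integral>\<^sup>+x. ?I A (f x) * ?I B (f x + y) \<partial>lborel) = (\<integral>\<^sup>+x. ?I A (f x - y) * ?I B (f x) \<partial>lborel)" for y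
  proof -
    \<comment> \<open>Translating by \<open>f y\<close> before applying \<open>f\<close> is
      translating by \<open>y\<close> afterwards; this is where linearity and
      \<open>f (f x) = x\<close> combine.\<close>
    have "f (f y + x) = y + f x" for x using lin inv by (simp add: linear_add)
    then show ?thesis
      using trans[of "\<lambda>x. ?I A (f x - y) * ?I B (f x)" "f y"] by (simp add: add.commute)
  qed
  moreover have "(\<integral>\<^sup>+y. (\<integral>\<^sup>+x. ?I A (f x - y) * ?I B (f x) \<partial>lborel) \<partial>lborel) =
      (\<integral>\<^sup>+x. (\<integral>\<^sup>+y. ?I A (f x - y) * ?I B (f x) \<partial>lborel) \<partial>lborel)"
    by (rule lborel_pair.Fubini') measurable
  moreover have "\<dots> = emeasure lborel A * (\<integral>\<^sup>+x. ?I B (f x) \<partial>lborel)"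
    by (simp add: nn_integral_cmult nn_integral_multc refl[of "?I A"])
  moreover have "(\<integral>\<^sup>+x. ?I B (f x) \<partial>lborel) = emeasure lborel B"
  proof -
    have "?I B (f x) = ?I B x" for x by (simp add: B_def nrm indicator_def)
    then show ?thesis by simp
  qed
  ultimately have eq: "(\<integral>\<^sup>+x. ?I A (f x) \<partial>lborel) * emeasure lborel B = emeasure lborel A * emeasure lborel B"
    by simp
  have "emeasure lborel B = ennreal (unit_ball_vol (real DIM('a)))"
    by (simp add: B_def emeasure_ball)
  then have "emeasure lborel B \<noteq> top" "emeasure lborel B \<noteq> 0"
    using unit_ball_vol_pos[of "real DIM('a)"] by (auto simp: ennreal_eq_0_iff not_le)
  then have "(\<integral>\<^sup>+x. ?I A (f x) \<partial>lborel) = emeasure lborel A"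
    using eq by (simp only: mult.commute[of _ "emeasure lborel B"] ennreal_mult_cancel_left) auto
  then show "emeasure (distr lborel borel f) A = emeasure lborel A" using nu by simp
qed simp

text \<open>The measure of a set of directions is the volume of the cone over it in the unit ball.\<close>

definition cone_measure :: "'a::euclidean_space measure" where
  "cone_measure = distr (density lborel (indicator (ball 0 1))) borel (\<lambda>y. y /\<^sub>R norm y)"

lemma sets_cone_measure [simp, measurable_cong]: "sets cone_measure = sets borel"
  by (simp add: cone_measure_def)

lemma nn_integral_cone_measure:
  "f \<in> borel_measurable borel \<Longrightarrow>
    (\<integral>\<^sup>+y. f y \<partial>cone_measure) = (\<integral>\<^sup>+y. f (y /\<^sub>R norm y) * indicator (ball 0 1) y \<partial>(lborel :: 'a::euclidean_space measure))"
  unfolding cone_measure_def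
  by (subst nn_integral_distr, simp, simp, subst nn_integral_density) (simp_all add: mult.commute)

lemma emeasure_cone_measure:
  fixes B :: "'a::euclidean_space set"
  assumes [measurable]: "B \<in> sets borel" 
  shows "emeasure cone_measure B = emeasure lborel {y \<in> ball 0 1. y /\<^sub>R norm y \<in> B}"
proof -
  have "emeasure cone_measure B = (\<integral>\<^sup>+y. indicator B y \<partial>cone_measure)"
    by (simp add: sets_cone_measure)
  also have "\<dots> = (\<integral>\<^sup>+y. indicator {y \<in> ball 0 1. y /\<^sub>R norm y \<in> B} y \<partial>lborel)"
    by (subst nn_integral_cone_measure, simp, rule nn_integral_cong) (auto simp del: mem_ball split: split_indicator)
  also have "\<dots> = emeasure lborel {y \<in> ball 0 1. y /\<^sub>R norm y \<in> B}"
    by (rule nn_integral_indicator) measurable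
  finally show ?thesis .
qed

lemma cone_measure_sphere: "emeasure cone_measure (- sphere 0 1 :: 'a::euclidean_space set) = 0"
proof -
  \<comment> \<open>At \<open>y = 0\<close> the normalised vector is 0 by the convention on
    division; this single point is Lebesgue null.\<close>
  have "{y::'a. y \<in> ball 0 1 \<and> y /\<^sub>R norm y \<in> - sphere 0 1} \<subseteq> {0}"
    by (auto simp: field_simps)
  then have "emeasure lborel {y::'a. y \<in> ball 0 1 \<and> y /\<^sub>R norm y \<in> - sphere 0 1} \<le> emeasure lborel {0::'a}"
    by (intro emeasure_mono) auto
  then show ?thesis by (subst emeasure_cone_measure) auto
qed

lemma cone_measure_total: "emeasure cone_measure (UNIV :: 'a::euclidean_space set) = ennreal (unit_ball_vol (real DIM('a)))"
  using emeasure_ball[of 1 "0::'a"] by (subst emeasure_cone_measure) (auto simp: ball_def)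

text \<open>The reflection in the hyperplane orthogonal to \<open>x - x'\<close> exchanges the two
  points. It is a norm-preserving linear involution, so it preserves Lebesgue measure and commutes
  with the normalisation of vectors.\<close>

lemma rpot_cone_measure_const:
  fixes x x' :: "'a::euclidean_space"
  assumes "norm x = 1" "norm x' = 1"
  shows "rpot s cone_measure x = rpot s cone_measure x'"
proof (cases "x = x'")
  case False
  define w where "w = x - x'"
  have w: "w \<bullet> w \<noteq> 0" using False by (simp add: w_def)
  define f where "f = (\<lambda>y. y - (2 * (y \<bullet> w) / (w \<bullet> w)) *\<^sub>R w)"
  have lin: "linear f" unfolding f_def
    by (rule linearI) (auto simp: inner_add_left algebra_simps add_divide_distrib)
  have ff: "f (f y) = y" for y
    using w by (simp add: f_def inner_diff_left algebra_simps)
  have nf: "norm (f y) = norm y" for y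
  proof -
    have "f y \<bullet> f y = y \<bullet> y" using w
      by (simp add: f_def inner_diff_left inner_diff_right inner_commute[of w y] field_simps)
    then show ?thesis by (simp add: norm_eq_sqrt_inner)
  qed
  have fx: "f x' = x"
  proof -
    have "w \<bullet> w = - (2 * (x' \<bullet> w))"
      using assms by (simp add: w_def inner_diff_left inner_diff_right norm_eq_1 inner_commute[of x x'])
    then have "2 * (x' \<bullet> w) / (w \<bullet> w) = - 1" using w by (simp add: field_simps)
    then show ?thesis by (simp add: f_def w_def)
  qed
  have [measurable]: "f \<in> borel_measurable borel"
    by (intro borel_measurable_continuous_onI linear_continuous_on linear_conv_bounded_linear[THEN iffD1] lin)
  have df: "dist (f a) (f b) = dist a b" for a b
    using nf[of "a - b"] lin by (simp add: dist_norm linear_diff)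
  have sc: "f (y /\<^sub>R norm y) = f y /\<^sub>R norm (f y)" for y
    using lin nf by (simp add: linear_scale)
  let ?g = "\<lambda>y. rker s (dist x (y /\<^sub>R norm y)) * indicator (ball 0 1) y"
  have "rpot s cone_measure x = (\<integral>\<^sup>+y. ?g y \<partial>lborel)"
    unfolding rpot_def by (rule nn_integral_cone_measure) measurable
  also have "\<dots> = (\<integral>\<^sup>+y. ?g (f y) \<partial>lborel)"
  proof -
    have "(\<integral>\<^sup>+y. ?g y \<partial>lborel) = (\<integral>\<^sup>+y. ?g y \<partial>distr lborel borel f)"
      by (simp only: lborel_linear_involution[OF lin ff nf])
    also have "\<dots> = (\<integral>\<^sup>+y. ?g (f y) \<partial>lborel)" by (rule nn_integral_distr) measurable
    finally show ?thesis .
  qed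
  also have "\<dots> = (\<integral>\<^sup>+y. rker s (dist x' (y /\<^sub>R norm y)) * indicator (ball 0 1) y \<partial>lborel)"
  proof (rule nn_integral_cong)
    fix y
    have "dist x (f y /\<^sub>R norm (f y)) = dist x' (y /\<^sub>R norm y)"
      using df[of x' "y /\<^sub>R norm y"] by (simp only: fx sc)
    then show "?g (f y) = rker s (dist x' (y /\<^sub>R norm y)) * indicator (ball 0 1) y"
      by (simp add: nf indicator_def)
  qed
  also have "\<dots> = rpot s cone_measure x'"
    unfolding rpot_def by (rule nn_integral_cone_measure[symmetric]) measurable
  finally show ?thesis .
qed simp

section \<open>Kernel integrals against upper regular measures\<close>

text \<open>Balls may be centred anywhere in the space, since the estimates are applied with poles
  off the support.\<close>

definition upper_reg :: "real \<Rightarrow> nat \<Rightarrow> 'a::euclidean_space measure \<Rightarrow> bool" where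
  "upper_reg C d M \<longleftrightarrow> (\<forall>p r. r > 0 \<longrightarrow> emeasure M (ball p r) \<le> ennreal (C * r ^ d))"

text \<open>The cone over a cap of radius \<open>r\<close> is a thin tube around the segment from 0
  to \<open>p\<close>. About 1/r balls of radius \<open>2 * r\<close> cover it, each of volume of
  order r^(d+1), which leaves r^d.\<close>

lemma cone_measure_ball:
  fixes p :: "'a::euclidean_space"
  assumes dim: "DIM('a) = d + 1" and p: "norm p = 1" and r: "0 < r" "r \<le> 1"
  defines "\<omega> \<equiv> unit_ball_vol (real DIM('a))"
  shows "emeasure cone_measure (ball p r) \<le> ennreal (2 * 2 ^ (d + 1) * \<omega> * r ^ d)"
proof -
  have w: "\<omega> > 0" unfolding \<omega>_def by (rule unit_ball_vol_pos) simp
  \<comment> \<open>The centres are the multiples of \<open>r\<close> along the segment, indices 0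
    to \<open>N\<close>; their number \<open>N + 1\<close> is at most \<open>2 / r\<close> because
    \<open>r \<le> 1\<close>.\<close>
  define N where "N = nat \<lfloor>1 / r\<rfloor>"
  have sub: "{y \<in> ball 0 1. y /\<^sub>R norm y \<in> ball p r} \<subseteq> (\<Union>j\<in>{..N}. ball ((real j * r) *\<^sub>R p) (2 * r))"
  proof
    fix y assume "y \<in> {y \<in> ball 0 1. y /\<^sub>R norm y \<in> ball p r}"
    then have y: "norm y < 1" "norm (y /\<^sub>R norm y - p) < r" by (auto simp: dist_norm norm_minus_commute)
    define j where "j = nat \<lfloor>norm y / r\<rfloor>"
    have "norm y / r \<ge> 0" using r by simp
    then have j: "real j \<le> norm y / r" "norm y / r < real j + 1" unfolding j_def by linarith+
    have "j \<le> N" unfolding j_def N_def using y r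
      by (intro nat_mono floor_mono) (simp add: divide_right_mono)
    have j': "\<bar>norm y - real j * r\<bar> \<le> r" using j r by (auto simp: field_simps abs_le_iff)
    have "norm (y - norm y *\<^sub>R p) \<le> r * norm y"
    proof (cases "y = 0")
      case False
      have "y - norm y *\<^sub>R p = norm y *\<^sub>R (y /\<^sub>R norm y - p)" using False by (simp add: scaleR_diff_right)
      then have "norm (y - norm y *\<^sub>R p) = norm y * norm (y /\<^sub>R norm y - p)" by (metis norm_scaleR abs_norm_cancel)
      also have "\<dots> \<le> norm y * r" using y by (intro mult_left_mono) auto
      finally show ?thesis by (simp add: mult.commute)
    qed simp
    also have "r * norm y < r * 1" using y r by (intro mult_strict_left_mono) auto
    finally have a: "norm (y - norm y *\<^sub>R p) < r" by simp
    have "norm (norm y *\<^sub>R p - (real j * r) *\<^sub>R p) \<le> r"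
      using j' p by (simp flip: scaleR_diff_left)
    then have "norm (y - (real j * r) *\<^sub>R p) < 2 * r"
      using a norm_triangle_ineq[of "y - norm y *\<^sub>R p" "norm y *\<^sub>R p - (real j * r) *\<^sub>R p"] by simp
    then show "y \<in> (\<Union>j\<in>{..N}. ball ((real j * r) *\<^sub>R p) (2 * r))"
      using \<open>j \<le> N\<close> by (auto simp: dist_norm norm_minus_commute)
  qed
  have "emeasure cone_measure (ball p r) = emeasure lborel {y \<in> ball 0 1. y /\<^sub>R norm y \<in> ball p r}"
    by (rule emeasure_cone_measure) simp
  also have "\<dots> \<le> emeasure lborel (\<Union>j\<in>{..N}. ball ((real j * r) *\<^sub>R p) (2 * r))"
    using sub by (intro emeasure_mono) auto
  also have "\<dots> \<le> (\<Sum>j\<in>{..N}. emeasure lborel (ball ((real j * r) *\<^sub>R p) (2 * r)))"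
    by (intro emeasure_subadditive_finite) auto
  also have "\<dots> = (\<Sum>j\<in>{..N}. ennreal (\<omega> * (2 * r) ^ (d + 1)))"
    using r dim by (simp add: emeasure_ball \<omega>_def)
  also have "\<dots> = ennreal (real (N + 1) * (\<omega> * (2 * r) ^ (d + 1)))"
    using w r by (simp only: sum_constant card_atMost ennreal_of_nat_eq_real_of_nat flip: ennreal_mult') simp
  also have "\<dots> \<le> ennreal ((2 / r) * (\<omega> * (2 * r) ^ (d + 1)))"
  proof (intro ennreal_leI mult_right_mono)
    have "real N \<le> 1 / r" using r unfolding N_def by (simp add: of_nat_floor)
    moreover have "1 \<le> 1 / r" using r by simp
    ultimately show "real (N + 1) \<le> 2 / r" by simp
  qed (use w r in auto)
  also have "(2 / r) * (\<omega> * (2 * r) ^ (d + 1)) = 2 * 2 ^ (d + 1) * \<omega> * r ^ d"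
    using r by (simp add: power_mult_distrib field_simps)
  finally show ?thesis .
qed

text \<open>Radii above 1 are covered by the total mass. A ball that meets the sphere is recentred
  on it at twice the radius, and any other ball is null.\<close>

lemma cone_measure_upper_reg:
  assumes dim: "DIM('a::euclidean_space) = d + 1"
  shows "\<exists>C>0. upper_reg C d (cone_measure :: 'a measure)"
proof -
  define \<omega> where "\<omega> = unit_ball_vol (real DIM('a))"
  have w: "\<omega> > 0" unfolding \<omega>_def by (rule unit_ball_vol_pos) simp
  define K where "K = 2 * 2 ^ (d + 1) * \<omega>"
  have "(1::real) \<le> 2 ^ d" by simp
  then have "(1::real) \<le> 2 * 2 ^ (d + 1)" by (simp only: power_add power_one_right)
  from mult_right_mono[OF this, of \<omega>] have K: "K > 0" "\<omega> \<le> K" using w by (auto simp: K_def)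
  have 1: "emeasure cone_measure (ball p r) \<le> ennreal (K * r ^ d)" if "norm p = 1" "r > 0" for p :: 'a and r
  proof (cases "r \<le> 1")
    case True
    then show ?thesis using cone_measure_ball[OF dim that(1) that(2)] by (simp add: K_def \<omega>_def)
  next
    case False
    have "emeasure cone_measure (ball p r) \<le> emeasure cone_measure (UNIV :: 'a set)" by (intro emeasure_mono) auto
    also have "\<dots> = ennreal \<omega>" by (simp add: cone_measure_total \<omega>_def)
    also have "\<dots> \<le> ennreal (K * r ^ d)"
      using mult_mono[of \<omega> K 1 "r ^ d"] K w False by (intro ennreal_leI) (simp add: one_le_power)
    finally show ?thesis .
  qed
  have "upper_reg (K * 2 ^ d) d (cone_measure :: 'a measure)" unfolding upper_reg_def
  proof (intro allI impI)
    fix p :: 'a and r :: real assume r: "r > 0"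
    show "emeasure cone_measure (ball p r) \<le> ennreal (K * 2 ^ d * r ^ d)"
    proof (cases "ball p r \<inter> sphere 0 1 = {}")
      case True
      then have "emeasure cone_measure (ball p r) \<le> emeasure cone_measure (- sphere 0 1 :: 'a set)"
        by (intro emeasure_mono) auto
      then show ?thesis by (simp add: cone_measure_sphere)
    next
      case False
      then obtain p' where p': "dist p p' < r" "norm p' = 1" by auto
      have "ball p r \<subseteq> ball p' (2 * r)"
      proof
        fix z assume "z \<in> ball p r"
        then show "z \<in> ball p' (2 * r)" using p' dist_triangle[of p' z p] by (simp add: dist_commute)
      qed
      then have "emeasure cone_measure (ball p r) \<le> emeasure cone_measure (ball p' (2 * r))"
        by (intro emeasure_mono) auto
      also have "\<dots> \<le> ennreal (K * (2 * r) ^ d)" by (rule 1) (use p' r in auto)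
      finally show ?thesis by (simp add: power_mult_distrib mult.assoc)
    qed
  qed
  then show ?thesis using K by (intro exI[of _ "K * 2 ^ d"]) auto
qed

lemma upper_regD: "upper_reg C d M \<Longrightarrow> r > 0 \<Longrightarrow> emeasure M (ball p r) \<le> ennreal (C * r ^ d)"
  by (simp add: upper_reg_def)

lemma upper_reg_singleton:
  fixes M :: "'a::euclidean_space measure"
  assumes reg: "upper_reg C d M" and d: "d \<ge> 1" and [simp]: "sets M = sets borel"
  shows "emeasure M {p} = 0"
proof -
  have "emeasure M {p} \<le> ennreal (C * r ^ d)" if "r > 0" for r
  proof -
    have "emeasure M {p} \<le> emeasure M (ball p r)" using that by (intro emeasure_mono) auto
    also have "\<dots> \<le> ennreal (C * r ^ d)" by (rule upper_regD[OF reg that])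
    finally show ?thesis .
  qed
  then have "\<forall>\<^sub>F r in at_right 0. emeasure M {p} \<le> ennreal (C * r ^ d)"
    by (auto simp: eventually_at_right_field intro!: exI[of _ 1])
  moreover have "((\<lambda>r. ennreal (C * r ^ d)) \<longlongrightarrow> ennreal (C * 0 ^ d)) (at_right 0)"
    by (intro tendsto_intros)
  ultimately have "emeasure M {p} \<le> ennreal (C * 0 ^ d)"
    using tendsto_lowerbound[of "\<lambda>r. ennreal (C * r ^ d)" _ "at_right (0::real)" "emeasure M {p}"] by simp
  then show ?thesis using d by (cases d) auto
qed

text \<open>Dyadic decomposition: on the shell of radius \<open>b k\<close> the kernel is at most
  \<open>b k powr (- e)\<close>, and the enclosing ball has measure at most
  \<open>C * (2 * b k) ^ d\<close>. Leaving the radii free lets one lemma serve shrinking shells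
  (\<open>e\<close> below \<open>d\<close>) and growing shells (\<open>e\<close> above
  \<open>d\<close>).\<close>

lemma shell_sum:
  fixes M :: "'a::euclidean_space measure"
  assumes reg: "upper_reg C d M" and [measurable_cong]: "sets M = sets borel" and C: "C \<ge> 0"
    and S: "\<And>y. y \<in> S \<Longrightarrow> \<exists>k. b k \<le> dist x y \<and> dist x y < 2 * b k"
    and b: "\<And>k::nat. b k > 0" and T: "(\<lambda>k. b k powr (real d - e)) sums T" and e: "e \<ge> 0"
  shows "(\<integral>\<^sup>+y. rker e (dist x y) * indicator S y \<partial>M) \<le> ennreal (C * 2 ^ d * T)"
proof -
  let ?f = "\<lambda>k y. ennreal (b k powr (- e)) * indicator (ball x (2 * b k)) y"
  have "(\<integral>\<^sup>+y. rker e (dist x y) * indicator S y \<partial>M) \<le> (\<integral>\<^sup>+y. (\<Sum>k. ?f k y) \<partial>M)"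
  proof (rule nn_integral_mono)
    fix y
    show "rker e (dist x y) * indicator S y \<le> (\<Sum>k. ?f k y)"
    proof (cases "y \<in> S")
      case True
      then obtain k where k: "b k \<le> dist x y" "dist x y < 2 * b k" using S by blast
      have "rker e (dist x y) \<le> rker e (b k)" using k b[of k] e by (intro rker_antimono) auto
      also have "\<dots> = ?f k y" using k b[of k] by (simp add: rker_def)
      also have "\<dots> \<le> (\<Sum>k. ?f k y)"
        using sum_le_suminf[OF summableI, of "{k}" "\<lambda>k. ?f k y"]
        by (simp only: sum.insert finite.emptyI finite.insertI empty_iff not_False_eq_True sum.empty add_0_right zero_le simp_thms)
      finally show ?thesis using True by simp
    qed simp
  qed
  also have "\<dots> = (\<Sum>k. \<integral>\<^sup>+y. ?f k y \<partial>M)" by (rule nn_integral_suminf) measurable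
  also have "\<dots> \<le> (\<Sum>k. ennreal (C * 2 ^ d * b k powr (real d - e)))"
  proof (rule suminf_le)
    fix k
    have "(\<integral>\<^sup>+y. ?f k y \<partial>M) = ennreal (b k powr (- e)) * emeasure M (ball x (2 * b k))"
      by (rule nn_integral_cmult_indicator) simp
    also have "\<dots> \<le> ennreal (b k powr (- e)) * ennreal (C * (2 * b k) ^ d)"
      using b[of k] by (intro mult_left_mono upper_regD[OF reg]) auto
    also have "\<dots> = ennreal (b k powr (- e) * (C * (2 * b k) ^ d))" by (rule ennreal_mult'[symmetric]) simp
    also have "b k powr (- e) * (C * (2 * b k) ^ d) = C * 2 ^ d * b k powr (real d - e)"
      using b[of k] by (simp add: power_mult_distrib powr_diff powr_minus powr_realpow field_simps)
    finally show "(\<integral>\<^sup>+y. ?f k y \<partial>M) \<le> ennreal (C * 2 ^ d * b k powr (real d - e))" .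
  qed auto
  also have "\<dots> = ennreal (C * 2 ^ d * T)"
    by (rule suminf_ennreal_eq) (use C T in \<open>auto intro: sums_mult\<close>)
  finally show ?thesis .
qed

lemma geometric_powr_sums:
  fixes q a c :: real
  assumes "q > 0" "q powr a < 1" "c > 0"
  shows "(\<lambda>k. (c * q ^ k) powr a) sums (c powr a / (1 - q powr a))"
proof -
  have "(c * q ^ k) powr a = c powr a * (q powr a) ^ k" for k
  proof -
    have "(q ^ k) powr a = (q powr real k) powr a" using assms by (simp add: powr_realpow)
    also have "\<dots> = (q powr a) powr real k" by (simp add: powr_powr mult.commute)
    also have "\<dots> = (q powr a) ^ k" using assms by (simp add: powr_realpow)
    finally show ?thesis using assms by (simp add: powr_mult)
  qed
  then show ?thesis using sums_mult[OF geometric_sums[of "q powr a"], of "c powr a"] assms by simp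
qed

text \<open>Halving shells give a convergent geometric series because \<open>e\<close> is below
  \<open>d\<close>. The pole itself, where the kernel is infinite, is a null set by upper
  regularity.\<close>

lemma kernel_ball_integral_centred:
  fixes M :: "'a::euclidean_space measure"
  assumes reg: "upper_reg C d M" and sM [measurable_cong]: "sets M = sets borel" and C: "C \<ge> 0"
    and d: "d \<ge> 1" and e: "0 \<le> e" "e < real d"
  shows "\<exists>K>0. \<forall>x r. r > 0 \<longrightarrow> (\<integral>\<^sup>+y. rker e (dist x y) * indicator (ball x r) y \<partial>M) \<le> ennreal (K * r powr (real d - e))"
proof -
  define a where "a = real d - e"
  have a: "a > 0" using e by (simp add: a_def)
  define q where "q = (1/2::real) powr a"
  have q: "q < 1" "q > 0" using a powr01_less_one[of "1/2" a] by (auto simp: q_def)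
  define K where "K = (C + 1) * 2 ^ d * ((1/2) powr a / (1 - q))"
  have K: "K > 0" using C q by (simp add: K_def)
  have "(\<integral>\<^sup>+y. rker e (dist x y) * indicator (ball x r) y \<partial>M) \<le> ennreal (K * r powr a)" if r: "r > 0" for x :: 'a and r
  proof -
    have "AE y in M. y \<noteq> x"
      by (rule AE_I[where N="{x}"]) (use upper_reg_singleton[OF reg d sM] sets_eq_imp_space_eq[OF sM] sM in auto)
    then have "(\<integral>\<^sup>+y. rker e (dist x y) * indicator (ball x r) y \<partial>M) = (\<integral>\<^sup>+y. rker e (dist x y) * indicator (ball x r - {x}) y \<partial>M)"
      by (intro nn_integral_cong_AE) (auto simp: indicator_def)
    also have "\<dots> \<le> ennreal (C * 2 ^ d * ((r / 2) powr a / (1 - q)))"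
    proof (rule shell_sum[OF reg sM C, where b="\<lambda>k. (r / 2) * (1/2) ^ k"])
      show "(\<lambda>k. (r / 2 * (1 / 2) ^ k) powr (real d - e)) sums ((r / 2) powr a / (1 - q))"
        using geometric_powr_sums[of "1/2" a "r/2"] q r by (simp add: a_def q_def)
      fix y assume "y \<in> ball x r - {x}"
      then have y: "dist x y < r" "dist x y > 0" by auto
      obtain k0 where "(1/2::real) ^ k0 < dist x y / r" using real_arch_pow_inv[of "dist x y / r" "1/2"] y r by auto
      then have ex: "r * (1/2) ^ k0 \<le> dist x y" using r by (simp add: field_simps)
      \<comment> \<open>The least index cannot be 0 since \<open>dist x y\<close> is below
        \<open>r\<close>. Its predecessor \<open>j\<close> names the shell, because the shell radii
        start at \<open>r / 2\<close>.\<close>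
      define k where "k = (LEAST k. r * (1/2) ^ k \<le> dist x y)"
      have k: "r * (1/2) ^ k \<le> dist x y" unfolding k_def by (rule LeastI) (rule ex)
      then obtain j where j: "k = Suc j" using y by (cases k) auto
      have "\<not> r * (1/2) ^ j \<le> dist x y" using not_less_Least[of j] j unfolding k_def by force
      then show "\<exists>k. r / 2 * (1 / 2) ^ k \<le> dist x y \<and> dist x y < 2 * (r / 2 * (1 / 2) ^ k)"
        using k j by (intro exI[of _ j]) auto
    qed (use r e in auto)
    also have "\<dots> \<le> ennreal (K * r powr a)"
    proof (rule ennreal_leI)
      have "(r / 2) powr a = r powr a * (1/2) powr a" using r by (simp add: powr_mult[symmetric])
      then have "C * 2 ^ d * ((r / 2) powr a / (1 - q)) = C * (2 ^ d * ((1/2) powr a / (1 - q)) * r powr a)" by simp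
      also have "\<dots> \<le> (C + 1) * (2 ^ d * ((1/2) powr a / (1 - q)) * r powr a)"
        using q by (intro mult_right_mono) auto
      finally show "C * 2 ^ d * ((r / 2) powr a / (1 - q)) \<le> K * r powr a" by (simp add: K_def mult.assoc)
    qed
    finally show ?thesis .
  qed
  then show ?thesis using K by (auto simp: a_def)
qed

text \<open>Moves the ball away from the pole: points of the ball within \<open>r\<close> of the
  pole fall under the centred estimate, and for the others the kernel is at most that at distance
  \<open>r\<close> while the ball has measure of order r^d.\<close>

lemma kernel_ball_integral:
  fixes M :: "'a::euclidean_space measure"
  assumes reg: "upper_reg C d M" and sM [measurable_cong]: "sets M = sets borel" and C: "C \<ge> 0"
    and d: "d \<ge> 1" and e: "0 \<le> e" "e < real d"
  shows "\<exists>K>0. \<forall>x p r. r > 0 \<longrightarrow> (\<integral>\<^sup>+y. rker e (dist x y) * indicator (ball p r) y \<partial>M) \<le> ennreal (K * r powr (real d - e))"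
proof -
  obtain K where K: "K > 0" and *: "\<And>x r. r > 0 \<Longrightarrow> (\<integral>\<^sup>+y. rker e (dist x y) * indicator (ball x r) y \<partial>M) \<le> ennreal (K * r powr (real d - e))"
    using kernel_ball_integral_centred[OF assms] by blast
  show ?thesis
  proof (rule exI[of _ "K + C"], intro conjI allI impI)
    show "K + C > 0" using K C by simp
    fix x p :: 'a and r :: real assume r: "r > 0"
    have "(\<integral>\<^sup>+y. rker e (dist x y) * indicator (ball p r) y \<partial>M) \<le>
       (\<integral>\<^sup>+y. rker e (dist x y) * indicator (ball x r) y + rker e r * indicator (ball p r) y \<partial>M)"
      using rker_antimono[of e r] r e
      by (intro nn_integral_mono) (auto simp: indicator_def not_less)
    also have "\<dots> = (\<integral>\<^sup>+y. rker e (dist x y) * indicator (ball x r) y \<partial>M) + rker e r * emeasure M (ball p r)"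
      by (subst nn_integral_add) (auto simp: nn_integral_cmult_indicator sM simp del: mem_ball)
    also have "\<dots> \<le> ennreal (K * r powr (real d - e)) + rker e r * ennreal (C * r ^ d)"
      by (intro add_mono mult_left_mono * upper_regD[OF reg] r) auto
    also have "rker e r * ennreal (C * r ^ d) = ennreal (C * r powr (real d - e))"
      using r C by (simp add: rker_def powr_diff powr_minus powr_realpow field_simps flip: ennreal_mult)
    also have "ennreal (K * r powr (real d - e)) + \<dots> = ennreal ((K + C) * r powr (real d - e))"
      using K C by (simp add: distrib_right flip: ennreal_plus)
    finally show "(\<integral>\<^sup>+y. rker e (dist x y) * indicator (ball p r) y \<partial>M) \<le> ennreal ((K + C) * r powr (real d - e))" .
  qed
qed

text \<open>Doubling shells; the geometric series now converges because \<open>e\<close> exceeds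
  \<open>d\<close>, and its first term sets the order.\<close>

lemma kernel_far_integral:
  fixes M :: "'a::euclidean_space measure"
  assumes reg: "upper_reg C d M" and sM [measurable_cong]: "sets M = sets borel" and C: "C \<ge> 0"
    and e: "real d < e"
  shows "\<exists>K>0. \<forall>x r. r > 0 \<longrightarrow> (\<integral>\<^sup>+y. rker e (dist x y) * indicator (- ball x r) y \<partial>M) \<le> ennreal (K * r powr (real d - e))"
proof -
  define a where "a = real d - e"
  have a: "a < 0" using e by (simp add: a_def)
  define q where "q = (2::real) powr a"
  have q: "q < 1" "q > 0" using a by (auto simp: q_def powr_less_one)
  define K where "K = (C + 1) * 2 ^ d * (1 / (1 - q))"
  have K: "K > 0" using C q by (simp add: K_def)
  have "(\<integral>\<^sup>+y. rker e (dist x y) * indicator (- ball x r) y \<partial>M) \<le> ennreal (K * r powr a)" if r: "r > 0" for x :: 'a and r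
  proof -
    have "(\<integral>\<^sup>+y. rker e (dist x y) * indicator (- ball x r) y \<partial>M) \<le> ennreal (C * 2 ^ d * (r powr a / (1 - q)))"
    proof (rule shell_sum[OF reg sM C, where b="\<lambda>k. r * 2 ^ k"])
      show "(\<lambda>k. (r * 2 ^ k) powr (real d - e)) sums (r powr a / (1 - q))"
        using geometric_powr_sums[of 2 a r] q r by (simp add: a_def q_def)
      fix y assume "y \<in> - ball x r"
      then have y: "r \<le> dist x y" by auto
      obtain k0 where "dist x y / r < 2 ^ k0" using real_arch_pow[of 2 "dist x y / r"] by auto
      then have ex: "dist x y < r * 2 ^ k0" using r by (simp add: field_simps)
      define k where "k = (LEAST k. dist x y < r * 2 ^ k)"
      have k: "dist x y < r * 2 ^ k" unfolding k_def by (rule LeastI) (rule ex)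
      then obtain j where j: "k = Suc j" using y by (cases k) auto
      have "\<not> dist x y < r * 2 ^ j" using not_less_Least[of j] j unfolding k_def by force
      then show "\<exists>k. r * 2 ^ k \<le> dist x y \<and> dist x y < 2 * (r * 2 ^ k)"
        using k j by (intro exI[of _ j]) auto
    qed (use r e in auto)
    also have "\<dots> \<le> ennreal (K * r powr a)"
    proof (rule ennreal_leI)
      have "C * 2 ^ d * (r powr a / (1 - q)) = C * (2 ^ d * (1 / (1 - q)) * r powr a)" by simp
      also have "\<dots> \<le> (C + 1) * (2 ^ d * (1 / (1 - q)) * r powr a)"
        using q by (intro mult_right_mono) auto
      finally show "C * 2 ^ d * (r powr a / (1 - q)) \<le> K * r powr a" by (simp add: K_def mult.assoc)
    qed
    finally show ?thesis .
  qed
  then show ?thesis using K by (auto simp: a_def)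
qed

lemma kernel_total_integral:
  fixes M :: "'a::euclidean_space measure"
  assumes reg: "upper_reg C d M" and sM [measurable_cong]: "sets M = sets borel" and C: "C \<ge> 0"
    and d: "d \<ge> 1" and e: "0 \<le> e" "e < real d" and sp: "emeasure M (- sphere 0 1) = 0"
  shows "\<exists>K>0. \<forall>x. rpot e M x \<le> ennreal K"
proof -
  obtain K where K: "K > 0" and *: "\<And>x p r. r > 0 \<Longrightarrow> (\<integral>\<^sup>+y. rker e (dist x y) * indicator (ball p r) y \<partial>M) \<le> ennreal (K * r powr (real d - e))"
    using kernel_ball_integral[OF reg sM C d e] by blast
  have ae: "AE y in M. y \<in> sphere 0 1" by (rule AE_supported[OF sM sp]) auto
  have "rpot e M x \<le> ennreal (K * 2 powr (real d - e))" for x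
  proof -
    have "rpot e M x = (\<integral>\<^sup>+y. rker e (dist x y) * indicator (ball 0 2) y \<partial>M)"
      unfolding rpot_def by (rule nn_integral_cong_AE) (use ae in \<open>auto simp: indicator_def\<close>)
    also have "\<dots> \<le> ennreal (K * 2 powr (real d - e))" by (rule *) simp
    finally show ?thesis .
  qed
  then show ?thesis using K by (intro exI[of _ "K * 2 powr (real d - e)"]) auto
qed

section \<open>The equilibrium measure of the unit sphere\<close>

text \<open>Normalised to potential 1 instead of mass 1, so that the inverted measure has exactly
  the kernel with pole \<open>q\<close> as its potential on the sphere, without a constant.\<close>

definition sphere_equilibrium :: "real \<Rightarrow> nat \<Rightarrow> real \<Rightarrow> 'a::euclidean_space measure \<Rightarrow> bool" where
  "sphere_equilibrium s d C M \<longleftrightarrow> finite_measure M \<and> sets M = sets borel \<and> emeasure M (- sphere 0 1) = 0 \<and>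
     upper_reg C d M \<and> (\<forall>x\<in>sphere 0 1. rpot s M x = 1)"

text \<open>The uniform measure divided by its constant potential. That constant is finite by upper
  regularity, and positive because the kernel is positive and the measure is not zero.\<close>

lemma sphere_equilibrium_exists:
  assumes dim: "DIM('a::euclidean_space) = d + 1" and d: "d \<ge> 1" and s: "0 \<le> s" "s < real d"
  shows "\<exists>C>0. \<exists>M :: 'a measure. sphere_equilibrium s d C M"
proof -
  obtain C where C: "C > 0" and reg: "upper_reg C d (cone_measure :: 'a measure)"
    using cone_measure_upper_reg[OF dim] by blast
  obtain K where K: "\<And>x :: 'a. rpot s cone_measure x \<le> ennreal K" "K > 0"
    using kernel_total_integral[OF reg sets_cone_measure _ d s cone_measure_sphere] C by auto
  obtain b :: 'a where b: "b \<in> Basis" using nonempty_Basis by blast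
  have nb: "norm b = 1" using b by simp
  define V where "V = enn2real (rpot s cone_measure b)"
  have Vt: "rpot s cone_measure b < top" using K(1)[of b] by (metis ennreal_less_top order_le_less_trans)
  then have V: "rpot s cone_measure b = ennreal V" by (simp add: V_def)
  have "rpot s cone_measure b \<noteq> 0"
  proof
    assume "rpot s cone_measure b = 0"
    then have "AE y in cone_measure. rker s (dist b y) = 0"
      unfolding rpot_def by (subst (asm) nn_integral_0_iff_AE) auto
    then have "AE y in (cone_measure :: 'a measure). False" using rker_pos by (auto simp: less_le)
    moreover have "(AE y in (cone_measure :: 'a measure). False) \<longleftrightarrow> emeasure cone_measure (space (cone_measure :: 'a measure)) = 0"
      by (rule AE_iff_measurable) (auto simp: sets_eq_imp_space_eq[OF sets_cone_measure])
    ultimately have "emeasure cone_measure (space (cone_measure :: 'a measure)) = 0" by simp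
    then have "ennreal (unit_ball_vol (real DIM('a))) = 0"
      unfolding sets_eq_imp_space_eq[OF sets_cone_measure] space_borel cone_measure_total .
    then show False using unit_ball_vol_pos[of "real DIM('a)"] unfolding ennreal_eq_0_iff by linarith
  qed
  then have V0: "V > 0" unfolding V_def enn2real_positive_iff using Vt by (simp add: zero_less_iff_neq_zero)
  define M where "M = scale_measure (ennreal (1 / V)) (cone_measure :: 'a measure)"
  have sM: "sets M = sets borel" by (simp add: M_def)
  have sp: "space M = UNIV" by (simp add: sets_eq_imp_space_eq[OF sM])
  have "upper_reg (C / V) d M" unfolding upper_reg_def
  proof (intro allI impI)
    fix p :: 'a and r :: real assume "r > 0"
    then have "emeasure M (ball p r) \<le> ennreal (1 / V) * ennreal (C * r ^ d)"
      unfolding M_def emeasure_scale_measure by (intro mult_left_mono upper_regD[OF reg]) auto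
    also have "\<dots> = ennreal (C / V * r ^ d)" using V0 by (simp flip: ennreal_mult')
    finally show "emeasure M (ball p r) \<le> ennreal (C / V * r ^ d)" .
  qed
  moreover have "rpot s M x = 1" if "x \<in> sphere 0 1" for x
  proof -
    have "rpot s M x = ennreal (1 / V) * rpot s cone_measure x"
      unfolding rpot_def M_def by (rule nn_integral_scale_measure) measurable
    also have "rpot s cone_measure x = ennreal V"
      using rpot_cone_measure_const[of x b s] that nb V by simp
    finally show ?thesis using V0 by (simp flip: ennreal_mult')
  qed
  moreover have "emeasure M (- sphere 0 1) = 0" by (simp add: M_def cone_measure_sphere)
  moreover have "finite_measure M"
    by (rule finite_measureI) (simp add: sp, simp add: M_def cone_measure_total ennreal_mult_eq_top_iff)
  ultimately have "sphere_equilibrium s d (C / V) M" using sM by (simp add: sphere_equilibrium_def)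
  then show ?thesis using C V0 by (intro exI[of _ "C / V"]) auto
qed

section \<open>Sweeping a point mass onto the sphere\<close>

definition inversion :: "'a::euclidean_space \<Rightarrow> real \<Rightarrow> 'a \<Rightarrow> 'a" where
  "inversion q k y = q + (k / (norm (y - q))\<^sup>2) *\<^sub>R (y - q)"

lemma inversion_measurable [measurable]: "inversion q k \<in> borel_measurable borel"
  unfolding inversion_def by measurable

lemma dist_inversion_centre: "y \<noteq> q \<Longrightarrow> 0 < k \<Longrightarrow> dist (inversion q k y) q = k / dist y q"
  by (simp add: inversion_def dist_norm power2_eq_square)

lemma inversion_neq_centre: "y \<noteq> q \<Longrightarrow> 0 < k \<Longrightarrow> inversion q k y \<noteq> q"
  using dist_inversion_centre[of y q k] by auto

lemma inversion_inversion:
  assumes "y \<noteq> q" "0 < k" shows "inversion q k (inversion q k y) = y"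
proof -
  have "norm (inversion q k y - q) = k / norm (y - q)"
    using dist_inversion_centre[OF assms] by (simp add: dist_norm)
  moreover have "inversion q k y - q = (k / (norm (y - q))\<^sup>2) *\<^sub>R (y - q)" by (simp add: inversion_def)
  ultimately have "inversion q k (inversion q k y) = q + (k / (k / norm (y - q))\<^sup>2 * (k / (norm (y - q))\<^sup>2)) *\<^sub>R (y - q)"
    by (simp add: inversion_def)
  also have "k / (k / norm (y - q))\<^sup>2 * (k / (norm (y - q))\<^sup>2) = 1"
    using assms by (simp add: power2_eq_square field_simps)
  finally show ?thesis by simp
qed

lemma dist_inversion:
  assumes "y \<noteq> q" "z \<noteq> q" "0 < k"
  shows "dist (inversion q k y) (inversion q k z) = k * dist y z / (dist y q * dist z q)"
proof -
  define a b where "a = y - q" and "b = z - q"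
  have ab: "a \<noteq> 0" "b \<noteq> 0" using assms by (auto simp: a_def b_def)
  have na: "(norm a)\<^sup>2 = a \<bullet> a" "(norm b)\<^sup>2 = b \<bullet> b" by (simp_all add: power2_norm_eq_inner)
  have ne: "a \<bullet> a \<noteq> 0" "b \<bullet> b \<noteq> 0" using ab by auto
  have "(dist (inversion q k y) (inversion q k z))\<^sup>2 = (norm ((k / (a \<bullet> a)) *\<^sub>R a - (k / (b \<bullet> b)) *\<^sub>R b))\<^sup>2"
    by (simp add: inversion_def dist_norm a_def b_def power2_norm_eq_inner)
  also have "\<dots> = k\<^sup>2 * (norm (a - b))\<^sup>2 / ((a \<bullet> a) * (b \<bullet> b))"
    unfolding power2_norm_eq_inner using ne
    by (simp add: inner_diff_left inner_diff_right inner_commute[of b a] power2_eq_square field_simps)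
  also have "\<dots> = (k * norm (a - b) / (norm a * norm b))\<^sup>2"
    by (simp add: na[symmetric] power_mult_distrib power_divide)
  finally have "dist (inversion q k y) (inversion q k z) = k * norm (a - b) / (norm a * norm b)"
    using assms by (subst (asm) power2_eq_iff_nonneg) auto
  then show ?thesis by (simp add: a_def b_def dist_norm)
qed

text \<open>The number \<open>k\<close> is the power of \<open>q\<close> with respect to the unit
  sphere, so the inversion preserves that sphere. The exact factor tells how far from the sphere a
  nearby point is sent.\<close>

lemma norm_inversion:
  fixes q :: "'a::euclidean_space"
  assumes "y \<noteq> q" and k: "k = (norm q)\<^sup>2 - 1"
  shows "(norm (inversion q k y))\<^sup>2 - 1 = k * ((norm y)\<^sup>2 - 1) / (dist y q)\<^sup>2"
proof -
  define a where "a = y - q"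
  have y: "y = q + a" by (simp add: a_def)
  have ne: "a \<bullet> a \<noteq> 0" using assms by (auto simp: a_def)
  have "(norm (inversion q k y))\<^sup>2 = q \<bullet> q + 2 * (k / (a \<bullet> a)) * (q \<bullet> a) + (k / (a \<bullet> a))\<^sup>2 * (a \<bullet> a)"
    unfolding inversion_def power2_norm_eq_inner a_def[symmetric]
    by (simp add: inner_add_left inner_add_right inner_commute[of a q] power2_eq_square algebra_simps)
  also have "\<dots> = q \<bullet> q + k * (2 * (q \<bullet> a) + k) / (a \<bullet> a)"
    using ne by (simp add: power2_eq_square field_simps)
  also have "\<dots> - 1 = k * ((norm y)\<^sup>2 - 1) / (a \<bullet> a)"
  proof -
    have k': "q \<bullet> q = k + 1" using k by (simp add: power2_norm_eq_inner)
    have "(norm y)\<^sup>2 = q \<bullet> q + 2 * (q \<bullet> a) + a \<bullet> a"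
      unfolding y power2_norm_eq_inner by (simp add: inner_add_left inner_add_right inner_commute)
    then show ?thesis using k' ne by (simp add: field_simps)
  qed
  finally show ?thesis by (simp add: a_def dist_norm power2_norm_eq_inner)
qed

lemma rker_mult': "0 < a \<Longrightarrow> 0 \<le> b \<Longrightarrow> rker s a * rker s b = rker s (a * b)"
  by (simp add: rker_mult rker_eq_ennreal)

text \<open>Converts a contraction of distances by \<open>1 - w\<close> into a relative kernel error
  linear in \<open>w\<close>; rests on 1/(1-w) \<le> 1+2w \<le> exp(2w).\<close>

lemma one_minus_powr_le:
  fixes w p :: real
  assumes "0 \<le> w" "w \<le> 1/2" "0 \<le> p"
  shows "(1 - w) powr (- p) \<le> 1 + 2 * p * exp p * w"
proof -
  have "1 \<le> (1 - w) * (1 + 2 * w)"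
    using mult_nonneg_nonneg[of w "1 - 2 * w"] assms by (simp add: algebra_simps)
  then have "1 / (1 - w) \<le> 1 + 2 * w" using assms by (simp add: field_simps)
  also have "\<dots> \<le> exp (2 * w)" by (rule exp_ge_add_one_self)
  finally have "(1 / (1 - w)) powr p \<le> (exp (2 * w)) powr p" using assms by (intro powr_mono2) auto
  moreover have "(1 / (1 - w)) powr p = (1 - w) powr (- p)" using assms by (simp add: powr_divide powr_minus_divide)
  ultimately have 1: "(1 - w) powr (- p) \<le> exp (2 * p * w)" by (simp add: exp_powr_real mult_ac)
  have ez: "exp z \<le> 1 + z * exp z" for z :: real
  proof -
    have "1 - z \<le> exp (- z)" using exp_ge_add_one_self[of "- z"] by simp
    then have "(1 - z) * exp z \<le> exp (- z) * exp z" by (intro mult_right_mono) auto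
    then show ?thesis by (simp add: algebra_simps flip: exp_add)
  qed
  have "2 * p * w \<le> p" using mult_left_mono[of "2 * w" 1 p] assms by simp
  then have "2 * p * w * exp (2 * p * w) \<le> 2 * p * w * exp p" using assms by (intro mult_left_mono) auto
  then show ?thesis using 1 ez[of "2 * p * w"] by (simp add: mult_ac)
qed

lemma one_plus_powr_ge:
  fixes u p :: real
  assumes "0 \<le> u" "0 \<le> p"
  shows "1 - p * u \<le> (1 + u) powr (- p)"
proof -
  have "1 - p * u \<le> 1 - p * ln (1 + u)" using ln_add_one_self_le_self[OF assms(1)] assms by (simp add: mult_left_mono)
  also have "\<dots> \<le> exp (- p * ln (1 + u))" using exp_ge_add_one_self[of "- p * ln (1 + u)"] by simp
  also have "\<dots> = (1 + u) powr (- p)" using assms by (simp add: powr_def)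
  finally show ?thesis .
qed

text \<open>The inversion of power \<open>(norm q)\<^sup>2 - 1\<close> about \<open>q\<close> maps the unit sphere to itself; the density is chosen
  so that the inverted measure has the potential of the unit mass at \<open>q\<close> on the sphere.\<close>

definition swept :: "real \<Rightarrow> 'a::euclidean_space \<Rightarrow> 'a measure \<Rightarrow> 'a measure" where
  "swept s q M = distr (density M (\<lambda>y. rker s (dist y q))) borel (inversion q ((norm q)\<^sup>2 - 1))"

lemma sets_swept [simp, measurable_cong]: "sets (swept s q M) = sets borel"
  by (simp add: swept_def)

lemma nn_integral_swept:
  assumes sM [measurable_cong]: "sets M = sets borel" and [measurable]: "f \<in> borel_measurable borel"
  shows "(\<integral>\<^sup>+z. f z \<partial>swept s q M) = (\<integral>\<^sup>+y. rker s (dist y q) * f (inversion q ((norm q)\<^sup>2 - 1) y) \<partial>M)"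
  unfolding swept_def
  by (subst nn_integral_distr, measurable) (subst nn_integral_density, measurable)

lemma emeasure_swept:
  assumes sM [measurable_cong]: "sets M = sets borel" and [measurable]: "E \<in> sets borel"
  shows "emeasure (swept s q M) E = (\<integral>\<^sup>+y. rker s (dist y q) * indicator E (inversion q ((norm q)\<^sup>2 - 1) y) \<partial>M)"
  using nn_integral_swept[OF sM, of "indicator E" s q] by simp

lemma dist_sphere_outside:
  fixes q :: "'a::euclidean_space"
  assumes "norm q = 1 + t" "norm y = 1" "0 < t"
  shows "t \<le> dist y q"
  using norm_triangle_ineq2[of q y] assms by (simp add: dist_norm norm_minus_commute)

text \<open>The Kelvin transform of potentials: the potential of the inverted measure at
  \<open>x\<close> is that of the original at the inverse of \<open>x\<close>, times the kernel
  between \<open>x\<close> and \<open>q\<close>. The indicator of \<open>E\<close> is carried along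
  so that tails are transformed by the same formula.\<close>

lemma swept_facts:
  fixes q :: "'a::euclidean_space"
  assumes eq: "sphere_equilibrium s d C M" and q: "norm q = 1 + t" and t: "0 < t" "t \<le> 1"
  defines "k \<equiv> (norm q)\<^sup>2 - 1"
  shows swept_k: "0 < k" "2 * t \<le> k" "k \<le> 3 * t"
    and swept_AE: "AE y in M. norm y = 1 \<and> y \<noteq> q \<and> t \<le> dist y q"
    and swept_rpot_on: "x \<noteq> q \<Longrightarrow> E \<in> sets borel \<Longrightarrow>
      (\<integral>\<^sup>+z. rker s (dist x z) * indicator E z \<partial>swept s q M) =
        rker s (dist x q) * (\<integral>\<^sup>+y. rker s (dist (inversion q k x) y) * indicator E (inversion q k y) \<partial>M)"
proof -
  have k: "k = t * (2 + t)" using q by (simp add: k_def power2_eq_square algebra_simps)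
  have "t * 2 \<le> t * (2 + t)" "t * (2 + t) \<le> t * 3" using t by (intro mult_left_mono; simp)+
  then show k': "0 < k" "2 * t \<le> k" "k \<le> 3 * t" using t by (auto simp: k)
  have sM [measurable_cong]: "sets M = sets borel" and sp: "emeasure M (- sphere 0 1) = 0"
    using eq by (auto simp: sphere_equilibrium_def)
  have "AE y in M. y \<in> sphere 0 1" by (rule AE_supported[OF sM sp]) auto
  then show ae: "AE y in M. norm y = 1 \<and> y \<noteq> q \<and> t \<le> dist y q"
    by eventually_elim (use q t dist_sphere_outside[OF q _ t(1)] in auto)
  assume x: "x \<noteq> q" and E [measurable]: "E \<in> sets borel"
  have "(\<integral>\<^sup>+z. rker s (dist x z) * indicator E z \<partial>swept s q M) =
     (\<integral>\<^sup>+y. rker s (dist y q) * (rker s (dist x (inversion q k y)) * indicator E (inversion q k y)) \<partial>M)"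
    unfolding k_def by (rule nn_integral_swept[OF sM]) measurable
  also have "\<dots> = (\<integral>\<^sup>+y. rker s (dist x q) * (rker s (dist (inversion q k x) y) * indicator E (inversion q k y)) \<partial>M)"
  proof (rule nn_integral_cong_AE, use ae in eventually_elim)
    case (elim y)
    let ?x = "inversion q k x"
    have x': "?x \<noteq> q" "inversion q k ?x = x" "dist ?x q = k / dist x q"
      using inversion_neq_centre inversion_inversion dist_inversion_centre x k' by auto
    have "dist x (inversion q k y) = k * dist ?x y / (dist ?x q * dist y q)"
      using dist_inversion[of ?x q y k] x' elim k' by simp
    \<comment> \<open>The distance formula for inverted points makes the density cancel the
      distortion: the two products of distances agree, and hence so do the products of
      kernels.\<close>
    then have "dist y q * dist x (inversion q k y) = dist x q * dist ?x y"
      using x' x elim k' by (simp add: field_simps)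
    then have "rker s (dist y q) * rker s (dist x (inversion q k y)) = rker s (dist x q) * rker s (dist ?x y)"
      using x elim by (subst (1 2) rker_mult') auto
    then show ?case by (simp only: mult.assoc[symmetric])
  qed
  also have "\<dots> = rker s (dist x q) * (\<integral>\<^sup>+y. rker s (dist (inversion q k x) y) * indicator E (inversion q k y) \<partial>M)"
    by (rule nn_integral_cmult) measurable
  finally show "(\<integral>\<^sup>+z. rker s (dist x z) * indicator E z \<partial>swept s q M) = \<dots>" .
qed

lemma swept_rpot:
  fixes q :: "'a::euclidean_space"
  assumes eq: "sphere_equilibrium s d C M" and q: "norm q = 1 + t" and t: "0 < t" "t \<le> 1" and x: "x \<noteq> q"
  shows "rpot s (swept s q M) x = rker s (dist x q) * rpot s M (inversion q ((norm q)\<^sup>2 - 1) x)"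
  using swept_rpot_on[OF eq q t x, of UNIV] by (simp add: rpot_def)

lemma swept_sphere:
  fixes q :: "'a::euclidean_space"
  assumes eq: "sphere_equilibrium s d C M" and q: "norm q = 1 + t" and t: "0 < t" "t \<le> 1"
  shows "emeasure (swept s q M) (- sphere 0 1) = 0"
    and "norm x = 1 \<Longrightarrow> rpot s (swept s q M) x = rker s (dist x q)"
proof -
  have sM: "sets M = sets borel" using eq by (auto simp: sphere_equilibrium_def)
  have n1: "norm (inversion q ((norm q)\<^sup>2 - 1) y) = 1" if "norm y = 1" "y \<noteq> q" for y
    using norm_inversion[OF that(2) refl] that by (simp add: power2_eq_1_iff) (metis norm_ge_zero neg_0_le_iff_le not_one_le_zero)
  have "emeasure (swept s q M) (- sphere 0 1) = (\<integral>\<^sup>+y. 0 \<partial>M)"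
    by (subst emeasure_swept[OF sM], simp, rule nn_integral_cong_AE)
      (use swept_AE[OF eq q t] n1 in \<open>auto simp: indicator_def\<close>)
  then show "emeasure (swept s q M) (- sphere 0 1) = 0" by simp
  assume x: "norm x = 1"
  then have "x \<noteq> q" using q t by auto
  then show "rpot s (swept s q M) x = rker s (dist x q)"
    using swept_rpot[OF eq q t, of x] n1[OF x] eq by (simp add: sphere_equilibrium_def)
qed

section \<open>Potentials near the sphere\<close>

lemma dist_scaleR_unit_sq:
  fixes m y :: "'a::euclidean_space"
  assumes "norm m = 1" "norm y = 1"
  shows "(dist (c *\<^sub>R m) y)\<^sup>2 = (c - 1)\<^sup>2 + c * (dist m y)\<^sup>2"
proof -
  have "(dist (r *\<^sub>R m) y)\<^sup>2 = r * r - 2 * r * (m \<bullet> y) + 1" for r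
    unfolding dist_norm power2_norm_eq_inner using assms
    by (simp add: inner_diff_left inner_diff_right norm_eq_1 inner_commute[of y m] algebra_simps)
  from this[of c] this[of 1] have *: "(dist (c *\<^sub>R m) y)\<^sup>2 = c * c - 2 * c * (m \<bullet> y) + 1"
    and **: "(dist m y)\<^sup>2 = 2 - 2 * (m \<bullet> y)" by simp_all
  show ?thesis unfolding * ** by (simp add: power2_eq_square algebra_simps)
qed

text \<open>Radial projection of \<open>x\<close> to the sphere shortens no distance to the sphere
  by more than it costs: distances from \<open>x\<close> are at least \<open>1 - w\<close> times
  those from the projection, where the potential is 1.\<close>

lemma sphere_rpot_le:
  fixes x :: "'a::euclidean_space"
  assumes eq: "sphere_equilibrium s d C M" and w: "0 \<le> w" "w \<le> 1/2" and x: "\<bar>(norm x)\<^sup>2 - 1\<bar> \<le> w" and s: "0 \<le> s"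
  shows "rpot s M x \<le> ennreal (1 + 2 * s * exp s * w)"
proof -
  have sM [measurable_cong]: "sets M = sets borel" and sp: "emeasure M (- sphere 0 1) = 0"
    using eq by (auto simp: sphere_equilibrium_def)
  have ae: "AE y in M. y \<in> sphere 0 1" by (rule AE_supported[OF sM sp]) auto
  have nx: "1 - w \<le> norm x"
  proof (rule ccontr)
    assume a: "\<not> 1 - w \<le> norm x"
    then have "norm x * norm x \<le> 1 * norm x" using w by (intro mult_right_mono) auto
    then show False using x a by (simp add: power2_eq_square abs_le_iff)
  qed
  then have x0: "x \<noteq> 0" using w by auto
  define m where "m = x /\<^sub>R norm x"
  have m: "norm m = 1" "x = norm x *\<^sub>R m" using x0 by (auto simp: m_def)
  have "rpot s M x \<le> (\<integral>\<^sup>+y. ennreal ((1 - w) powr (- s)) * rker s (dist m y) \<partial>M)"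
    unfolding rpot_def
  proof (rule nn_integral_mono_AE, use ae in eventually_elim)
    case (elim y)
    then have y: "norm y = 1" by simp
    have "(dist x y)\<^sup>2 = (norm x - 1)\<^sup>2 + norm x * (dist m y)\<^sup>2"
      using dist_scaleR_unit_sq[OF m(1) y, of "norm x"] m(2) by simp
    moreover have "norm x * (dist m y)\<^sup>2 \<ge> (1 - w) * (dist m y)\<^sup>2" using nx by (intro mult_right_mono) auto
    moreover have "(1 - w) * (dist m y)\<^sup>2 \<ge> (1 - w)\<^sup>2 * (dist m y)\<^sup>2"
      using w by (intro mult_right_mono) (auto simp: power2_eq_square mult_left_le_one_le)
    ultimately have "((1 - w) * dist m y)\<^sup>2 \<le> (dist x y)\<^sup>2"
      using zero_le_power2[of "norm x - 1"] unfolding power_mult_distrib by linarith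
    then have "(1 - w) * dist m y \<le> dist x y" by (rule power2_le_imp_le) simp
    then show ?case using w s by (intro rker_le_scaled) auto
  qed
  also have "\<dots> = ennreal ((1 - w) powr (- s)) * rpot s M m"
    unfolding rpot_def by (rule nn_integral_cmult) measurable
  also have "rpot s M m = 1" using eq m by (simp add: sphere_equilibrium_def)
  also have "ennreal ((1 - w) powr (- s)) * 1 \<le> ennreal (1 + 2 * s * exp s * w)"
    using one_minus_powr_le[OF w s] by (simp add: ennreal_leI)
  finally show ?thesis .
qed

text \<open>A deviation from the sphere that is quadratic in the distance to \<open>q\<close> is
  inverted to a deviation of order \<open>t\<close>, uniformly in \<open>x\<close>, because the
  factor in \<open>norm_inversion\<close> divides by exactly that square.\<close>

lemma swept_rpot_near_sphere:
  fixes q :: "'a::euclidean_space"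
  assumes eq: "sphere_equilibrium s d C M" and q: "norm q = 1 + t" and t: "0 < t" "t \<le> 1" and s: "0 \<le> s"
    and x: "x \<noteq> q" "\<bar>(norm x)\<^sup>2 - 1\<bar> \<le> B * (dist x q)\<^sup>2" and B: "0 \<le> B" "6 * B * t \<le> 1"
  shows "rpot s (swept s q M) x \<le> ennreal (1 + 6 * s * exp s * B * t) * rker s (dist x q)"
proof -
  define k where "k = (norm q)\<^sup>2 - 1"
  have k: "0 < k" "k \<le> 3 * t" using swept_k[OF eq q t] by (auto simp: k_def)
  have "\<bar>(norm (inversion q k x))\<^sup>2 - 1\<bar> = k * \<bar>(norm x)\<^sup>2 - 1\<bar> / (dist x q)\<^sup>2"
    using norm_inversion[OF x(1) k_def] k by (simp add: abs_mult)
  also have "\<dots> \<le> k * (B * (dist x q)\<^sup>2) / (dist x q)\<^sup>2"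
    using x k by (intro divide_right_mono mult_left_mono) auto
  also have "\<dots> = k * B" using x by simp
  also have "\<dots> \<le> 3 * t * B" using k B by (intro mult_right_mono) auto
  finally have "\<bar>(norm (inversion q k x))\<^sup>2 - 1\<bar> \<le> 3 * t * B" .
  then have "rpot s M (inversion q k x) \<le> ennreal (1 + 2 * s * exp s * (3 * t * B))"
    using B t s by (intro sphere_rpot_le[OF eq]) (auto simp: mult_ac)
  then have "rker s (dist x q) * rpot s M (inversion q k x) \<le> rker s (dist x q) * ennreal (1 + 2 * s * exp s * (3 * t * B))"
    by (rule mult_left_mono) simp
  then show ?thesis unfolding swept_rpot[OF eq q t x(1)] k_def[symmetric] by (simp add: mult_ac)
qed

section \<open>Tails, moments and mass of the swept measure\<close>

text \<open>The exterior of the ball of radius \<eta> about \<open>q\<close> is inverted to the ball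
  of radius \<open>k / \<eta>\<close> about \<open>q\<close>, with \<open>k \<le> 3 * t\<close>.
  Both claims become kernel integrals over this ball, one with pole at the inverted point of
  \<open>x\<close>, the other with pole \<open>q\<close>.\<close>

lemma swept_tail:
  assumes eq: "sphere_equilibrium s d C (M :: 'a::euclidean_space measure)" and d: "d \<ge> 1" and s: "0 \<le> s" "s < real d" and C: "C \<ge> 0"
  shows "\<exists>K>0. \<forall>(q::'a) t. norm q = 1 + t \<and> 0 < t \<and> t \<le> 1 \<longrightarrow>
    (\<forall>x \<eta>. x \<noteq> q \<and> \<eta> > 0 \<longrightarrow> (\<integral>\<^sup>+z. rker s (dist x z) * indicator {z. \<eta> < dist z q} z \<partial>swept s q M)
        \<le> ennreal (K * (t / \<eta>) powr (real d - s)) * rker s (dist x q)) \<and>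
    (\<forall>\<eta>>0. emeasure (swept s q M) {z. \<eta> < dist z q} \<le> ennreal (K * (t / \<eta>) powr (real d - s)))"
proof -
  have sM [measurable_cong]: "sets M = sets borel" and reg: "upper_reg C d M"
    using eq by (auto simp: sphere_equilibrium_def)
  obtain K where K: "K > 0" and *: "\<And>x p r. r > 0 \<Longrightarrow> (\<integral>\<^sup>+y. rker s (dist x y) * indicator (ball p r) y \<partial>M) \<le> ennreal (K * r powr (real d - s))"
    using kernel_ball_integral[OF reg sM C d s] by blast
  define K' where "K' = K * 3 powr (real d - s)"
  have K': "K' > 0" using K by (simp add: K'_def)
  have main: "(\<forall>x \<eta>. x \<noteq> q \<and> \<eta> > 0 \<longrightarrow> (\<integral>\<^sup>+z. rker s (dist x z) * indicator {z. \<eta> < dist z q} z \<partial>swept s q M)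
        \<le> ennreal (K' * (t / \<eta>) powr (real d - s)) * rker s (dist x q)) \<and>
    (\<forall>\<eta>>0. emeasure (swept s q M) {z. \<eta> < dist z q} \<le> ennreal (K' * (t / \<eta>) powr (real d - s)))"
    if q: "norm q = 1 + t" and t: "0 < t" "t \<le> 1" for q :: 'a and t
  proof -
    define k where "k = (norm q)\<^sup>2 - 1"
    have k: "0 < k" "k \<le> 3 * t" using swept_k[OF eq q t] by (auto simp: k_def)
    note ae = swept_AE[OF eq q t]
    have ball: "(\<integral>\<^sup>+y. rker s (dist x y) * indicator (ball q (k / \<eta>)) y \<partial>M) \<le> ennreal (K' * (t / \<eta>) powr (real d - s))" 
      if "\<eta> > 0" for x \<eta>
    proof -
      have "k / \<eta> \<le> 3 * (t / \<eta>)" using k that by (simp add: divide_right_mono)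
      then have "(k / \<eta>) powr (real d - s) \<le> (3 * (t / \<eta>)) powr (real d - s)"
        using k that s by (intro powr_mono2) auto
      also have "\<dots> = 3 powr (real d - s) * (t / \<eta>) powr (real d - s)" using t that by (intro powr_mult) 
      finally have "K * (k / \<eta>) powr (real d - s) \<le> K' * (t / \<eta>) powr (real d - s)"
        using K by (simp add: K'_def)
      moreover have "(\<integral>\<^sup>+y. rker s (dist x y) * indicator (ball q (k / \<eta>)) y \<partial>M) \<le> ennreal (K * (k / \<eta>) powr (real d - s))"
        using k that by (intro *) auto
      ultimately show ?thesis using ennreal_leI order_trans by blast
    qed
    have set: "indicator {z. \<eta> < dist z q} (inversion q k y) = (indicator (ball q (k / \<eta>)) y :: ennreal)"
      if "y \<noteq> q" "\<eta> > 0" for y \<eta>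
    proof -
      have "\<eta> < k / dist y q \<longleftrightarrow> dist y q < k / \<eta>" using that by (simp add: field_simps)
      then show ?thesis
        using dist_inversion_centre[OF that(1) k(1)] by (simp add: indicator_def dist_commute[of q y])
    qed
    show ?thesis
    proof (intro conjI allI impI)
      fix x \<eta> assume x: "x \<noteq> q \<and> (\<eta>::real) > 0"
      have "(\<integral>\<^sup>+z. rker s (dist x z) * indicator {z. \<eta> < dist z q} z \<partial>swept s q M) =
        rker s (dist x q) * (\<integral>\<^sup>+y. rker s (dist (inversion q k x) y) * indicator {z. \<eta> < dist z q} (inversion q k y) \<partial>M)"
        unfolding k_def using x by (intro swept_rpot_on[OF eq q t]) auto
      also have "(\<integral>\<^sup>+y. rker s (dist (inversion q k x) y) * indicator {z. \<eta> < dist z q} (inversion q k y) \<partial>M)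
        = (\<integral>\<^sup>+y. rker s (dist (inversion q k x) y) * indicator (ball q (k / \<eta>)) y \<partial>M)"
        by (rule nn_integral_cong_AE) (use ae set x in auto)
      also have "rker s (dist x q) * \<dots> \<le> rker s (dist x q) * ennreal (K' * (t / \<eta>) powr (real d - s))"
        using x by (intro mult_left_mono ball) auto
      finally show "(\<integral>\<^sup>+z. rker s (dist x z) * indicator {z. \<eta> < dist z q} z \<partial>swept s q M)
        \<le> ennreal (K' * (t / \<eta>) powr (real d - s)) * rker s (dist x q)" by (simp add: mult.commute)
    next
      fix \<eta> :: real assume e: "\<eta> > 0"
      have "emeasure (swept s q M) {z. \<eta> < dist z q} = (\<integral>\<^sup>+y. rker s (dist y q) * indicator {z. \<eta> < dist z q} (inversion q k y) \<partial>M)"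
        unfolding k_def by (rule emeasure_swept[OF sM]) simp
      also have "\<dots> = (\<integral>\<^sup>+y. rker s (dist q y) * indicator (ball q (k / \<eta>)) y \<partial>M)"
        by (rule nn_integral_cong_AE) (use ae set e in \<open>auto simp: dist_commute\<close>)
      also have "\<dots> \<le> ennreal (K' * (t / \<eta>) powr (real d - s))" by (rule ball[OF e])
      finally show "emeasure (swept s q M) {z. \<eta> < dist z q} \<le> ennreal (K' * (t / \<eta>) powr (real d - s))" .
    qed
  qed
  show ?thesis by (rule exI[of _ K'], intro conjI allI impI K') (use main in blast)+
qed

text \<open>Inversion turns the moment of order \<open>e\<close> into \<open>k powr e\<close> times
  a kernel integral of exponent \<open>s + e\<close> over the sphere, all of which has distance at
  least \<open>t\<close> from \<open>q\<close>. Below exponent \<open>d\<close> this integral is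
  bounded; above it, it grows like \<open>t powr (real d - (s + e))\<close>.\<close>

lemma swept_moment:
  assumes eq: "sphere_equilibrium s d C (M :: 'a::euclidean_space measure)" and d: "d \<ge> 1" and s: "0 \<le> s" "s < real d" and C: "C \<ge> 0"
  shows swept_moment_low: "0 \<le> e \<Longrightarrow> s + e < real d \<Longrightarrow> \<exists>K>0. \<forall>(q::'a) t. norm q = 1 + t \<and> 0 < t \<and> t \<le> 1 \<longrightarrow>
      (\<integral>\<^sup>+z. ennreal (dist z q powr e) \<partial>swept s q M) \<le> ennreal (K * t powr e)"
    and swept_moment_high: "0 \<le> e \<Longrightarrow> s + e > real d \<Longrightarrow> \<exists>K>0. \<forall>(q::'a) t. norm q = 1 + t \<and> 0 < t \<and> t \<le> 1 \<longrightarrow>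
      (\<integral>\<^sup>+z. ennreal (dist z q powr e) \<partial>swept s q M) \<le> ennreal (K * t powr (real d - s))"
proof -
  have sM [measurable_cong]: "sets M = sets borel" and reg: "upper_reg C d M" and sp: "emeasure M (- sphere 0 1) = 0"
    using eq by (auto simp: sphere_equilibrium_def)
  have mom: "(\<integral>\<^sup>+z. ennreal (dist z q powr e) \<partial>swept s q M) \<le> ennreal (3 powr e * t powr e) *
      (\<integral>\<^sup>+y. rker (s + e) (dist q y) * indicator (- ball q t) y \<partial>M)"
    if q: "norm q = 1 + t" and t: "0 < t" "t \<le> 1" and e: "0 \<le> e" for q :: 'a and t e
  proof -
    define k where "k = (norm q)\<^sup>2 - 1"
    have k: "0 < k" "k \<le> 3 * t" using swept_k[OF eq q t] by (auto simp: k_def)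
    have "(\<integral>\<^sup>+z. ennreal (dist z q powr e) \<partial>swept s q M) = (\<integral>\<^sup>+y. rker s (dist y q) * ennreal (dist (inversion q k y) q powr e) \<partial>M)"
      unfolding k_def by (rule nn_integral_swept[OF sM]) measurable
    also have "\<dots> \<le> (\<integral>\<^sup>+y. ennreal (3 powr e * t powr e) * (rker (s + e) (dist q y) * indicator (- ball q t) y) \<partial>M)"
    proof (rule nn_integral_mono_AE, use swept_AE[OF eq q t] in eventually_elim)
      case (elim y)
      have D: "dist y q > 0" using elim by simp
      have "dist (inversion q k y) q powr e = k powr e * dist y q powr (- e)"
        using dist_inversion_centre[of y q k] elim k by (simp add: powr_divide powr_minus_divide)
      also have "\<dots> \<le> (3 powr e * t powr e) * dist y q powr (- e)"
        using powr_mono2[of e k "3 * t"] k t e by (intro mult_right_mono) (auto simp: powr_mult)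
      finally have "rker s (dist y q) * ennreal (dist (inversion q k y) q powr e)
          \<le> rker s (dist y q) * ennreal ((3 powr e * t powr e) * dist y q powr (- e))"
        by (intro mult_left_mono ennreal_leI) auto
      also have "\<dots> = ennreal (3 powr e * t powr e) * (rker (s + e) (dist q y) * indicator (- ball q t) y)"
        using D elim by (simp add: rker_eq_ennreal dist_commute[of q] powr_add powr_diff powr_minus field_simps flip: ennreal_mult)
      finally show ?case .
    qed
    also have "\<dots> = ennreal (3 powr e * t powr e) * (\<integral>\<^sup>+y. rker (s + e) (dist q y) * indicator (- ball q t) y \<partial>M)"
      by (rule nn_integral_cmult) measurable
    finally show ?thesis .
  qed
  {
    assume e: "0 \<le> e" "s + e < real d"
    obtain K where K: "K > 0" and *: "\<And>x. rpot (s + e) M x \<le> ennreal K"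
      using kernel_total_integral[OF reg sM C d _ _ sp, of "s + e"] e s by auto
    have "(\<integral>\<^sup>+z. ennreal (dist z q powr e) \<partial>swept s q M) \<le> ennreal (3 powr e * K * t powr e)"
      if q: "norm q = 1 + t" and t: "0 < t" "t \<le> 1" for q :: 'a and t
    proof -
      have "(\<integral>\<^sup>+y. rker (s + e) (dist q y) * indicator (- ball q t) y \<partial>M) \<le> rpot (s + e) M q"
        unfolding rpot_def by (intro nn_integral_mono) (auto simp: indicator_def)
      also have "\<dots> \<le> ennreal K" by (rule *)
      finally have "ennreal (3 powr e * t powr e) * (\<integral>\<^sup>+y. rker (s + e) (dist q y) * indicator (- ball q t) y \<partial>M)
          \<le> ennreal (3 powr e * t powr e) * ennreal K" by (rule mult_left_mono) simp
      also have "\<dots> = ennreal (3 powr e * K * t powr e)" using K by (simp add: mult_ac flip: ennreal_mult)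
      finally show ?thesis using mom[OF q t e(1)] by (rule order_trans[rotated])
    qed
    then show "\<exists>K>0. \<forall>(q::'a) t. norm q = 1 + t \<and> 0 < t \<and> t \<le> 1 \<longrightarrow>
      (\<integral>\<^sup>+z. ennreal (dist z q powr e) \<partial>swept s q M) \<le> ennreal (K * t powr e)"
      using K by (intro exI[of _ "3 powr e * K"]) auto
  }
  {
    assume e: "0 \<le> e" "s + e > real d"
    obtain K where K: "K > 0" and *: "\<And>x r. r > 0 \<Longrightarrow> (\<integral>\<^sup>+y. rker (s + e) (dist x y) * indicator (- ball x r) y \<partial>M) \<le> ennreal (K * r powr (real d - (s + e)))"
      using kernel_far_integral[OF reg sM C e(2)] by blast
    have "(\<integral>\<^sup>+z. ennreal (dist z q powr e) \<partial>swept s q M) \<le> ennreal (3 powr e * K * t powr (real d - s))"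
      if q: "norm q = 1 + t" and t: "0 < t" "t \<le> 1" for q :: 'a and t
    proof -
      have "ennreal (3 powr e * t powr e) * (\<integral>\<^sup>+y. rker (s + e) (dist q y) * indicator (- ball q t) y \<partial>M)
          \<le> ennreal (3 powr e * t powr e) * ennreal (K * t powr (real d - (s + e)))"
        by (intro mult_left_mono * t) auto
      also have "\<dots> = ennreal (3 powr e * K * (t powr e * t powr (real d - (s + e))))" 
        using K by (simp add: mult_ac flip: ennreal_mult)
      also have "t powr e * t powr (real d - (s + e)) = t powr (real d - s)" by (simp flip: powr_add)
      finally show ?thesis using mom[OF q t e(1)] by (rule order_trans[rotated])
    qed
    then show "\<exists>K>0. \<forall>(q::'a) t. norm q = 1 + t \<and> 0 < t \<and> t \<le> 1 \<longrightarrow>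
      (\<integral>\<^sup>+z. ennreal (dist z q powr e) \<partial>swept s q M) \<le> ennreal (K * t powr (real d - s))"
      using K by (intro exI[of _ "3 powr e * K"]) auto
  }
qed

text \<open>The mass is the potential of the sphere measure at \<open>q\<close>. It is compared with
  the value 1 at the radial projection \<open>n\<close> of \<open>q\<close>, which is closer than
  \<open>q\<close> to every point of the sphere.\<close>

lemma swept_mass:
  assumes eq: "sphere_equilibrium s d C (M :: 'a::euclidean_space measure)" and d: "d \<ge> 1"
    and s: "0 < s" "real d - 1 \<le> s" "s < real d" and C: "C \<ge> 0"
  shows "\<exists>K>0. \<forall>(q::'a) t. norm q = 1 + t \<and> 0 < t \<and> t \<le> 1 \<longrightarrow>
     1 \<le> emeasure (swept s q M) UNIV + ennreal (K * t powr (real d - s)) \<and> emeasure (swept s q M) UNIV \<le> 1"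
proof -
  have sM [measurable_cong]: "sets M = sets borel" and reg: "upper_reg C d M"
    using eq by (auto simp: sphere_equilibrium_def)
  define \<beta> where "\<beta> = real d - s"
  have \<beta>: "0 < \<beta>" "\<beta> \<le> 1" using s by (auto simp: \<beta>_def)
  obtain K1 where K1: "K1 > 0" and *: "\<And>x p r. r > 0 \<Longrightarrow> (\<integral>\<^sup>+y. rker s (dist x y) * indicator (ball p r) y \<partial>M) \<le> ennreal (K1 * r powr \<beta>)"
    using kernel_ball_integral[OF reg sM C d] s unfolding \<beta>_def by (meson less_imp_le)
  obtain K2 where K2: "K2 > 0" and **: "\<And>x r. r > 0 \<Longrightarrow> (\<integral>\<^sup>+y. rker (s + 2) (dist x y) * indicator (- ball x r) y \<partial>M) \<le> ennreal (K2 * r powr (real d - (s + 2)))"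
    using kernel_far_integral[OF reg sM C, of "s + 2"] s by auto
  define K where "K = K1 + s / 2 + s / 2 * K2"
  have K: "K > 0" using K1 K2 s by (simp add: K_def add_pos_pos)
  have main: "1 \<le> emeasure (swept s q M) UNIV + ennreal (K * t powr \<beta>) \<and> emeasure (swept s q M) UNIV \<le> 1"
    if q: "norm q = 1 + t" and t: "0 < t" "t \<le> 1" for q :: 'a and t
  proof
    have mass: "emeasure (swept s q M) UNIV = rpot s M q"
      by (subst emeasure_swept[OF sM]) (auto simp: rpot_def dist_commute)
    note ae = swept_AE[OF eq q t]
    define n where "n = q /\<^sub>R norm q"
    have n: "norm n = 1" "q = (1 + t) *\<^sub>R n" using q t by (auto simp: n_def)
    have "rpot s M q \<le> rpot s M n" unfolding rpot_def
    proof (rule nn_integral_mono_AE, use ae in eventually_elim)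
      case (elim y)
      have "(dist n y)\<^sup>2 \<le> (dist q y)\<^sup>2"
        using dist_scaleR_unit_sq[OF n(1), of y "1 + t"] elim t unfolding n(2)[symmetric] by (simp add: distrib_right)
      then have "dist n y \<le> dist q y" by (rule power2_le_imp_le) simp
      then show ?case using s by (intro rker_antimono) auto
    qed
    also have "\<dots> = 1" using eq n by (simp add: sphere_equilibrium_def)
    finally show "emeasure (swept s q M) UNIV \<le> 1" by (simp add: mass)
    have "1 = rpot s M n" using eq n by (simp add: sphere_equilibrium_def)
    \<comment> \<open>Inside the ball of radius \<open>t\<close> about \<open>n\<close> the whole
      kernel counts as loss; outside it only the first order change of the kernel between
      \<open>n\<close> and \<open>q\<close> does.\<close>
    also have "\<dots> \<le> (\<integral>\<^sup>+y. rker s (dist q y) + rker s (dist n y) * indicator (ball n t) y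
        + ennreal (s / 2 * t) * rker s (dist n y) + ennreal (s / 2 * t\<^sup>2) * (rker (s + 2) (dist n y) * indicator (- ball n t) y) \<partial>M)"
      unfolding rpot_def
    proof (rule nn_integral_mono_AE, use ae in eventually_elim)
      case (elim y)
      show ?case
      proof (cases "dist n y < t")
        case True
        then show ?thesis by (simp add: add_increasing add_increasing2)
      next
        case False
        define a where "a = dist n y"
        have a: "a \<ge> t" "a > 0" using False t by (auto simp: a_def)
        \<comment> \<open>In this form the Bernoulli bound of exponent \<open>s / 2\<close> yields
          one loss proportional to \<open>t\<close> and one to the square of \<open>t / a\<close>;
          the latter raises the kernel exponent to \<open>s + 2\<close>, which exceeds
          \<open>d\<close>.\<close>
        have "(dist q y)\<^sup>2 = t\<^sup>2 + (1 + t) * a\<^sup>2"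
          using dist_scaleR_unit_sq[OF n(1), of y "1 + t"] elim unfolding n(2)[symmetric] a_def by simp
        also have "\<dots> = a\<^sup>2 * (1 + (t + t\<^sup>2 / a\<^sup>2))" using a by (simp add: field_simps)
        finally have D: "(dist q y)\<^sup>2 = a\<^sup>2 * (1 + (t + t\<^sup>2 / a\<^sup>2))" .
        have Dp: "dist q y > 0" using elim by (simp add: dist_commute[of q])
        have pw: "x powr (- s) = (x\<^sup>2) powr (- (s / 2))" if "x > 0" for x
          using that powr_powr[of x 2 "- (s / 2)"] by simp
        have "a powr (- s) * (1 - s / 2 * (t + t\<^sup>2 / a\<^sup>2)) \<le> a powr (- s) * (1 + (t + t\<^sup>2 / a\<^sup>2)) powr (- (s / 2))"
          using t s by (intro mult_left_mono one_plus_powr_ge) auto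
        also have "\<dots> = dist q y powr (- s)"
          using a t Dp by (simp add: pw D powr_mult)
        finally have "a powr (- s) \<le> dist q y powr (- s) + s / 2 * t * a powr (- s) + s / 2 * t\<^sup>2 * (a powr (- s) / a\<^sup>2)"
          by (simp add: algebra_simps)
        also have "a powr (- s) / a\<^sup>2 = a powr (- (s + 2))" using a by (simp add: powr_diff)
        finally have "ennreal (a powr (- s)) \<le> ennreal (dist q y powr (- s) + s / 2 * t * a powr (- s) + s / 2 * t\<^sup>2 * a powr (- (s + 2)))"
          by (rule ennreal_leI)
        also have "\<dots> = ennreal (dist q y powr (- s)) + ennreal (s / 2 * t) * ennreal (a powr (- s)) + ennreal (s / 2 * t\<^sup>2) * ennreal (a powr (- (s + 2)))"
          using s t by (simp only: ennreal_mult[symmetric] ennreal_plus[symmetric] powr_ge_zero mult_nonneg_nonneg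
              add_nonneg_nonneg less_imp_le zero_le_power2 divide_nonneg_nonneg zero_le_numeral)
        finally show ?thesis using False a Dp by (simp add: rker_eq_ennreal flip: a_def)
      qed
    qed
    also have "\<dots> = rpot s M q + (\<integral>\<^sup>+y. rker s (dist n y) * indicator (ball n t) y \<partial>M)
        + ennreal (s / 2 * t) * rpot s M n + ennreal (s / 2 * t\<^sup>2) * (\<integral>\<^sup>+y. rker (s + 2) (dist n y) * indicator (- ball n t) y \<partial>M)"
      unfolding rpot_def
      apply (subst nn_integral_add, measurable)+
      apply (subst nn_integral_cmult, measurable)+
      done
    also have "\<dots> \<le> rpot s M q + ennreal (K1 * t powr \<beta>) + ennreal (s / 2 * t) * 1 + ennreal (s / 2 * t\<^sup>2) * ennreal (K2 * t powr (real d - (s + 2)))"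
      using eq n by (intro add_mono mult_left_mono * ** t order_refl) (auto simp: sphere_equilibrium_def)
    also have "\<dots> = rpot s M q + ennreal (K1 * t powr \<beta> + s / 2 * t + s / 2 * K2 * (t\<^sup>2 * t powr (real d - (s + 2))))"
    proof -
      define P where "P = t powr (real d - (s + 2))"
      have "ennreal (s / 2 * t\<^sup>2) * ennreal (K2 * P) = ennreal (s / 2 * K2 * (t\<^sup>2 * P))"
        using K2 s t by (simp add: P_def ennreal_mult'[symmetric] mult_ac)
      moreover have "ennreal (K1 * t powr \<beta> + s / 2 * t + s / 2 * K2 * (t\<^sup>2 * P)) =
          ennreal (K1 * t powr \<beta>) + ennreal (s / 2 * t) + ennreal (s / 2 * K2 * (t\<^sup>2 * P))"
        using K1 K2 s t by (subst ennreal_plus, simp add: P_def, simp add: P_def, subst ennreal_plus) auto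
      ultimately show ?thesis by (simp only: P_def[symmetric] mult_1_right add.assoc)
    qed
    also have "t\<^sup>2 * t powr (real d - (s + 2)) = t powr \<beta>"
    proof -
      have "t\<^sup>2 = t powr 2" using t by simp
      moreover have "2 + (real d - (s + 2)) = \<beta>" by (simp add: \<beta>_def)
      ultimately show ?thesis by (simp only: powr_add[symmetric])
    qed
    also have "rpot s M q + ennreal (K1 * t powr \<beta> + s / 2 * t + s / 2 * K2 * t powr \<beta>) \<le> rpot s M q + ennreal (K * t powr \<beta>)"
    proof (intro add_left_mono ennreal_leI)
      \<comment> \<open>The assumption d - 1 \<le> s, in the form \<beta> \<le> 1, absorbs the
        linear loss.\<close>
      have "t powr 1 \<le> t powr \<beta>" using \<beta> t by (intro powr_mono') auto
      then have "s / 2 * t \<le> s / 2 * t powr \<beta>" using s t by (intro mult_left_mono) auto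
      then show "K1 * t powr \<beta> + s / 2 * t + s / 2 * K2 * t powr \<beta> \<le> K * t powr \<beta>" by (simp add: K_def distrib_right)
    qed
    finally show "1 \<le> emeasure (swept s q M) UNIV + ennreal (K * t powr \<beta>)" by (simp add: mass)
  qed
  show ?thesis by (rule exI[of _ K], intro conjI allI impI K) (use main in \<open>auto simp: \<beta>_def\<close>)
qed

text \<open>The properties of the swept measure that the proof uses, moved to the unit sphere tangent at \<open>x0\<close>.
  The moment exponents 9/10 and 6/5 (times \<open>real d - s\<close>) only have to lie on either side of 1: the first
  moment is then of the order of the pole distance \<open>t\<close> to its own exponent, the second one of order
  \<open>t powr (real d - s)\<close>.\<close>

definition sweep :: "real \<Rightarrow> nat \<Rightarrow> real \<Rightarrow> 'a::euclidean_space \<Rightarrow> 'a \<Rightarrow> real \<Rightarrow> 'a measure \<Rightarrow> bool" where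
  "sweep s d K x0 n t N \<longleftrightarrow> (let q = x0 + t *\<^sub>R n; \<beta> = real d - s in
     finite_measure N \<and> sets N = sets borel \<and> emeasure N (- sphere (x0 - n) 1) = 0 \<and>
     1 \<le> emeasure N UNIV + ennreal (K * t powr \<beta>) \<and> emeasure N UNIV \<le> 1 \<and>
     (\<forall>x\<in>sphere (x0 - n) 1. rpot s N x = rker s (dist x q)) \<and>
     (\<forall>x B. x \<noteq> q \<and> 0 \<le> B \<and> 6 * B * t \<le> 1 \<and> \<bar>(dist x (x0 - n))\<^sup>2 - 1\<bar> \<le> B * (dist x q)\<^sup>2 \<longrightarrow>
        rpot s N x \<le> ennreal (1 + K * B * t) * rker s (dist x q)) \<and>
     (\<forall>x \<eta>. x \<noteq> q \<and> \<eta> > 0 \<longrightarrow> (\<integral>\<^sup>+z. rker s (dist x z) * indicator {z. \<eta> < dist z q} z \<partial>N)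
        \<le> ennreal (K * (t / \<eta>) powr \<beta>) * rker s (dist x q)) \<and>
     (\<forall>\<eta>>0. emeasure N {z. \<eta> < dist z q} \<le> ennreal (K * (t / \<eta>) powr \<beta>)) \<and>
     (\<integral>\<^sup>+z. ennreal (dist z q powr (9/10 * \<beta>)) \<partial>N) \<le> ennreal (K * t powr (9/10 * \<beta>)) \<and>
     (\<integral>\<^sup>+z. ennreal (dist z q powr (6/5 * \<beta>)) \<partial>N) \<le> ennreal (K * t powr \<beta>))"

lemma
  assumes "sweep s d K x0 n t N"
  shows sweep_finite: "finite_measure N"
    and sweep_sets: "sets N = sets borel"
    and sweep_support: "emeasure N (- sphere (x0 - n) 1) = 0"
    and sweep_mass: "1 \<le> emeasure N UNIV + ennreal (K * t powr (real d - s))"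
    and sweep_mass_le: "emeasure N UNIV \<le> 1"
    and sweep_rpot: "x \<in> sphere (x0 - n) 1 \<Longrightarrow> rpot s N x = rker s (dist x (x0 + t *\<^sub>R n))"
    and sweep_rpot_near: "x \<noteq> x0 + t *\<^sub>R n \<Longrightarrow> 0 \<le> B \<Longrightarrow> 6 * B * t \<le> 1 \<Longrightarrow>
      \<bar>(dist x (x0 - n))\<^sup>2 - 1\<bar> \<le> B * (dist x (x0 + t *\<^sub>R n))\<^sup>2 \<Longrightarrow>
      rpot s N x \<le> ennreal (1 + K * B * t) * rker s (dist x (x0 + t *\<^sub>R n))"
    and sweep_tail: "x \<noteq> x0 + t *\<^sub>R n \<Longrightarrow> 0 < \<eta> \<Longrightarrow>
      (\<integral>\<^sup>+z. rker s (dist x z) * indicator {z. \<eta> < dist z (x0 + t *\<^sub>R n)} z \<partial>N)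
        \<le> ennreal (K * (t / \<eta>) powr (real d - s)) * rker s (dist x (x0 + t *\<^sub>R n))"
    and sweep_tail_mass: "0 < \<eta> \<Longrightarrow>
      emeasure N {z. \<eta> < dist z (x0 + t *\<^sub>R n)} \<le> ennreal (K * (t / \<eta>) powr (real d - s))"
    and sweep_moment_low: "(\<integral>\<^sup>+z. ennreal (dist z (x0 + t *\<^sub>R n) powr (9/10 * (real d - s))) \<partial>N)
      \<le> ennreal (K * t powr (9/10 * (real d - s)))"
    and sweep_moment_high: "(\<integral>\<^sup>+z. ennreal (dist z (x0 + t *\<^sub>R n) powr (6/5 * (real d - s))) \<partial>N)
      \<le> ennreal (K * t powr (real d - s))"
  using assms[unfolded sweep_def Let_def] by simp_all

text \<open>The sphere measure is fixed once; the measure for given \<open>x0\<close>,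
  \<open>n\<close>, \<open>t\<close> is a translate of its inversion about
  \<open>(1 + t) *\<^sub>R n\<close>. All constants therefore come from that one measure, and
  \<open>K\<close> is uniform.\<close>

lemma sweep_exists:
  assumes dim: "DIM('a::euclidean_space) = d + 1" and d: "d \<ge> 1"
    and s: "0 < s" "real d - 1 \<le> s" "s < real d"
  shows "\<exists>K>0. \<forall>(x0::'a) n t. norm n = 1 \<and> 0 < t \<and> t \<le> 1 \<longrightarrow> (\<exists>N. sweep s d K x0 n t N)"
proof -
  define \<beta> where "\<beta> = real d - s"
  have \<beta>: "0 < \<beta>" "\<beta> \<le> 1" using s by (auto simp: \<beta>_def)
  have s0: "0 \<le> s" using s by simp
  obtain C and M :: "'a measure" where C: "C > 0" and eq: "sphere_equilibrium s d C M"
    using sphere_equilibrium_exists[OF dim d s0 s(3)] by blast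
  then have C0: "C \<ge> 0" by simp
  have sM: "sets M = sets borel" using eq by (auto simp: sphere_equilibrium_def)
  obtain K1 where K1: "K1 > 0" "\<And>(q::'a) t. norm q = 1 + t \<and> 0 < t \<and> t \<le> 1 \<longrightarrow>
    (\<forall>x \<eta>. x \<noteq> q \<and> \<eta> > 0 \<longrightarrow> (\<integral>\<^sup>+z. rker s (dist x z) * indicator {z. \<eta> < dist z q} z \<partial>swept s q M)
        \<le> ennreal (K1 * (t / \<eta>) powr \<beta>) * rker s (dist x q)) \<and>
    (\<forall>\<eta>>0. emeasure (swept s q M) {z. \<eta> < dist z q} \<le> ennreal (K1 * (t / \<eta>) powr \<beta>))"
    using swept_tail[OF eq d s0 s(3) C0] unfolding \<beta>_def by blast
  have e1: "0 \<le> 9/10 * \<beta>" using \<beta> by simp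
  have e2: "s + 9/10 * \<beta> < real d" using \<beta> unfolding \<beta>_def by argo
  from swept_moment_low[OF eq d s0 s(3) C0 e1 e2]
  obtain K2 where K2: "K2 > 0" "\<And>(q::'a) t. norm q = 1 + t \<and> 0 < t \<and> t \<le> 1 \<longrightarrow>
      (\<integral>\<^sup>+z. ennreal (dist z q powr (9/10 * \<beta>)) \<partial>swept s q M) \<le> ennreal (K2 * t powr (9/10 * \<beta>))"
    by blast
  have e3: "0 \<le> 6/5 * \<beta>" using \<beta> by simp
  have e4: "s + 6/5 * \<beta> > real d" using \<beta> unfolding \<beta>_def by argo
  from swept_moment_high[OF eq d s0 s(3) C0 e3 e4]
  obtain K3 where K3: "K3 > 0" "\<And>(q::'a) t. norm q = 1 + t \<and> 0 < t \<and> t \<le> 1 \<longrightarrow>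
      (\<integral>\<^sup>+z. ennreal (dist z q powr (6/5 * \<beta>)) \<partial>swept s q M) \<le> ennreal (K3 * t powr \<beta>)"
    unfolding \<beta>_def by blast
  obtain K4 where K4: "K4 > 0" "\<And>(q::'a) t. norm q = 1 + t \<and> 0 < t \<and> t \<le> 1 \<longrightarrow>
     1 \<le> emeasure (swept s q M) UNIV + ennreal (K4 * t powr \<beta>) \<and> emeasure (swept s q M) UNIV \<le> 1"
    using swept_mass[OF eq d s C0] unfolding \<beta>_def by blast
  \<comment> \<open>The last entry is the constant of \<open>swept_rpot_near_sphere\<close>.\<close>
  define K where "K = Max {K1, K2, K3, K4, 6 * s * exp s}"
  have K: "K1 \<le> K" "K2 \<le> K" "K3 \<le> K" "K4 \<le> K" "6 * s * exp s \<le> K" by (auto simp: K_def)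
  have up: "ennreal (k * a) \<le> ennreal (K * a)" if "k \<le> K" "0 \<le> a" for k a
    using that by (intro ennreal_leI mult_right_mono)
  have "\<exists>N. sweep s d K x0 n t N" if n: "norm n = 1" and t: "0 < t" "t \<le> 1" for x0 n :: 'a and t
  proof -
    define c where "c = x0 - n"
    define p where "p = (1 + t) *\<^sub>R n"
    define q where "q = x0 + t *\<^sub>R n"
    have q: "q = c + p" by (simp add: c_def p_def q_def algebra_simps)
    have p: "norm p = 1 + t" using n t by (simp add: p_def)
    have pt: "norm p = 1 + t \<and> 0 < t \<and> t \<le> 1" using p t by simp
    define N0 where "N0 = swept s p M"
    have sN0 [simp, measurable_cong]: "sets N0 = sets borel" by (simp add: N0_def)
    define N where "N = distr N0 borel ((+) c)"
    have sN [simp]: "sets N = sets borel" by (simp add: N_def)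
    have NI: "(\<integral>\<^sup>+z. f z \<partial>N) = (\<integral>\<^sup>+z. f (c + z) \<partial>N0)" if "f \<in> borel_measurable borel" for f
      unfolding N_def using that by (intro nn_integral_distr) measurable
    have eN: "emeasure N E = emeasure N0 {z. c + z \<in> E}" if "E \<in> sets borel" for E
      unfolding N_def using that
      by (subst emeasure_distr) (auto simp: sets_eq_imp_space_eq[OF sN0] vimage_def)
    have dq: "dist (c + z) q = dist z p" for z by (simp add: q)
    have dx: "dist x (c + z) = dist (x - c) z" for x z by (simp add: dist_norm algebra_simps)
    have rp: "rpot s N x = rpot s N0 (x - c)" for x
      unfolding rpot_def by (subst NI, measurable) (simp add: dx)
    have dxq: "dist (x - c) p = dist x q" for x by (simp add: q dist_norm algebra_simps)
    have ne: "x - c \<noteq> p \<longleftrightarrow> x \<noteq> q" for x by (auto simp: q algebra_simps)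
    have tot: "emeasure N UNIV = emeasure N0 UNIV" by (subst eN) auto
    have 0: "emeasure N UNIV \<le> 1" using K4(2)[of p t] pt by (simp add: tot N0_def)
    then have 1: "finite_measure N"
      by (intro finite_measureI) (auto simp: sets_eq_imp_space_eq[OF sN] top_unique)
    have 2: "emeasure N (- sphere c 1) = 0"
    proof -
      have "{z. c + z \<in> - sphere c 1} = - sphere 0 1" by (auto simp: dist_norm)
      then show ?thesis using swept_sphere(1)[OF eq p t] by (subst eN) (auto simp: N0_def)
    qed
    have 3: "1 \<le> emeasure N UNIV + ennreal (K * t powr \<beta>)"
    proof -
      have "1 \<le> emeasure N0 UNIV + ennreal (K4 * t powr \<beta>)" using K4(2)[of p t] pt by (simp add: N0_def)
      also have "\<dots> \<le> emeasure N0 UNIV + ennreal (K * t powr \<beta>)" by (intro add_left_mono up K) simp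
      finally show ?thesis by (simp add: tot)
    qed
    have 4: "rpot s N x = rker s (dist x q)" if "x \<in> sphere c 1" for x
    proof -
      have "norm (x - c) = 1" using that by (simp add: dist_norm norm_minus_commute)
      then show ?thesis using swept_sphere(2)[OF eq p t, of "x - c"] by (simp add: rp N0_def dxq)
    qed
    have 5: "rpot s N x \<le> ennreal (1 + K * B * t) * rker s (dist x q)"
      if "x \<noteq> q" "0 \<le> B" "6 * B * t \<le> 1" "\<bar>(dist x c)\<^sup>2 - 1\<bar> \<le> B * (dist x q)\<^sup>2" for x B
    proof -
      have "rpot s N0 (x - c) \<le> ennreal (1 + 6 * s * exp s * B * t) * rker s (dist (x - c) p)"
        unfolding N0_def using that(2-4) ne[THEN iffD2, OF that(1)]
        by (intro swept_rpot_near_sphere[OF eq p t s0]) (simp_all only: dxq dist_norm[of x c] simp_thms)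
      also have "\<dots> \<le> ennreal (1 + K * B * t) * rker s (dist (x - c) p)"
        using K(5) that t by (intro mult_right_mono ennreal_leI add_left_mono) auto
      finally show ?thesis by (simp add: rp dxq)
    qed
    have 6: "(\<integral>\<^sup>+z. rker s (dist x z) * indicator {z. \<eta> < dist z q} z \<partial>N)
        \<le> ennreal (K * (t / \<eta>) powr \<beta>) * rker s (dist x q)" if "x \<noteq> q" "\<eta> > 0" for x \<eta>
    proof -
      have "(\<integral>\<^sup>+z. rker s (dist x z) * indicator {z. \<eta> < dist z q} z \<partial>N) = (\<integral>\<^sup>+z. rker s (dist (x - c) z) * indicator {z. \<eta> < dist z p} z \<partial>N0)"
        by (subst NI, measurable) (simp add: dx dq indicator_def)
      also have "\<dots> \<le> ennreal (K1 * (t / \<eta>) powr \<beta>) * rker s (dist (x - c) p)"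
        using K1(2)[of p t] pt that by (simp add: N0_def ne)
      also have "\<dots> \<le> ennreal (K * (t / \<eta>) powr \<beta>) * rker s (dist (x - c) p)"
        by (intro mult_right_mono up K) auto
      finally show ?thesis by (simp add: dxq)
    qed
    have 7: "emeasure N {z. \<eta> < dist z q} \<le> ennreal (K * (t / \<eta>) powr \<beta>)" if "\<eta> > 0" for \<eta>
    proof -
      have "emeasure N {z. \<eta> < dist z q} = emeasure N0 {z. \<eta> < dist z p}" by (subst eN) (auto simp: dq)
      also have "\<dots> \<le> ennreal (K1 * (t / \<eta>) powr \<beta>)" using K1(2)[of p t] pt that by (simp add: N0_def)
      also have "\<dots> \<le> ennreal (K * (t / \<eta>) powr \<beta>)" by (intro up K) auto
      finally show ?thesis .
    qed
    have 8: "(\<integral>\<^sup>+z. ennreal (dist z q powr (9/10 * \<beta>)) \<partial>N) \<le> ennreal (K * t powr (9/10 * \<beta>))"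
    proof -
      have "(\<integral>\<^sup>+z. ennreal (dist z q powr (9/10 * \<beta>)) \<partial>N) = (\<integral>\<^sup>+z. ennreal (dist z p powr (9/10 * \<beta>)) \<partial>N0)"
        by (subst NI, measurable) (simp add: dq)
      also have "\<dots> \<le> ennreal (K2 * t powr (9/10 * \<beta>))" using K2(2)[of p t] pt by (simp add: N0_def)
      also have "\<dots> \<le> ennreal (K * t powr (9/10 * \<beta>))" by (intro up K) auto
      finally show ?thesis .
    qed
    have 9: "(\<integral>\<^sup>+z. ennreal (dist z q powr (6/5 * \<beta>)) \<partial>N) \<le> ennreal (K * t powr \<beta>)"
    proof -
      have "(\<integral>\<^sup>+z. ennreal (dist z q powr (6/5 * \<beta>)) \<partial>N) = (\<integral>\<^sup>+z. ennreal (dist z p powr (6/5 * \<beta>)) \<partial>N0)"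
        by (subst NI, measurable) (simp add: dq)
      also have "\<dots> \<le> ennreal (K3 * t powr \<beta>)" using K3(2)[of p t] pt by (simp add: N0_def)
      also have "\<dots> \<le> ennreal (K * t powr \<beta>)" by (intro up K) auto
      finally show ?thesis .
    qed
    have "sweep s d K x0 n t N"
      unfolding sweep_def Let_def q_def[symmetric] c_def[symmetric] \<beta>_def[symmetric]
      using 0 1 2 3 4 5 6 7 8 9 by simp
    then show ?thesis by blast
  qed
  moreover have "K > 0" using K K1 by linarith
  ultimately show ?thesis by blast
qed

section \<open>Transfer from the tangent sphere to the hypersurface\<close>

lemma norm_add_scaleR_sq:
  fixes v n :: "'a::euclidean_space"
  assumes "norm n = 1"
  shows "(norm (v + c *\<^sub>R n))\<^sup>2 = (norm v)\<^sup>2 + 2 * c * (v \<bullet> n) + c\<^sup>2"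
proof -
  have "n \<bullet> n = 1" using assms by (simp add: norm_eq_1)
  then show ?thesis
    unfolding power2_norm_eq_inner inner_add_left inner_add_right inner_commute[of "c *\<^sub>R n" v]
    by (simp add: power2_eq_square)
qed

text \<open>The height of a sphere point below the tangent plane is known exactly from the equation
  of the sphere; comparing it with the height of \<open>A\<close> only costs a change of
  constant.\<close>

lemma sphere_inner:
  fixes z x0 n :: "'a::euclidean_space"
  assumes n: "norm n = 1" and z: "z \<in> sphere (x0 - n) 1"
  shows "(z - x0) \<bullet> n = - (dist z x0)\<^sup>2 / 2"
proof -
  have "(norm ((z - x0) + n))\<^sup>2 = 1" using z by (simp add: dist_norm norm_minus_commute algebra_simps)
  moreover have "(norm ((z - x0) + n))\<^sup>2 = (norm (z - x0))\<^sup>2 + 2 * ((z - x0) \<bullet> n) + (norm n)\<^sup>2"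
    using norm_add_scaleR_sq[OF n, of "z - x0" 1] n by simp
  ultimately show ?thesis using n by (simp add: dist_norm)
qed

text \<open>A chord between two sphere points near \<open>x0\<close> makes a slope of at most
  \<open>2 * \<rho>\<close> with the tangent plane. Vertical shifts, however large, leave its
  horizontal part alone, so they shorten it only by a factor quadratic in \<rho>. This is why mass
  is transported along \<open>n\<close>.\<close>

lemma vertical_pair:
  fixes z w x0 n :: "'a::euclidean_space"
  assumes n: "norm n = 1" and z: "z \<in> sphere (x0 - n) 1" and w: "w \<in> sphere (x0 - n) 1"
    and \<rho>: "dist z x0 \<le> 2 * \<rho>" "dist w x0 \<le> 2 * \<rho>" "0 \<le> \<rho>" "\<rho> \<le> 1 / 2"
  shows "(1 - 4 * \<rho>\<^sup>2) * dist w z \<le> dist (w + a *\<^sub>R n) (z + b *\<^sub>R n)"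
proof -
  define u where "u = w - z"
  have "u \<bullet> n = ((dist z x0)\<^sup>2 - (dist w x0)\<^sup>2) / 2"
    using sphere_inner[OF n z] sphere_inner[OF n w] by (simp add: u_def inner_diff_left)
  also have "\<dots> = (dist z x0 - dist w x0) * ((dist z x0 + dist w x0) / 2)"
    by (simp add: power2_eq_square algebra_simps)
  finally have "\<bar>u \<bullet> n\<bar> = \<bar>dist z x0 - dist w x0\<bar> * ((dist z x0 + dist w x0) / 2)"
    by (simp only: abs_mult) simp
  also have "\<dots> \<le> norm u * (2 * \<rho>)"
  proof (rule mult_mono)
    show "\<bar>dist z x0 - dist w x0\<bar> \<le> norm u"
      using abs_dist_diff_le[of z x0 w] by (simp add: u_def dist_commute flip: dist_norm)
  qed (use \<rho> in auto)
  finally have "(u \<bullet> n)\<^sup>2 \<le> (norm u * (2 * \<rho>))\<^sup>2" by (metis abs_ge_zero power2_abs power_mono)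
  then have un: "(u \<bullet> n)\<^sup>2 \<le> 4 * \<rho>\<^sup>2 * (norm u)\<^sup>2" by (simp add: power_mult_distrib mult_ac)
  have r1: "4 * \<rho>\<^sup>2 \<le> 1" using power_mono[of \<rho> "1/2" 2] \<rho> by (simp add: power2_eq_square)
  have "(dist (w + a *\<^sub>R n) (z + b *\<^sub>R n))\<^sup>2 = (norm (u + (a - b) *\<^sub>R n))\<^sup>2"
    by (simp add: dist_norm u_def algebra_simps)
  also have "\<dots> = (norm u)\<^sup>2 + 2 * (a - b) * (u \<bullet> n) + (a - b)\<^sup>2"
    by (simp add: norm_add_scaleR_sq[OF n])
  \<comment> \<open>Completing the square isolates the horizontal part; the vertical square, which
    contains both shifts, is dropped.\<close>
  also have "\<dots> = (norm u)\<^sup>2 - (u \<bullet> n)\<^sup>2 + ((a - b) + u \<bullet> n)\<^sup>2" by (simp add: power2_eq_square algebra_simps)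
  also have "\<dots> \<ge> (norm u)\<^sup>2 - 4 * \<rho>\<^sup>2 * (norm u)\<^sup>2" using un zero_le_power2[of "a - b + u \<bullet> n"] by linarith
  also have "(norm u)\<^sup>2 - 4 * \<rho>\<^sup>2 * (norm u)\<^sup>2 = (1 - 4 * \<rho>\<^sup>2) * (norm u)\<^sup>2" by (simp add: algebra_simps)
  finally have 1: "(1 - 4 * \<rho>\<^sup>2) * (norm u)\<^sup>2 \<le> (dist (w + a *\<^sub>R n) (z + b *\<^sub>R n))\<^sup>2" .
  have "(1 - 4 * \<rho>\<^sup>2)\<^sup>2 * (norm u)\<^sup>2 \<le> (1 - 4 * \<rho>\<^sup>2) * (norm u)\<^sup>2"
    using r1 by (intro mult_right_mono) (auto simp: power2_eq_square[of "1 - 4 * \<rho>\<^sup>2"] mult_left_le)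
  then have "((1 - 4 * \<rho>\<^sup>2) * norm u)\<^sup>2 \<le> (dist (w + a *\<^sub>R n) (z + b *\<^sub>R n))\<^sup>2" using 1 by (simp add: power_mult_distrib)
  then show ?thesis unfolding u_def dist_norm[of w z, symmetric] by (rule power2_le_imp_le) simp
qed

text \<open>Over the horizontal part of \<open>z - x0\<close> both the sphere and \<open>A\<close>
  have height quadratic in \<open>dist z x0\<close>, so the vertical gap is quadratic too.\<close>

lemma over_submanifold:
  fixes z x0 n :: "'a::euclidean_space"
  assumes fl: "flat_at A C \<delta> x0 n" and C: "C \<ge> 1" and z: "z \<in> sphere (x0 - n) 1" "dist z x0 \<le> \<delta>"
  shows "\<exists>g. \<bar>g\<bar> \<le> 2 * C * (dist z x0)\<^sup>2 \<and> z + g *\<^sub>R n \<in> A"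
proof -
  have n: "norm n = 1" using fl by (simp add: flat_at_def)
  define h where "h = (z - x0) \<bullet> n"
  define v where "v = (z - x0) - h *\<^sub>R n"
  have vn: "v \<bullet> n = 0" using n by (simp add: v_def h_def inner_diff_left norm_eq_1)
  have "z - x0 = v + h *\<^sub>R n" by (simp add: v_def)
  then have "(norm (z - x0))\<^sup>2 = (norm v)\<^sup>2 + h\<^sup>2" using norm_add_scaleR_sq[OF n, of v h] vn by simp
  then have vz: "(norm v)\<^sup>2 \<le> (dist z x0)\<^sup>2" by (simp add: dist_norm)
  then have "norm v \<le> \<delta>" using z power2_le_imp_le[of "norm v" "dist z x0"] by simp
  then obtain g where g: "\<bar>g\<bar> \<le> C * (norm v)\<^sup>2" "x0 + v + g *\<^sub>R n \<in> A" using fl vn by (auto simp: flat_at_def)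
  have "z + (g - h) *\<^sub>R n = x0 + v + g *\<^sub>R n" by (simp add: v_def algebra_simps)
  moreover have "\<bar>g - h\<bar> \<le> 2 * C * (dist z x0)\<^sup>2"
  proof -
    have "\<bar>g\<bar> \<le> C * (dist z x0)\<^sup>2" using g mult_left_mono[OF vz, of C] C by linarith
    moreover have "\<bar>h\<bar> \<le> C * (dist z x0)\<^sup>2"
      using sphere_inner[OF n z(1)] mult_right_mono[OF C, of "(dist z x0)\<^sup>2"] zero_le_power2[of "dist z x0"]
      unfolding h_def by linarith
    ultimately show ?thesis by linarith
  qed
  ultimately show ?thesis using g by metis
qed

text \<open>The sphere point \<open>w\<close> vertically over or under \<open>x\<close> differs from
  it by a shift of order r^2, with r the distance from \<open>x\<close> to \<open>x0\<close>, while
  \<open>w - q\<close> has vertical component of order r^2+t. The squared distances to the pole thus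
  differ by order r^2(r^2+t), which is of relative size r^2+t.\<close>

lemma over_sphere:
  fixes x x0 n :: "'a::euclidean_space"
  assumes n: "norm n = 1" and C: "C \<ge> 1" and t: "0 < t"
    and flat: "\<bar>(x - x0) \<bullet> n\<bar> \<le> C * (dist x x0)\<^sup>2" and r: "C * dist x x0 \<le> 1 / 2"
    and small: "24 * C\<^sup>2 * ((dist x x0)\<^sup>2 + t) \<le> 1"
  shows "\<exists>w a. w \<in> sphere (x0 - n) 1 \<and> x = w + a *\<^sub>R n \<and> dist w x0 \<le> 2 * dist x x0 \<and>
    (1 - 24 * C\<^sup>2 * ((dist x x0)\<^sup>2 + t)) * dist x (x0 + t *\<^sub>R n) \<le> dist w (x0 + t *\<^sub>R n)"
proof -
  define r where "r = dist x x0"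
  define h where "h = (x - x0) \<bullet> n"
  define v where "v = (x - x0) - h *\<^sub>R n"
  have r0: "0 \<le> r" by (simp add: r_def)
  have rC: "C * r \<le> 1/2" using r by (simp add: r_def)
  have r12: "r \<le> 1/2" using mult_right_mono[OF C r0] rC by simp
  have vn: "v \<bullet> n = 0" using n by (simp add: v_def h_def inner_diff_left norm_eq_1)
  have sq: "r\<^sup>2 = (norm v)\<^sup>2 + h\<^sup>2"
  proof -
    have "x - x0 = v + h *\<^sub>R n" by (simp add: v_def)
    then show ?thesis using norm_add_scaleR_sq[OF n, of v h] vn by (simp add: r_def dist_norm)
  qed
  have v2: "(norm v)\<^sup>2 \<le> r\<^sup>2" using sq by simp
  have "r\<^sup>2 \<le> (1/2)\<^sup>2" using r12 r0 by (intro power_mono)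
  then have v1: "(norm v)\<^sup>2 \<le> 1/4" using v2 by (simp add: power2_eq_square)
  \<comment> \<open>The depth of the upper cap of the sphere below its tangent plane at horizontal
    displacement \<open>v\<close>.\<close>
  define k where "k = 1 - sqrt (1 - (norm v)\<^sup>2)"
  have k2: "(1 - k)\<^sup>2 = 1 - (norm v)\<^sup>2" using v1 by (simp add: k_def)
  have k0: "0 \<le> k" by (simp add: k_def)
  have kv: "k \<le> (norm v)\<^sup>2"
  proof -
    have "(1 - (norm v)\<^sup>2)\<^sup>2 \<le> 1 - (norm v)\<^sup>2" using v1 by (simp add: power2_eq_square[of "1 - _"] mult_left_le)
    then have "1 - (norm v)\<^sup>2 \<le> sqrt (1 - (norm v)\<^sup>2)" using v1 by (intro real_le_rsqrt)
    then show ?thesis by (simp add: k_def)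
  qed
  define w where "w = x0 + v - k *\<^sub>R n"
  have nsq: "(norm (v + c *\<^sub>R n))\<^sup>2 = (norm v)\<^sup>2 + c\<^sup>2" for c
    using norm_add_scaleR_sq[OF n, of v c] vn by simp
  have wS: "w \<in> sphere (x0 - n) 1"
  proof -
    have "w - (x0 - n) = v + (1 - k) *\<^sub>R n" by (simp add: w_def algebra_simps)
    then have "(norm (w - (x0 - n)))\<^sup>2 = 1" using nsq[of "1 - k"] k2 by simp
    then have "norm (w - (x0 - n)) = 1" using power2_eq_iff_nonneg[of "norm (w - (x0 - n))" 1] by simp
    then show ?thesis by (simp add: dist_norm norm_minus_commute)
  qed
  have wx: "(dist w x0)\<^sup>2 = (norm v)\<^sup>2 + k\<^sup>2"
    using nsq[of "- k"] by (simp add: w_def dist_norm)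
  have xw: "x = w + (h + k) *\<^sub>R n" by (simp add: w_def v_def algebra_simps)
  have "k\<^sup>2 \<le> (norm v)\<^sup>2"
    using mult_mono[OF kv kv] k0 v1 mult_left_le[of "(norm v)\<^sup>2" "(norm v)\<^sup>2"] by (simp add: power2_eq_square)
  then have wr2: "(dist w x0)\<^sup>2 \<le> 2 * r\<^sup>2" using wx v2 by simp
  moreover have "(2 * r)\<^sup>2 = 2 * r\<^sup>2 + 2 * r\<^sup>2" by (simp add: power_mult_distrib)
  ultimately have "(dist w x0)\<^sup>2 \<le> (2 * r)\<^sup>2" using zero_le_power2[of r] by linarith
  then have wr: "dist w x0 \<le> 2 * r" by (rule power2_le_imp_le) (simp add: r0)
  have "h\<^sup>2 \<le> (C * r\<^sup>2)\<^sup>2" using power_mono[OF flat, of 2] by (simp add: h_def r_def)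
  also have "(C * r\<^sup>2)\<^sup>2 = (C * r)\<^sup>2 * r\<^sup>2" by (simp add: power2_eq_square)
  also have "\<dots> \<le> (1/2)\<^sup>2 * r\<^sup>2" using rC C r0 by (intro mult_right_mono power_mono) auto
  finally have "h\<^sup>2 \<le> r\<^sup>2 / 4" by (simp add: power2_eq_square)
  then have rw: "r\<^sup>2 \<le> 2 * (dist w x0)\<^sup>2" using sq wx zero_le_power2[of k] zero_le_power2[of "norm v"] by linarith
  define a where "a = h + k"
  have a: "\<bar>a\<bar> \<le> 2 * C * r\<^sup>2"
  proof -
    have "\<bar>h\<bar> \<le> C * r\<^sup>2" using flat by (simp add: h_def r_def)
    moreover have "k \<le> C * r\<^sup>2" using kv v2 mult_right_mono[OF C, of "r\<^sup>2"] by simp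
    ultimately show ?thesis using k0 by (simp add: a_def)
  qed
  define q where "q = x0 + t *\<^sub>R n"
  have wqn: "(w - q) \<bullet> n = - (dist w x0)\<^sup>2 / 2 - t"
    using sphere_inner[OF n wS] n by (simp add: q_def inner_diff_left inner_add_left norm_eq_1)
  have wq: "(dist w x0)\<^sup>2 \<le> (dist w q)\<^sup>2"
  proof -
    have "(dist w q)\<^sup>2 = (norm ((w - x0) - t *\<^sub>R n))\<^sup>2" by (simp add: q_def dist_norm algebra_simps)
    also have "\<dots> = (dist w x0)\<^sup>2 - 2 * t * ((w - x0) \<bullet> n) + t\<^sup>2"
      using norm_add_scaleR_sq[OF n, of "w - x0" "- t"] by (simp add: dist_norm)
    also have "\<dots> = (dist w x0)\<^sup>2 * (1 + t) + t\<^sup>2" unfolding sphere_inner[OF n wS] by (simp add: algebra_simps)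
    finally show ?thesis using t by (simp add: distrib_left)
  qed
  define e where "e = 24 * C\<^sup>2 * (r\<^sup>2 + t)"
  have e: "0 \<le> e" "e \<le> 1" using small t C by (auto simp: e_def r_def)
  have "(dist x q)\<^sup>2 = (norm ((w - q) + a *\<^sub>R n))\<^sup>2" by (subst xw) (simp add: a_def dist_norm algebra_simps)
  also have "\<dots> = (dist w q)\<^sup>2 + 2 * a * ((w - q) \<bullet> n) + a\<^sup>2"
    by (simp add: norm_add_scaleR_sq[OF n] dist_norm)
  also have "\<dots> \<le> (dist w q)\<^sup>2 + e * (dist w q)\<^sup>2"
  proof -
    have "2 * a * ((w - q) \<bullet> n) \<le> 2 * \<bar>a\<bar> * \<bar>(w - q) \<bullet> n\<bar>" by (metis abs_ge_self abs_mult abs_numeral)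
    also have "\<bar>(w - q) \<bullet> n\<bar> \<le> r\<^sup>2 + t" using wqn wr2 t zero_le_power2[of "dist w x0"] by linarith
    then have "2 * \<bar>a\<bar> * \<bar>(w - q) \<bullet> n\<bar> \<le> 2 * (2 * C * r\<^sup>2) * (r\<^sup>2 + t)" using a by (intro mult_mono) auto
    finally have 1: "2 * a * ((w - q) \<bullet> n) \<le> 4 * C * (r\<^sup>2 * (r\<^sup>2 + t))" by (simp add: mult.assoc)
    have "C * 1 \<le> C * C" using C by (intro mult_left_mono) auto
    then have "4 * C * (r\<^sup>2 * (r\<^sup>2 + t)) \<le> 4 * C\<^sup>2 * (r\<^sup>2 * (r\<^sup>2 + t))"
      using t by (intro mult_right_mono) (auto simp: power2_eq_square)
    then have 2: "2 * a * ((w - q) \<bullet> n) \<le> 4 * C\<^sup>2 * (r\<^sup>2 * (r\<^sup>2 + t))" using 1 by linarith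
    have "a\<^sup>2 \<le> (2 * C * r\<^sup>2)\<^sup>2" using a by (metis abs_ge_zero power2_abs power_mono)
    also have "\<dots> = 4 * C\<^sup>2 * (r\<^sup>2 * r\<^sup>2)" by (simp add: power2_eq_square mult_ac)
    also have "\<dots> \<le> 4 * C\<^sup>2 * (r\<^sup>2 * (r\<^sup>2 + t))" using t by (intro mult_left_mono) auto
    finally have 3: "2 * a * ((w - q) \<bullet> n) + a\<^sup>2 \<le> 8 * C\<^sup>2 * (r\<^sup>2 * (r\<^sup>2 + t))" using 2 by simp
    have "8 * C\<^sup>2 * (r\<^sup>2 * (r\<^sup>2 + t)) = (8 * C\<^sup>2 * (r\<^sup>2 + t)) * r\<^sup>2" by simp
    also have "\<dots> \<le> (8 * C\<^sup>2 * (r\<^sup>2 + t)) * (2 * (dist w q)\<^sup>2)" using order_trans[OF rw mult_left_mono[OF wq, of 2]] t by (intro mult_left_mono) auto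
    also have "\<dots> \<le> e * (dist w q)\<^sup>2" using t by (simp add: e_def algebra_simps)
    finally show ?thesis using 3 by simp
  qed
  finally have "(dist x q)\<^sup>2 \<le> (1 + e) * (dist w q)\<^sup>2" by (simp add: distrib_right)
  \<comment> \<open>From 1+e on squares to 1-e on distances: (1-e)^2(1+e) = (1-e)(1-e^2) \<le>
    1.\<close>
  then have "(1 - e)\<^sup>2 * (dist x q)\<^sup>2 \<le> (1 - e)\<^sup>2 * ((1 + e) * (dist w q)\<^sup>2)" by (rule mult_left_mono) simp
  also have "\<dots> = ((1 - e) * (1 - e\<^sup>2)) * (dist w q)\<^sup>2" by (simp add: power2_eq_square algebra_simps)
  also have "\<dots> \<le> 1 * (dist w q)\<^sup>2"
  proof (rule mult_right_mono)
    have "e\<^sup>2 \<le> 1" using e by (simp add: power_le_one)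
    then show "(1 - e) * (1 - e\<^sup>2) \<le> 1" using e by (intro mult_le_one) auto
  qed simp
  finally have "((1 - e) * dist x q)\<^sup>2 \<le> (dist w q)\<^sup>2" by (simp add: power_mult_distrib)
  then have "(1 - e) * dist x q \<le> dist w q" by (rule power2_le_imp_le) simp
  then show ?thesis using wS xw wr by (auto simp: e_def r_def q_def intro!: exI[of _ w] exI[of _ "h + k"])
qed

text \<open>The lowest point of \<open>A\<close> over \<open>z\<close> is a lower semicontinuous function of \<open>z\<close>.\<close>

lemma vertical_selection:
  fixes A :: "'a::euclidean_space set"
  assumes A: "closed A" and S: "compact S" and G: "continuous_on S G"
    and ex: "\<And>z. z \<in> S \<Longrightarrow> \<exists>g. \<bar>g\<bar> \<le> G z \<and> z + g *\<^sub>R n \<in> A"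
  shows "\<exists>P\<in>borel_measurable borel. \<forall>z\<in>S. P z \<in> A \<and> (\<exists>g. \<bar>g\<bar> \<le> G z \<and> P z = z + g *\<^sub>R n)"
proof -
  define T where "T = (\<lambda>z. {g. \<bar>g\<bar> \<le> G z \<and> z + g *\<^sub>R n \<in> A})"
  have Tc: "closed (T z)" for z
  proof -
    have "closed ((\<lambda>g. z + g *\<^sub>R n) -` A)" by (intro closed_vimage A continuous_intros)
    moreover have "closed {g. \<bar>g\<bar> \<le> G z}" by (intro closed_Collect_le continuous_intros)
    ultimately show ?thesis unfolding T_def by (auto simp: vimage_def Collect_conj_eq intro: closed_Int)
  qed
  have Tb: "bdd_below (T z)" for z by (rule bdd_belowI[of _ "- G z"]) (auto simp: T_def)
  define \<gamma> where "\<gamma> = (\<lambda>z. if z \<in> S then Inf (T z) else 0)"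
  have \<gamma>: "\<gamma> z \<in> T z" if "z \<in> S" for z
    using closed_contains_Inf[OF _ Tb Tc, of z] ex[OF that] that by (auto simp: \<gamma>_def T_def)
  have le: "\<gamma> z \<le> a \<longleftrightarrow> (\<exists>g\<in>T z. g \<le> a)" if "z \<in> S" for z a
  proof
    show "\<gamma> z \<le> a \<Longrightarrow> \<exists>g\<in>T z. g \<le> a" using \<gamma>[OF that] by blast
    show "\<exists>g\<in>T z. g \<le> a \<Longrightarrow> \<gamma> z \<le> a"
      using that Tb cInf_lower order_trans unfolding \<gamma>_def by (metis (full_types))
  qed
  \<comment> \<open>A sublevel set of the lowest height is the projection of a compact set of pairs
    \<open>(z, g)\<close>, and the infimum is attained; so the sublevel set is compact.\<close>
  have cl: "closed {z \<in> S. \<gamma> z \<le> a}" for a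
  proof -
    obtain B where B: "\<And>z. z \<in> S \<Longrightarrow> G z \<le> B"
      using compact_imp_bounded[OF compact_continuous_image[OF G S]]
      unfolding bounded_iff by (metis abs_le_D1 imageI real_norm_def)
    define Q where "Q = {zg \<in> S \<times> {-B..B}. \<bar>snd zg\<bar> \<le> G (fst zg) \<and> snd zg \<le> a \<and> fst zg + snd zg *\<^sub>R n \<in> A}"
    have SB: "compact (S \<times> {-B..B})" by (intro compact_Times S) simp
    have cG: "continuous_on (S \<times> {-B..B}) (\<lambda>zg. G (fst zg))"
      by (rule continuous_on_compose2[OF G]) (auto intro!: continuous_intros)
    have c1: "closedin (top_of_set (S \<times> {-B..B})) ((S \<times> {-B..B}) \<inter> (\<lambda>zg. \<bar>snd zg\<bar> - G (fst zg)) -` {..0})"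
      by (intro continuous_closedin_preimage continuous_intros cG)
    have c2: "closedin (top_of_set (S \<times> {-B..B})) ((S \<times> {-B..B}) \<inter> (\<lambda>zg. snd zg) -` {..a})"
      by (intro continuous_closedin_preimage continuous_intros)
    have c3: "closedin (top_of_set (S \<times> {-B..B})) ((S \<times> {-B..B}) \<inter> (\<lambda>zg. fst zg + snd zg *\<^sub>R n) -` A)"
      by (intro continuous_closedin_preimage continuous_intros A)
    note closedin_Int[OF closedin_Int[OF c1 c2] c3]
    also have "(S \<times> {-B..B}) \<inter> (\<lambda>zg. \<bar>snd zg\<bar> - G (fst zg)) -` {..0} \<inter> ((S \<times> {-B..B}) \<inter> (\<lambda>zg. snd zg) -` {..a})
        \<inter> ((S \<times> {-B..B}) \<inter> (\<lambda>zg. fst zg + snd zg *\<^sub>R n) -` A) = Q"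
      by (auto simp: Q_def)
    finally have "compact Q" using closedin_compact[OF SB] by blast
    then have "compact (fst ` Q)" by (intro compact_continuous_image continuous_intros) 
    moreover have "fst ` Q = {z \<in> S. \<gamma> z \<le> a}"
    proof (intro subset_antisym subsetI)
      fix z assume "z \<in> fst ` Q"
      then show "z \<in> {z \<in> S. \<gamma> z \<le> a}" using le by (auto simp: Q_def T_def)
    next
      fix z assume z: "z \<in> {z \<in> S. \<gamma> z \<le> a}"
      then obtain g where g: "g \<in> T z" "g \<le> a" using le by blast
      then have "\<bar>g\<bar> \<le> B" using B[of z] z by (auto simp: T_def)
      then have "(z, g) \<in> Q" using g z by (auto simp: Q_def T_def abs_le_iff)
      then show "z \<in> fst ` Q" by (metis fst_conv image_eqI)
    qed
    ultimately show ?thesis by (simp add: compact_imp_closed)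
  qed
  have Sb: "S \<in> sets borel" using S by (simp add: borel_compact)
  have [measurable]: "\<gamma> \<in> borel_measurable borel"
  proof (rule borel_measurableI_le)
    fix a
    \<comment> \<open>The default value 0 off \<open>S\<close> adds either all of the complement of
      \<open>S\<close> or nothing.\<close>
    have "{z \<in> space borel. \<gamma> z \<le> a} = {z \<in> S. \<gamma> z \<le> a} \<union> (if 0 \<le> a then - S else {})"
      by (auto simp: \<gamma>_def)
    also have "\<dots> \<in> sets borel" using cl[of a] Sb by auto
    finally show "{z \<in> space borel. \<gamma> z \<le> a} \<in> sets borel" .
  qed
  show ?thesis
  proof (intro bexI ballI conjI)
    show "(\<lambda>z. z + \<gamma> z *\<^sub>R n) \<in> borel_measurable borel" by measurable
    fix z assume z: "z \<in> S"
    show "z + \<gamma> z *\<^sub>R n \<in> A" using \<gamma>[OF z] by (simp add: T_def)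
    show "\<exists>g. \<bar>g\<bar> \<le> G z \<and> z + \<gamma> z *\<^sub>R n = z + g *\<^sub>R n" using \<gamma>[OF z] by (auto simp: T_def)
  qed
qed

text \<open>Flatness bounds the cross term in the expanded square, so up to a factor the distance to
  a point on the normal behaves as over a flat plane.\<close>

lemma flat_dist_sq:
  fixes x x0 n :: "'a::euclidean_space"
  assumes n: "norm n = 1" and flat: "\<bar>(x - x0) \<bullet> n\<bar> \<le> C * (norm (x - x0))\<^sup>2" and t: "0 < t"
  shows "(1 - 2 * C * t) * (dist x x0)\<^sup>2 + t\<^sup>2 \<le> (dist x (x0 + t *\<^sub>R n))\<^sup>2"
proof -
  have "(dist x (x0 + t *\<^sub>R n))\<^sup>2 = (dist x x0)\<^sup>2 - 2 * t * ((x - x0) \<bullet> n) + t\<^sup>2"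
    using norm_add_scaleR_sq[OF n, of "x - x0" "- t"] by (simp add: dist_norm algebra_simps)
  moreover have "2 * t * ((x - x0) \<bullet> n) \<le> 2 * t * (C * (dist x x0)\<^sup>2)"
    using flat t by (intro mult_left_mono) (auto simp: dist_norm)
  ultimately show ?thesis by (simp add: algebra_simps)
qed

lemma flat_dist_bounds:
  fixes x x0 n :: "'a::euclidean_space"
  assumes n: "norm n = 1" and flat: "\<bar>(x - x0) \<bullet> n\<bar> \<le> C * (norm (x - x0))\<^sup>2" and t: "0 < t" "4 * C * t \<le> 1"
  shows "dist x x0 / 2 \<le> dist x (x0 + t *\<^sub>R n)" "t \<le> dist x (x0 + t *\<^sub>R n)"
    "dist x (x0 + t *\<^sub>R n) \<le> dist x x0 + t"
proof -
  have "(1/2) * (dist x x0)\<^sup>2 \<le> (1 - 2 * C * t) * (dist x x0)\<^sup>2" using t by (intro mult_right_mono) auto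
  then have *: "(1/2) * (dist x x0)\<^sup>2 + t\<^sup>2 \<le> (dist x (x0 + t *\<^sub>R n))\<^sup>2" using flat_dist_sq[OF n flat t(1)] by linarith
  have "(dist x x0)\<^sup>2 / 4 \<le> (dist x (x0 + t *\<^sub>R n))\<^sup>2"
    using * zero_le_power2[of "dist x x0"] zero_le_power2[of t] by linarith
  then have "(dist x x0 / 2)\<^sup>2 \<le> (dist x (x0 + t *\<^sub>R n))\<^sup>2" by (simp add: power_divide)
  then show "dist x x0 / 2 \<le> dist x (x0 + t *\<^sub>R n)" by (rule power2_le_imp_le) simp
  have "t\<^sup>2 \<le> (dist x (x0 + t *\<^sub>R n))\<^sup>2" using * zero_le_power2[of "dist x x0"] by linarith
  then show "t \<le> dist x (x0 + t *\<^sub>R n)" by (rule power2_le_imp_le) simp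
  have "dist x0 (x0 + t *\<^sub>R n) = t" using n t by (simp add: dist_norm)
  then show "dist x (x0 + t *\<^sub>R n) \<le> dist x x0 + t" using dist_triangle[of x "x0 + t *\<^sub>R n" x0] by simp
qed

section \<open>Potential of the transported measure\<close>

text \<open>For \<open>x\<close> within \<rho> of \<open>x0\<close>, both \<open>x\<close> and the
  transported mass are moved back vertically to the sphere, where the potential is exactly the
  kernel. Mass beyond \<rho> suffers only a bounded factor but is a tail; nearby mass suffers a
  factor that is quadratically close to 1.\<close>

lemma transfer_bound_near:
  fixes x x0 n :: "'a::euclidean_space"
  assumes n: "norm n = 1" and C: "C \<ge> 1" and \<delta>1: "40 * C * \<delta>1 \<le> 1" and s: "0 < s" and K: "K > 0" and t: "0 < t"
    and \<rho>: "0 < \<rho>" "2 * \<rho> \<le> \<delta>1" "t \<le> \<rho>\<^sup>2" and sw: "sweep s d K x0 n t N"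
    and P: "P \<in> borel_measurable borel" "\<And>z. z \<in> sphere (x0 - n) 1 \<inter> cball x0 \<delta>1 \<Longrightarrow> \<exists>g. P z = z + g *\<^sub>R n"
    and x: "\<bar>(x - x0) \<bullet> n\<bar> \<le> C * (norm (x - x0))\<^sup>2" "dist x x0 \<le> \<rho>"
  shows "(\<integral>\<^sup>+z. rker s (dist x (P z)) * indicator (sphere (x0 - n) 1 \<inter> cball x0 \<delta>1) z \<partial>N)
    \<le> ennreal (1 + 104 * s * exp s * C\<^sup>2 * \<rho>\<^sup>2 + 4 powr s * K * (t / \<rho>) powr (real d - s)) * rker s (dist x (x0 + t *\<^sub>R n))"
proof -
  define q where "q = x0 + t *\<^sub>R n"
  define S where "S = sphere (x0 - n) 1"
  define \<beta> where "\<beta> = real d - s"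
  have [measurable_cong]: "sets N = sets borel" by (rule sweep_sets[OF sw])
  note [measurable] = P(1)
  have \<delta>0: "0 < \<delta>1" using \<rho> by simp
  have "1 * \<delta>1 \<le> C * \<delta>1" using C \<delta>0 by (intro mult_right_mono) auto
  then have \<delta>s: "\<delta>1 \<le> 1/40" using \<delta>1 by simp
  have r0: "0 \<le> dist x x0" by simp
  have Cr: "C * \<rho> \<le> 1/80"
  proof -
    have "C * (2 * \<rho>) \<le> C * \<delta>1" using \<rho> C by (intro mult_left_mono) auto
    then show ?thesis using \<delta>1 by simp
  qed
  have CC: "C\<^sup>2 * \<rho>\<^sup>2 \<le> 1/6400"
  proof -
    have "(C * \<rho>)\<^sup>2 \<le> (1/80)\<^sup>2" using Cr C \<rho> by (intro power_mono) auto
    then show ?thesis by (simp only: power_mult_distrib) (simp add: power2_eq_square)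
  qed
  have rr: "(dist x x0)\<^sup>2 \<le> \<rho>\<^sup>2" using x(2) by (intro power_mono) auto
  define e where "e = 24 * C\<^sup>2 * ((dist x x0)\<^sup>2 + t)"
  have "24 * C\<^sup>2 * ((dist x x0)\<^sup>2 + t) \<le> 24 * C\<^sup>2 * (2 * \<rho>\<^sup>2)"
    using add_mono[OF rr \<rho>(3)] by (intro mult_left_mono) auto
  then have e: "0 \<le> e" "e \<le> 48 * (C\<^sup>2 * \<rho>\<^sup>2)" using t by (auto simp: e_def)
  have "C * dist x x0 \<le> C * \<rho>" using x(2) C by (intro mult_left_mono) auto
  then have "C * dist x x0 \<le> 1/2" using Cr by simp
  moreover have "e \<le> 1" using e CC by simp
  ultimately obtain w a where w: "w \<in> S" "x = w + a *\<^sub>R n" "dist w x0 \<le> 2 * dist x x0" "(1 - e) * dist x q \<le> dist w q"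
    using over_sphere[OF n C t, of x x0] x(1) unfolding S_def q_def e_def dist_norm[of x x0, symmetric] by blast
  have wS: "w \<in> sphere (x0 - n) 1" using w(1) by (simp add: S_def)
  have qS: "q \<notin> S"
  proof -
    have "q - (x0 - n) = (1 + t) *\<^sub>R n" by (simp add: q_def algebra_simps)
    then have "norm (q - (x0 - n)) = 1 + t" using n t by simp
    then show ?thesis using t by (simp add: S_def dist_norm norm_minus_commute)
  qed
  then have wq: "w \<noteq> q" using w(1) by auto
  have dq: "dist z x0 \<le> dist z q + t" for z
  proof -
    have "dist q x0 = t" using n t by (simp add: q_def dist_norm)
    then show ?thesis using dist_triangle[of z x0 q] by simp
  qed
  have t\<rho>: "t \<le> \<rho>"
  proof -
    have "\<rho> * \<rho> \<le> \<rho> * 1" using \<rho> \<delta>s by (intro mult_left_mono) auto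
    then show ?thesis using \<rho>(3) unfolding power2_eq_square by linarith
  qed
  have pw: "(\<integral>\<^sup>+z. rker s (dist x (P z)) * indicator (S \<inter> cball x0 \<delta>1) z \<partial>N) \<le>
     (\<integral>\<^sup>+z. ennreal ((1 - 4 * \<rho>\<^sup>2) powr (- s)) * rker s (dist w z) + ennreal (2 powr s) * (rker s (dist w z) * indicator {z. \<rho> < dist z q} z) \<partial>N)"
  proof (rule nn_integral_mono)
    fix z
    show "rker s (dist x (P z)) * indicator (S \<inter> cball x0 \<delta>1) z \<le>
      ennreal ((1 - 4 * \<rho>\<^sup>2) powr (- s)) * rker s (dist w z) + ennreal (2 powr s) * (rker s (dist w z) * indicator {z. \<rho> < dist z q} z)"
    proof (cases "z \<in> S \<inter> cball x0 \<delta>1")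
      case True
      then obtain g where g: "P z = z + g *\<^sub>R n" using P(2)[of z] by (auto simp: S_def)
      have zS: "z \<in> sphere (x0 - n) 1" and zd: "dist z x0 \<le> \<delta>1" using True by (auto simp: S_def dist_commute)
      show ?thesis
      proof (cases "dist z x0 \<le> 2 * \<rho>")
        \<comment> \<open>Both sphere points lie within \<open>2 * \<rho>\<close> of
          \<open>x0\<close>, so the factor is 1 up to order \<rho>^2.\<close>
        case near: True
        have "(1 - 4 * \<rho>\<^sup>2) * dist w z \<le> dist (w + a *\<^sub>R n) (z + g *\<^sub>R n)"
          by (rule vertical_pair[OF n zS wS]) (use near w x \<rho> \<delta>s in auto)
        then have "(1 - 4 * \<rho>\<^sup>2) * dist w z \<le> dist x (P z)" using w(2) g by simp
        moreover have "\<rho>\<^sup>2 \<le> (1/40)\<^sup>2" using \<rho> \<delta>s by (intro power_mono) auto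
        ultimately have "rker s (dist x (P z)) \<le> ennreal ((1 - 4 * \<rho>\<^sup>2) powr (- s)) * rker s (dist w z)"
          using s by (intro rker_le_scaled) (auto simp: power2_eq_square)
        then show ?thesis using True by (simp add: add_increasing2)
      next
        \<comment> \<open>Here \<open>vertical_pair\<close> is used at the fixed scale
          \<open>\<delta>1\<close>, giving the factor 1/2; since \<open>t \<le> \<rho>\<close>, such
          a point has distance more than \<rho> from \<open>q\<close> and belongs to the
          tail.\<close>
        case far: False
        have "(1 - 4 * \<delta>1\<^sup>2) * dist w z \<le> dist (w + a *\<^sub>R n) (z + g *\<^sub>R n)"
          by (rule vertical_pair[OF n zS wS]) (use zd w x \<rho> \<delta>s in auto)
        moreover have "\<delta>1\<^sup>2 \<le> (1/40)\<^sup>2" using \<delta>0 \<delta>s by (intro power_mono) auto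
        then have "(1/2) * dist w z \<le> (1 - 4 * \<delta>1\<^sup>2) * dist w z"
          by (intro mult_right_mono) (auto simp: power2_eq_square)
        ultimately have "(1/2) * dist w z \<le> dist x (P z)" using w(2) g by simp
        then have "rker s (dist x (P z)) \<le> ennreal ((1/2) powr (- s)) * rker s (dist w z)"
          using s by (intro rker_le_scaled) auto
        moreover have "(1/2) powr (- s) = 2 powr s" by (simp add: powr_minus_divide powr_divide)
        moreover have "\<rho> < dist z q" using far dq[of z] t\<rho> by simp
        ultimately show ?thesis using True by (simp add: add_increasing)
      qed
    qed simp
  qed
  also have "\<dots> = ennreal ((1 - 4 * \<rho>\<^sup>2) powr (- s)) * rpot s N w + ennreal (2 powr s) * (\<integral>\<^sup>+z. rker s (dist w z) * indicator {z. \<rho> < dist z q} z \<partial>N)"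
    unfolding rpot_def
    apply (subst nn_integral_add, measurable)
    apply (subst nn_integral_cmult, measurable)+
    done
  also have "\<dots> \<le> ennreal ((1 - 4 * \<rho>\<^sup>2) powr (- s)) * rker s (dist w q) + ennreal (2 powr s) * (ennreal (K * (t / \<rho>) powr \<beta>) * rker s (dist w q))"
  proof (intro add_mono mult_left_mono)
    show "rpot s N w \<le> rker s (dist w q)" using sweep_rpot[OF sw wS] by (simp add: q_def)
    show "(\<integral>\<^sup>+z. rker s (dist w z) * indicator {z. \<rho> < dist z q} z \<partial>N) \<le> ennreal (K * (t / \<rho>) powr \<beta>) * rker s (dist w q)"
      using sweep_tail[OF sw, of w \<rho>] wq \<rho> unfolding q_def \<beta>_def by simp
  qed auto
  also have "\<dots> = ennreal ((1 - 4 * \<rho>\<^sup>2) powr (- s) + 2 powr s * K * (t / \<rho>) powr \<beta>) * rker s (dist w q)"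
    using K by (simp add: ennreal_plus distrib_right ennreal_mult mult.assoc)
  also have "\<dots> \<le> ennreal ((1 - 4 * \<rho>\<^sup>2) powr (- s) + 2 powr s * K * (t / \<rho>) powr \<beta>) * (ennreal ((1 - e) powr (- s)) * rker s (dist x q))"
    using w(4) s e CC by (intro mult_left_mono rker_le_scaled) auto
  also have "\<dots> = ennreal (((1 - 4 * \<rho>\<^sup>2) powr (- s) + 2 powr s * K * (t / \<rho>) powr \<beta>) * (1 - e) powr (- s)) * rker s (dist x q)"
    using K by (subst ennreal_mult) (auto simp: mult.assoc)
  also have "\<dots> \<le> ennreal (1 + 104 * s * exp s * C\<^sup>2 * \<rho>\<^sup>2 + 4 powr s * K * (t / \<rho>) powr \<beta>) * rker s (dist x q)"
  proof (intro mult_right_mono ennreal_leI)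
    have C1: "1 \<le> C\<^sup>2" using C by simp
    have r1: "\<rho>\<^sup>2 \<le> C\<^sup>2 * \<rho>\<^sup>2" using mult_right_mono[OF C1, of "\<rho>\<^sup>2"] by simp
    have small: "4 * \<rho>\<^sup>2 \<le> 1/2" "e \<le> 1/2" using e CC r1 by auto
    have "(1 - 4 * \<rho>\<^sup>2) powr (- s) * (1 - e) powr (- s) = ((1 - 4 * \<rho>\<^sup>2) * (1 - e)) powr (- s)"
      using small by (simp add: powr_mult)
    \<comment> \<open>The 52 adds 4 from moving the mass and 48 from moving \<open>x\<close>; the
      linear bound doubles it to 104.\<close>
    also have "\<dots> \<le> (1 - 52 * (C\<^sup>2 * \<rho>\<^sup>2)) powr (- s)"
    proof (rule powr_mono2')
      have "0 \<le> 4 * \<rho>\<^sup>2 * e" using e by simp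
      then have "1 - (4 * \<rho>\<^sup>2 + e) \<le> (1 - 4 * \<rho>\<^sup>2) * (1 - e)" by (simp add: algebra_simps)
      then show "1 - 52 * (C\<^sup>2 * \<rho>\<^sup>2) \<le> (1 - 4 * \<rho>\<^sup>2) * (1 - e)" using e r1 by linarith
    qed (use s CC in auto)
    also have "\<dots> \<le> 1 + 2 * s * exp s * (52 * (C\<^sup>2 * \<rho>\<^sup>2))"
      using s CC by (intro one_minus_powr_le) auto
    finally have 1: "(1 - 4 * \<rho>\<^sup>2) powr (- s) * (1 - e) powr (- s) \<le> 1 + 104 * s * exp s * C\<^sup>2 * \<rho>\<^sup>2" by simp
    have "(1 - e) powr (- s) \<le> (1/2) powr (- s)" using small s by (intro powr_mono2') auto
    also have "\<dots> = 2 powr s" by (simp add: powr_minus_divide powr_divide)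
    finally have "2 powr s * K * (t / \<rho>) powr \<beta> * (1 - e) powr (- s) \<le> 2 powr s * K * (t / \<rho>) powr \<beta> * 2 powr s"
      using K by (intro mult_left_mono) auto
    also have "\<dots> = (2 powr s * 2 powr s) * K * (t / \<rho>) powr \<beta>" by simp
    also have "2 powr s * 2 powr s = 4 powr s" by (simp add: powr_mult[symmetric])
    finally show "((1 - 4 * \<rho>\<^sup>2) powr (- s) + 2 powr s * K * (t / \<rho>) powr \<beta>) * (1 - e) powr (- s) \<le>
        1 + 104 * s * exp s * C\<^sup>2 * \<rho>\<^sup>2 + 4 powr s * K * (t / \<rho>) powr \<beta>"
      using 1 by (simp add: distrib_right)
  qed simp
  finally show ?thesis by (simp add: S_def q_def \<beta>_def)
qed

text \<open>Seen from distance \<open>r \<ge> t\<close>, the measure looks like a point mass at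
  \<open>q\<close>. Its spread around \<open>q\<close> enters through a moment of order
  \<open>b\<close> below \<beta>, and the mass at distance comparable with \<open>r\<close> through
  the tail bounds.\<close>

lemma transfer_bound_far:
  fixes x x0 n :: "'a::euclidean_space"
  assumes n: "norm n = 1" and C: "C \<ge> 1" and \<delta>1: "0 < \<delta>1" "40 * C * \<delta>1 \<le> 1"
    and s: "0 < s" "real d - 1 \<le> s" "s < real d" and K: "K > 0" and t: "0 < t"
    and sw: "sweep s d K x0 n t N"
    and P: "P \<in> borel_measurable borel"
      "\<And>z. z \<in> sphere (x0 - n) 1 \<inter> cball x0 \<delta>1 \<Longrightarrow> \<exists>g. P z = z + g *\<^sub>R n \<and> \<bar>g\<bar> \<le> 2 * C * (dist z x0)\<^sup>2"
    and x: "\<bar>(x - x0) \<bullet> n\<bar> \<le> C * (norm (x - x0))\<^sup>2" and r: "r = dist x x0" "0 < r" "t \<le> r" "t \<le> \<delta>1\<^sup>2"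
  shows "(\<integral>\<^sup>+z. rker s (dist x (P z)) * indicator (sphere (x0 - n) 1 \<inter> cball x0 \<delta>1) z \<partial>N)
    \<le> ennreal (1 + 12 * s * exp s * K * (t / r) powr (9/10 * (real d - s)) + 12 * 4 powr s * K * (t / r) powr (real d - s)) * rker s (dist x (x0 + t *\<^sub>R n))"
proof -
  define q where "q = x0 + t *\<^sub>R n"
  define S where "S = sphere (x0 - n) 1"
  define \<beta> where "\<beta> = real d - s"
  have \<beta>: "0 < \<beta>" "\<beta> \<le> 1" using s by (auto simp: \<beta>_def)
  define b where "b = 9/10 * \<beta>"
  have b: "0 < b" "b \<le> 1" using \<beta> by (auto simp: b_def)
  have sN [measurable_cong]: "sets N = sets borel" by (rule sweep_sets[OF sw])
  have spN: "space N = UNIV" by (simp add: sets_eq_imp_space_eq[OF sN])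
  note [measurable] = P(1)
  have "1 * \<delta>1 \<le> C * \<delta>1" using C \<delta>1 by (intro mult_right_mono) auto
  then have \<delta>s: "\<delta>1 \<le> 1/40" using \<delta>1 by linarith
  have t\<delta>: "t \<le> \<delta>1 / 40"
  proof -
    have "\<delta>1 * \<delta>1 \<le> \<delta>1 * (1/40)" using \<delta>s \<delta>1 by (intro mult_left_mono) auto
    then show ?thesis using r by (simp add: power2_eq_square)
  qed
  have Ct: "4 * C * t \<le> 1"
  proof -
    have "C * t \<le> C * (\<delta>1 / 40)" using t\<delta> C by (intro mult_left_mono) auto
    then show ?thesis using \<delta>1 by simp
  qed
  have xq: "r / 2 \<le> dist x q" "dist x q \<le> r + t" 
    using flat_dist_bounds[OF n x t Ct] unfolding q_def r(1) by auto
  have xq0: "x \<noteq> q" using xq r by auto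
  have qS: "dist q (x0 - n) = 1 + t"
  proof -
    have "q - (x0 - n) = (1 + t) *\<^sub>R n" by (simp add: q_def algebra_simps)
    then show ?thesis using n t by (simp add: dist_norm)
  qed
  have qx0: "dist q x0 = t" using n t by (simp add: q_def dist_norm)
  have SK [measurable]: "S \<inter> cball x0 \<delta>1 \<in> sets borel" by (auto simp: S_def)
  have zq: "t \<le> dist z q" if "z \<in> S" for z
    using dist_triangle[of q "x0 - n" z] that qS by (simp add: S_def dist_commute)
  have Pz: "dist (P z) z \<le> dist z x0 / 4" if zz: "z \<in> S \<inter> cball x0 \<delta>1" for z
  proof -
    obtain g where g: "P z = z + g *\<^sub>R n" "\<bar>g\<bar> \<le> 2 * C * (dist z x0)\<^sup>2"
      using P(2)[of z] zz unfolding S_def by blast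
    have zd: "dist z x0 \<le> \<delta>1" using zz by (simp add: dist_commute)
    have "2 * C * (dist z x0)\<^sup>2 = (2 * C * dist z x0) * dist z x0" by (simp add: power2_eq_square)
    also have "\<dots> \<le> (2 * C * \<delta>1) * dist z x0" using zd C by (intro mult_right_mono mult_left_mono) auto
    also have "\<dots> \<le> (1/4) * dist z x0" using \<delta>1 by (intro mult_right_mono) auto
    finally have "2 * C * (dist z x0)\<^sup>2 \<le> dist z x0 / 4" by simp
    moreover have "dist (P z) z = \<bar>g\<bar>" using g n by (simp add: dist_norm)
    ultimately show ?thesis using g(2) by simp
  qed
  define R where "R = rker s (dist x q)"
  have near: "(\<integral>\<^sup>+z. rker s (dist x (P z)) * indicator (S \<inter> cball x0 \<delta>1 \<inter> {z. dist z q \<le> r / 12}) z \<partial>N)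
     \<le> ennreal (1 + 12 * s * exp s * K * (t / r) powr b) * R"
  proof -
    have "(\<integral>\<^sup>+z. rker s (dist x (P z)) * indicator (S \<inter> cball x0 \<delta>1 \<inter> {z. dist z q \<le> r / 12}) z \<partial>N)
      \<le> (\<integral>\<^sup>+z. R + (ennreal (12 * s * exp s * r powr (- b)) * R) * ennreal (dist z q powr b) \<partial>N)"
    proof (rule nn_integral_mono)
      fix z
      show "rker s (dist x (P z)) * indicator (S \<inter> cball x0 \<delta>1 \<inter> {z. dist z q \<le> r / 12}) z \<le>
        R + (ennreal (12 * s * exp s * r powr (- b)) * R) * ennreal (dist z q powr b)"
      proof (cases "z \<in> S \<inter> cball x0 \<delta>1 \<inter> {z. dist z q \<le> r / 12}")
        case True
        then have z: "z \<in> S" "z \<in> S \<inter> cball x0 \<delta>1" "dist z q \<le> r / 12" by auto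
        have zx: "dist z x0 \<le> 2 * dist z q" using dist_triangle[of z x0 q] qx0 zq[OF z(1)] by simp
        have "dist (P z) q \<le> dist (P z) z + dist z q" by (rule dist_triangle)
        also have "\<dots> \<le> 3 * dist z q" using Pz[OF z(2)] zx zero_le_dist[of z q] by linarith
        finally have Pq: "dist (P z) q \<le> 3 * dist z q" .
        \<comment> \<open>Transport moves the mass point to within \<open>3 * dist z q\<close> of
          the pole, and \<open>dist x q\<close> is at least \<open>r / 2\<close>; their ratio is at
          most this relative displacement.\<close>
        define w where "w = 6 * dist z q / r"
        have w: "0 \<le> w" "w \<le> 1/2" using z r by (auto simp: w_def field_simps)
        have "3 * dist z q = w * (r / 2)" using r by (simp add: w_def)
        also have "\<dots> \<le> w * dist x q" using w xq by (intro mult_left_mono)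
        finally have "(1 - w) * dist x q \<le> dist x (P z)"
          using Pq dist_triangle[of x q "P z"] by (simp add: algebra_simps)
        then have "rker s (dist x (P z)) \<le> ennreal ((1 - w) powr (- s)) * R"
          unfolding R_def using w s by (intro rker_le_scaled) auto
        also have "\<dots> \<le> ennreal (1 + 12 * s * exp s * r powr (- b) * dist z q powr b) * R"
        proof (intro mult_right_mono ennreal_leI)
          \<comment> \<open>Lowering the power to \<open>b\<close> is allowed as
            \<open>w \<le> 1\<close>; the moment of order \<open>b\<close> is the one known to be of
            order \<open>t powr b\<close>.\<close>
          have "w powr 1 \<le> w powr b" using w b by (intro powr_mono') auto
          also have "w powr b = 6 powr b * (dist z q powr b * r powr (- b))"
            using r by (simp add: w_def powr_divide powr_mult powr_minus_divide)
          also have "\<dots> \<le> 6 * (dist z q powr b * r powr (- b))"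
            using b powr_mono[of b 1 6] by (intro mult_right_mono) auto
          finally have "w \<le> 6 * (dist z q powr b * r powr (- b))" using w by simp
          then have "2 * s * exp s * w \<le> 2 * s * exp s * (6 * (dist z q powr b * r powr (- b)))"
            using s by (intro mult_left_mono) auto
          moreover have "(1 - w) powr (- s) \<le> 1 + 2 * s * exp s * w" using w s by (intro one_minus_powr_le) auto
          ultimately show "(1 - w) powr (- s) \<le> 1 + 12 * s * exp s * r powr (- b) * dist z q powr b"
            by (simp add: mult_ac)
        qed simp
        also have "\<dots> = R + (ennreal (12 * s * exp s * r powr (- b)) * R) * ennreal (dist z q powr b)"
          using s by (simp add: ennreal_plus ennreal_mult distrib_right distrib_left mult_ac)
        finally show ?thesis using True by simp
      qed simp
    qed
    also have "\<dots> = R * emeasure N UNIV + (ennreal (12 * s * exp s * r powr (- b)) * R) * (\<integral>\<^sup>+z. ennreal (dist z q powr b) \<partial>N)"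
      by (subst nn_integral_add, measurable) (subst nn_integral_cmult, measurable, simp add: spN)
    also have "\<dots> \<le> R * 1 + (ennreal (12 * s * exp s * r powr (- b)) * R) * ennreal (K * t powr b)"
      using sweep_mass_le[OF sw] sweep_moment_low[OF sw] unfolding b_def \<beta>_def q_def
      by (intro add_mono mult_left_mono) auto
    also have "\<dots> = ennreal (1 + 12 * s * exp s * r powr (- b) * (K * t powr b)) * R"
      using s K by (simp add: ennreal_plus ennreal_mult distrib_right distrib_left mult_ac)
    also have "12 * s * exp s * r powr (- b) * (K * t powr b) = 12 * s * exp s * K * (t / r) powr b"
      using r t by (simp add: powr_divide powr_minus_divide)
    finally show ?thesis .
  qed
  have far: "(\<integral>\<^sup>+z. rker s (dist x (P z)) * indicator (S \<inter> cball x0 \<delta>1 \<inter> {z. r / 12 < dist z q}) z \<partial>N)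
     \<le> ennreal (12 * 4 powr s * K * (t / r) powr \<beta>) * R"
  proof -
    have tr: "K * (t / (r / 12)) powr \<beta> \<le> 12 * K * (t / r) powr \<beta>"
    proof -
      have "t / (r / 12) = 12 * (t / r)" by simp
      then have "(t / (r / 12)) powr \<beta> = 12 powr \<beta> * (t / r) powr \<beta>" using t r by (simp only: powr_mult)
      also have "\<dots> \<le> 12 * (t / r) powr \<beta>" using \<beta> powr_mono[of \<beta> 1 12] by (intro mult_right_mono) auto
      finally show ?thesis using K by simp
    qed
    have two: "2 powr s * 2 powr s = (4::real) powr s" by (simp add: powr_mult[symmetric])
    have r12: "r / 12 > 0" using r by simp
    \<comment> \<open>For \<open>r \<le> 4 * \<delta>1\<close> the point \<open>x\<close> still has
      a sphere point vertically over or under it, and the comparison is made on the sphere. Farther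
      out all transported mass stays near \<open>x0\<close>, the kernel is comparable with the one
      with pole \<open>q\<close>, and the mass of the tail suffices.\<close>
    show ?thesis
    proof (cases "r \<le> 4 * \<delta>1")
      case True
      define e where "e = 24 * C\<^sup>2 * ((dist x x0)\<^sup>2 + t)"
      have "C * r \<le> C * (4 * \<delta>1)" using True C by (intro mult_left_mono) auto
      then have Cr: "C * r \<le> 1/2" using \<delta>1 by simp
      have e: "0 \<le> e" "e \<le> 1/2"
      proof -
        show "0 \<le> e" using t by (simp add: e_def)
        have "(dist x x0)\<^sup>2 \<le> (4 * \<delta>1)\<^sup>2" using True r by (intro power_mono) auto
        then have "(dist x x0)\<^sup>2 + t \<le> 17 * \<delta>1\<^sup>2" using r by (simp add: power_mult_distrib)
        then have "e \<le> 24 * C\<^sup>2 * (17 * \<delta>1\<^sup>2)" unfolding e_def by (intro mult_left_mono) auto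
        also have "\<dots> = 408 * (C * \<delta>1)\<^sup>2" by (simp add: power_mult_distrib)
        also have "(C * \<delta>1)\<^sup>2 \<le> (1/40)\<^sup>2" using \<delta>1 C by (intro power_mono) auto
        finally show "e \<le> 1/2" by (simp add: power2_eq_square)
      qed
      obtain w a where w: "w \<in> S" "x = w + a *\<^sub>R n" "dist w x0 \<le> 2 * dist x x0" "(1 - e) * dist x q \<le> dist w q"
        using over_sphere[OF n C t, of x x0] x Cr e unfolding S_def q_def e_def r dist_norm[of x x0, symmetric] by auto
      have wS: "w \<in> sphere (x0 - n) 1" using w(1) by (simp add: S_def)
      have wq: "w \<noteq> q" using w(1) qS t by (auto simp: S_def dist_commute)
      have "(\<integral>\<^sup>+z. rker s (dist x (P z)) * indicator (S \<inter> cball x0 \<delta>1 \<inter> {z. r / 12 < dist z q}) z \<partial>N)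
        \<le> (\<integral>\<^sup>+z. ennreal (2 powr s) * (rker s (dist w z) * indicator {z. r / 12 < dist z q} z) \<partial>N)"
      proof (rule nn_integral_mono)
        fix z
        show "rker s (dist x (P z)) * indicator (S \<inter> cball x0 \<delta>1 \<inter> {z. r / 12 < dist z q}) z
          \<le> ennreal (2 powr s) * (rker s (dist w z) * indicator {z. r / 12 < dist z q} z)"
        proof (cases "z \<in> S \<inter> cball x0 \<delta>1 \<inter> {z. r / 12 < dist z q}")
          case z: True
          then obtain g where g: "P z = z + g *\<^sub>R n" using P(2)[of z] by (auto simp: S_def)
          have zS: "z \<in> sphere (x0 - n) 1" and zd: "dist z x0 \<le> \<delta>1" using z by (auto simp: S_def dist_commute)
          have "(1 - 4 * (4 * \<delta>1)\<^sup>2) * dist w z \<le> dist (w + a *\<^sub>R n) (z + g *\<^sub>R n)"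
            by (rule vertical_pair[OF n zS wS]) (use zd w True r \<delta>s \<delta>1 in auto)
          moreover have "\<delta>1\<^sup>2 \<le> (1/40)\<^sup>2" using \<delta>1 \<delta>s by (intro power_mono) auto
          then have "(1/2) * dist w z \<le> (1 - 4 * (4 * \<delta>1)\<^sup>2) * dist w z"
            by (intro mult_right_mono) (auto simp: power2_eq_square)
          ultimately have "(1/2) * dist w z \<le> dist x (P z)" using w(2) g by simp
          then have "rker s (dist x (P z)) \<le> ennreal ((1/2) powr (- s)) * rker s (dist w z)"
            using s by (intro rker_le_scaled) auto
          moreover have "(1/2) powr (- s) = 2 powr s" by (simp add: powr_minus_divide powr_divide)
          ultimately show ?thesis using z by simp
        qed simp
      qed
      also have "\<dots> = ennreal (2 powr s) * (\<integral>\<^sup>+z. rker s (dist w z) * indicator {z. r / 12 < dist z q} z \<partial>N)"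
        by (rule nn_integral_cmult) measurable
      also have "\<dots> \<le> ennreal (2 powr s) * (ennreal (K * (t / (r / 12)) powr \<beta>) * rker s (dist w q))"
        using sweep_tail[OF sw, of w "r / 12"] wq r12 unfolding q_def \<beta>_def by (intro mult_left_mono) auto
      also have "\<dots> \<le> ennreal (2 powr s) * (ennreal (12 * K * (t / r) powr \<beta>) * (ennreal (2 powr s) * R))"
      proof (rule mult_left_mono[OF mult_mono[OF ennreal_leI[OF tr]]])
        have "(1/2) * dist x q \<le> (1 - e) * dist x q" using e by (intro mult_right_mono) auto
        then have "(1/2) * dist x q \<le> dist w q" using w(4) by simp
        then have "rker s (dist w q) \<le> ennreal ((1/2) powr (- s)) * R"
          unfolding R_def using s by (intro rker_le_scaled) auto
        then show "rker s (dist w q) \<le> ennreal (2 powr s) * R" by (simp add: powr_minus_divide powr_divide)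
      qed auto
      also have "\<dots> = ennreal ((2 powr s * 2 powr s) * (12 * K * (t / r) powr \<beta>)) * R"
        using K by (simp add: ennreal_mult mult_ac)
      finally show ?thesis by (simp add: two mult_ac)
    next
      case False
      have "(\<integral>\<^sup>+z. rker s (dist x (P z)) * indicator (S \<inter> cball x0 \<delta>1 \<inter> {z. r / 12 < dist z q}) z \<partial>N)
        \<le> (\<integral>\<^sup>+z. (ennreal (4 powr s) * R) * indicator {z. r / 12 < dist z q} z \<partial>N)"
      proof (rule nn_integral_mono)
        fix z
        show "rker s (dist x (P z)) * indicator (S \<inter> cball x0 \<delta>1 \<inter> {z. r / 12 < dist z q}) z
          \<le> (ennreal (4 powr s) * R) * indicator {z. r / 12 < dist z q} z"
        proof (cases "z \<in> S \<inter> cball x0 \<delta>1 \<inter> {z. r / 12 < dist z q}")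
          case z: True
          have "dist (P z) x0 \<le> dist (P z) z + dist z x0" by (rule dist_triangle)
          also have "\<dots> \<le> 2 * \<delta>1" using Pz[of z] z \<delta>1 by (auto simp: dist_commute)
          finally have "r / 2 \<le> dist x (P z)" using False dist_triangle[of x x0 "P z"] r by simp
          then have "(1/4) * dist x q \<le> dist x (P z)" using xq r by simp
          then have "rker s (dist x (P z)) \<le> ennreal ((1/4) powr (- s)) * R"
            unfolding R_def using s by (intro rker_le_scaled) auto
          then show ?thesis using z by (simp add: powr_minus_divide powr_divide)
        qed simp
      qed
      also have "\<dots> = (ennreal (4 powr s) * R) * emeasure N {z. r / 12 < dist z q}"
        by (rule nn_integral_cmult_indicator) (simp add: sN)
      also have "\<dots> \<le> (ennreal (4 powr s) * R) * ennreal (12 * K * (t / r) powr \<beta>)"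
      proof (rule mult_left_mono)
        have "emeasure N {z. r / 12 < dist z q} \<le> ennreal (K * (t / (r / 12)) powr \<beta>)"
          using sweep_tail_mass[OF sw r12] unfolding q_def \<beta>_def .
        also have "\<dots> \<le> ennreal (12 * K * (t / r) powr \<beta>)" by (rule ennreal_leI) (rule tr)
        finally show "emeasure N {z. r / 12 < dist z q} \<le> ennreal (12 * K * (t / r) powr \<beta>)" .
      qed simp
      also have "\<dots> = ennreal (4 powr s * (12 * K * (t / r) powr \<beta>)) * R"
        using K by (simp add: ennreal_mult mult_ac)
      finally show ?thesis by (simp add: mult_ac)
    qed
  qed
  have "(\<integral>\<^sup>+z. rker s (dist x (P z)) * indicator (S \<inter> cball x0 \<delta>1) z \<partial>N) =
    (\<integral>\<^sup>+z. rker s (dist x (P z)) * indicator (S \<inter> cball x0 \<delta>1 \<inter> {z. dist z q \<le> r / 12}) z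
      + rker s (dist x (P z)) * indicator (S \<inter> cball x0 \<delta>1 \<inter> {z. r / 12 < dist z q}) z \<partial>N)"
    by (rule nn_integral_cong) (auto simp: indicator_def)
  also have "\<dots> = (\<integral>\<^sup>+z. rker s (dist x (P z)) * indicator (S \<inter> cball x0 \<delta>1 \<inter> {z. dist z q \<le> r / 12}) z \<partial>N)
      + (\<integral>\<^sup>+z. rker s (dist x (P z)) * indicator (S \<inter> cball x0 \<delta>1 \<inter> {z. r / 12 < dist z q}) z \<partial>N)"
    by (rule nn_integral_add) measurable
  also have "\<dots> \<le> ennreal (1 + 12 * s * exp s * K * (t / r) powr b) * R + ennreal (12 * 4 powr s * K * (t / r) powr \<beta>) * R"
    by (rule add_mono[OF near far])
  also have "\<dots> = ennreal (1 + 12 * s * exp s * K * (t / r) powr b + 12 * 4 powr s * K * (t / r) powr \<beta>) * R"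
    using K s by (simp add: ennreal_plus distrib_right)
  finally show ?thesis by (simp add: S_def b_def \<beta>_def q_def R_def)
qed

text \<open>Restricting the swept measure to a cap around \<open>x0\<close> loses mass of order
  \<open>t powr \<beta>\<close> by the tail bound; the rest is moved vertically to \<open>A\<close>
  by a measurable choice of point. The result is an admissible test measure with potential barely
  above the kernel.\<close>

lemma transfer_measure:
  fixes A :: "'a::euclidean_space set"
  assumes A: "closed A" and C: "C \<ge> 1" and fl: "flat_at A C \<delta> x0 n"
    and \<delta>1: "0 < \<delta>1" "\<delta>1 \<le> \<delta>" "40 * C * \<delta>1 \<le> 1"
    and s: "0 < s" "real d - 1 \<le> s" "s < real d" and K: "K > 0" and t: "0 < t" "t \<le> (\<delta>1 / 2) ^ 3"
    and sw: "sweep s d K x0 n t N"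
  defines "\<beta> \<equiv> real d - s" and "q \<equiv> x0 + t *\<^sub>R n"
  shows "\<exists>\<nu>. finite_measure \<nu> \<and> sets \<nu> = sets borel \<and> emeasure \<nu> (- A) = 0 \<and> (\<integral>\<^sup>+x. rpot s \<nu> x \<partial>\<nu>) < \<infinity> \<and>
    1 \<le> emeasure \<nu> UNIV + ennreal (K * (1 + (2 / \<delta>1) powr \<beta>) * t powr \<beta>) \<and>
    (\<forall>x\<in>A. rpot s \<nu> x \<le> ennreal (1 + (104 * s * exp s * C\<^sup>2 + 12 * s * exp s * K + 12 * 4 powr s * K) * t powr (3/5 * \<beta>)) * rker s (dist x q))"
proof -
  have n: "norm n = 1" and flat: "\<And>x. x \<in> A \<Longrightarrow> \<bar>(x - x0) \<bullet> n\<bar> \<le> C * (norm (x - x0))\<^sup>2"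
    using fl by (auto simp: flat_at_def)
  have \<beta>: "0 < \<beta>" "\<beta> \<le> 1" using s by (auto simp: \<beta>_def)
  have sN [measurable_cong]: "sets N = sets borel" by (rule sweep_sets[OF sw])
  have spN: "space N = UNIV" by (simp add: sets_eq_imp_space_eq[OF sN])
  define S where "S = sphere (x0 - n) 1 \<inter> cball x0 \<delta>1"
  have "1 * \<delta>1 \<le> C * \<delta>1" using C \<delta>1 by (intro mult_right_mono) auto
  then have \<delta>s: "\<delta>1 \<le> 1/40" using \<delta>1 by linarith
  \<comment> \<open>The relative errors are \<open>\<rho>\<^sup>2\<close> inside the ball of radius \<open>\<rho>\<close> and \<open>(t / \<rho>) powr (9/10 * \<beta>)\<close> outside;
    this choice makes both at most \<open>t powr (3/5 * \<beta>)\<close>.\<close>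
  define \<rho> where "\<rho> = t powr (1/3)"
  have \<rho>0: "0 < \<rho>" using t by (simp add: \<rho>_def)
  have \<rho>3: "\<rho> ^ 3 = t" using t by (simp add: \<rho>_def powr_power)
  have "\<rho> ^ 3 \<le> (\<delta>1 / 2) ^ 3" using t \<rho>3 by simp
  then have \<rho>\<delta>: "2 * \<rho> \<le> \<delta>1" using power_mono_iff[of \<rho> "\<delta>1 / 2" 3] \<rho>0 \<delta>1 by simp
  have \<rho>1: "\<rho> \<le> 1" using \<rho>\<delta> \<delta>s by simp
  have t\<rho>2: "t \<le> \<rho>\<^sup>2" using power_decreasing[of 2 3 \<rho>] \<rho>0 \<rho>1 \<rho>3 by simp
  have t\<rho>: "t \<le> \<rho>" using power_decreasing[of 1 3 \<rho>] \<rho>0 \<rho>1 \<rho>3 by simp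
  have t1: "t \<le> 1" using t\<rho> \<rho>1 by simp
  have t\<delta>2: "t \<le> \<delta>1\<^sup>2" using t\<rho>2 power_mono[of \<rho> \<delta>1 2] \<rho>\<delta> \<rho>0 by linarith
  have t\<delta>: "t \<le> \<delta>1 / 2" using t\<rho> \<rho>\<delta> by simp
  have Ct: "4 * C * t \<le> 1"
  proof -
    have "C * t \<le> C * (\<delta>1 / 2)" using t\<delta> C by (intro mult_left_mono) auto
    then show ?thesis using \<delta>1 by simp
  qed
  have "\<exists>P\<in>borel_measurable borel. \<forall>z\<in>S. P z \<in> A \<and> (\<exists>g. \<bar>g\<bar> \<le> 2 * C * (dist z x0)\<^sup>2 \<and> P z = z + g *\<^sub>R n)"
  proof (rule vertical_selection[OF A])
    show "compact S" unfolding S_def by (intro closed_Int_compact) auto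
    show "continuous_on S (\<lambda>z. 2 * C * (dist z x0)\<^sup>2)" by (intro continuous_intros)
    fix z assume "z \<in> S"
    then show "\<exists>g. \<bar>g\<bar> \<le> 2 * C * (dist z x0)\<^sup>2 \<and> z + g *\<^sub>R n \<in> A"
      using over_submanifold[OF fl C, of z] \<delta>1 by (auto simp: S_def dist_commute)
  qed
  then obtain P where P [measurable]: "P \<in> borel_measurable borel" and PA: "\<And>z. z \<in> S \<Longrightarrow> P z \<in> A"
    and Pg: "\<And>z. z \<in> S \<Longrightarrow> \<exists>g. \<bar>g\<bar> \<le> 2 * C * (dist z x0)\<^sup>2 \<and> P z = z + g *\<^sub>R n"
    by blast
  have S [measurable]: "S \<in> sets borel" by (auto simp: S_def)
  define \<nu> where "\<nu> = distr (density N (indicator S)) borel P"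
  have sO [simp]: "sets \<nu> = sets borel" by (simp add: \<nu>_def)
  have spO: "space \<nu> = UNIV" by (simp add: sets_eq_imp_space_eq[OF sO])
  have OI: "(\<integral>\<^sup>+x. f x \<partial>\<nu>) = (\<integral>\<^sup>+z. f (P z) * indicator S z \<partial>N)" if [measurable]: "f \<in> borel_measurable borel" for f
    unfolding \<nu>_def by (subst nn_integral_distr, measurable, subst nn_integral_density, measurable) (simp add: mult.commute)
  have eO: "emeasure \<nu> E = (\<integral>\<^sup>+z. indicator E (P z) * indicator S z \<partial>N)" if "E \<in> sets borel" for E
    using OI[of "indicator E"] that by simp
  have tot: "emeasure \<nu> UNIV = emeasure N S"
    by (subst eO) (auto simp: sN)
  have supp: "emeasure \<nu> (- A) = 0"
  proof -
    have "(\<lambda>z. indicator (- A) (P z) * indicator S z :: ennreal) = (\<lambda>z. 0)"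
      using PA by (auto simp: fun_eq_iff indicator_def)
    then show ?thesis using A by (subst eO) auto
  qed
  have O1: "emeasure \<nu> UNIV \<le> 1"
    unfolding tot using sweep_mass_le[OF sw] emeasure_mono[of S UNIV N] sN by (auto intro: order_trans)
  have Ofin: "finite_measure \<nu>" by (rule finite_measureI) (use O1 in \<open>auto simp: spO top_unique\<close>)
  have mass: "1 \<le> emeasure \<nu> UNIV + ennreal (K * (1 + (2 / \<delta>1) powr \<beta>) * t powr \<beta>)"
  proof -
    have qx0: "dist q x0 = t" using n t by (simp add: q_def dist_norm)
    have sub: "UNIV \<subseteq> S \<union> ((- sphere (x0 - n) 1) \<union> {z. \<delta>1 / 2 < dist z q})"
    proof
      fix z :: 'a
      have "dist x0 z \<le> dist z q + t" using dist_triangle[of z x0 q] qx0 by (simp add: dist_commute)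
      then show "z \<in> S \<union> ((- sphere (x0 - n) 1) \<union> {z. \<delta>1 / 2 < dist z q})"
        using t\<delta> by (auto simp: S_def)
    qed
    have "emeasure N UNIV \<le> emeasure N (S \<union> ((- sphere (x0 - n) 1) \<union> {z. \<delta>1 / 2 < dist z q}))"
      using sub by (intro emeasure_mono) (auto simp: sN)
    also have "\<dots> \<le> emeasure N S + emeasure N ((- sphere (x0 - n) 1) \<union> {z. \<delta>1 / 2 < dist z q})"
      by (intro emeasure_subadditive) (auto simp: sN)
    also have "\<dots> \<le> emeasure N S + (emeasure N (- sphere (x0 - n) 1) + emeasure N {z. \<delta>1 / 2 < dist z q})"
      by (intro add_left_mono emeasure_subadditive) (auto simp: sN)
    also have "\<dots> \<le> emeasure N S + (0 + ennreal (K * (t / (\<delta>1 / 2)) powr \<beta>))"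
      using sweep_support[OF sw] sweep_tail_mass[OF sw, of "\<delta>1 / 2"] \<delta>1 
      by (intro add_left_mono add_mono) (auto simp: \<beta>_def q_def)
    also have "K * (t / (\<delta>1 / 2)) powr \<beta> = K * (2 / \<delta>1) powr \<beta> * t powr \<beta>"
    proof -
      have "t / (\<delta>1 / 2) = (2 / \<delta>1) * t" by simp
      then show ?thesis by (simp only: powr_mult mult.assoc)
    qed
    finally have "emeasure N UNIV \<le> emeasure \<nu> UNIV + ennreal (K * (2 / \<delta>1) powr \<beta> * t powr \<beta>)" by (simp add: tot)
    then have "emeasure N UNIV + ennreal (K * t powr \<beta>) \<le> emeasure \<nu> UNIV + ennreal (K * (2 / \<delta>1) powr \<beta> * t powr \<beta>) + ennreal (K * t powr \<beta>)"
      by (rule add_right_mono)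
    also have "\<dots> = emeasure \<nu> UNIV + ennreal (K * (1 + (2 / \<delta>1) powr \<beta>) * t powr \<beta>)"
      using K by (simp add: add.assoc distrib_left distrib_right add.commute ennreal_plus[symmetric] del: ennreal_plus)
    finally show ?thesis using sweep_mass[OF sw] unfolding \<beta>_def by (rule order_trans[rotated])
  qed
  define M where "M = 104 * s * exp s * C\<^sup>2 + 12 * s * exp s * K + 12 * 4 powr s * K"
  have t\<rho>p: "(t / \<rho>) = t powr (2/3)"
  proof -
    have "t / \<rho> = \<rho> * \<rho>" using \<rho>3 \<rho>0 by (simp add: power3_eq_cube field_simps)
    also have "\<dots> = t powr (1/3 + 1/3)" unfolding \<rho>_def powr_add ..
    finally show ?thesis by simp
  qed
  have p1: "(t / \<rho>) powr \<beta> \<le> t powr (3/5 * \<beta>)"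
    unfolding t\<rho>p powr_powr using \<beta> t t1 by (intro powr_mono') auto
  have p2: "(t / \<rho>) powr (9/10 * \<beta>) = t powr (3/5 * \<beta>)"
    unfolding t\<rho>p powr_powr by (rule arg_cong[where f="\<lambda>a. t powr a"]) simp
  have p3: "\<rho>\<^sup>2 \<le> t powr (3/5 * \<beta>)"
  proof -
    have "\<rho>\<^sup>2 = t / \<rho>" unfolding \<rho>3[symmetric] using \<rho>0 by (simp add: power3_eq_cube power2_eq_square)
    then have "\<rho>\<^sup>2 = t powr (2/3)" by (simp only: t\<rho>p)
    also have "\<dots> \<le> t powr (3/5 * \<beta>)" using \<beta> t t1 by (intro powr_mono') auto
    finally show ?thesis .
  qed
  have bound: "rpot s \<nu> x \<le> ennreal (1 + M * t powr (3/5 * \<beta>)) * rker s (dist x q)" if x: "x \<in> A" for x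
  proof -
    have eq: "rpot s \<nu> x = (\<integral>\<^sup>+z. rker s (dist x (P z)) * indicator S z \<partial>N)"
      unfolding rpot_def by (rule OI) measurable
    show ?thesis
    proof (cases "dist x x0 \<le> \<rho>")
      case True
      have "rpot s \<nu> x \<le> ennreal (1 + 104 * s * exp s * C\<^sup>2 * \<rho>\<^sup>2 + 4 powr s * K * (t / \<rho>) powr \<beta>) * rker s (dist x q)"
        unfolding eq S_def \<beta>_def q_def
        using Pg by (intro transfer_bound_near[OF n C \<delta>1(3) s(1) K t(1) \<rho>0 \<rho>\<delta> t\<rho>2 sw P _ flat[OF x] True])
          (auto simp: S_def)
      also have "\<dots> \<le> ennreal (1 + M * t powr (3/5 * \<beta>)) * rker s (dist x q)"
      proof (intro mult_right_mono ennreal_leI)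
        have "104 * s * exp s * C\<^sup>2 * \<rho>\<^sup>2 \<le> 104 * s * exp s * C\<^sup>2 * t powr (3/5 * \<beta>)"
          using p3 s by (intro mult_left_mono) auto
        moreover have "4 powr s * K * (t / \<rho>) powr \<beta> \<le> 12 * 4 powr s * K * t powr (3/5 * \<beta>)"
          using p1 K by (intro mult_mono) auto
        moreover have "0 \<le> 12 * s * exp s * K * t powr (3/5 * \<beta>)" using s K by simp
        ultimately show "1 + 104 * s * exp s * C\<^sup>2 * \<rho>\<^sup>2 + 4 powr s * K * (t / \<rho>) powr \<beta> \<le> 1 + M * t powr (3/5 * \<beta>)"
          unfolding M_def distrib_right by linarith
      qed simp
      finally show ?thesis .
    next
      case False
      define r where "r = dist x x0"
      have r: "r = dist x x0" "0 < r" "t \<le> r" "\<rho> \<le> r" using False \<rho>0 t\<rho> by (auto simp: r_def)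
      have "rpot s \<nu> x \<le> ennreal (1 + 12 * s * exp s * K * (t / r) powr (9/10 * \<beta>) + 12 * 4 powr s * K * (t / r) powr \<beta>) * rker s (dist x q)"
        unfolding eq S_def \<beta>_def q_def
        using Pg by (intro transfer_bound_far[OF n C \<delta>1(1,3) s K t(1) sw P _ flat[OF x] r(1-3) t\<delta>2])
          (auto simp: S_def)
      also have "\<dots> \<le> ennreal (1 + M * t powr (3/5 * \<beta>)) * rker s (dist x q)"
      proof (intro mult_right_mono ennreal_leI)
        have tr: "t / r \<le> t / \<rho>" using r \<rho>0 t by (intro divide_left_mono) auto
        have "(t / r) powr (9/10 * \<beta>) \<le> (t / \<rho>) powr (9/10 * \<beta>)" using tr r t \<beta> by (intro powr_mono2) auto
        then have "12 * s * exp s * K * (t / r) powr (9/10 * \<beta>) \<le> 12 * s * exp s * K * t powr (3/5 * \<beta>)"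
          unfolding p2 using s K by (intro mult_left_mono) auto
        moreover have "(t / r) powr \<beta> \<le> (t / \<rho>) powr \<beta>" using tr r t \<beta> by (intro powr_mono2) auto
        then have "12 * 4 powr s * K * (t / r) powr \<beta> \<le> 12 * 4 powr s * K * t powr (3/5 * \<beta>)"
          using p1 K by (intro mult_left_mono) auto
        moreover have "0 \<le> 104 * s * exp s * C\<^sup>2 * t powr (3/5 * \<beta>)" using s by simp
        ultimately show "1 + 12 * s * exp s * K * (t / r) powr (9/10 * \<beta>) + 12 * 4 powr s * K * (t / r) powr \<beta> \<le> 1 + M * t powr (3/5 * \<beta>)"
          unfolding M_def distrib_right by linarith
      qed simp
      finally show ?thesis .
    qed
  qed
  \<comment> \<open>Finite energy: points of \<open>A\<close> have distance at least
    \<open>t\<close> from \<open>q\<close>, so the potential of the transported measure is bounded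
    on \<open>A\<close>.\<close>
  have "(\<integral>\<^sup>+x. rpot s \<nu> x \<partial>\<nu>) \<le> (\<integral>\<^sup>+x. ennreal (1 + M * t powr (3/5 * \<beta>)) * rker s t \<partial>\<nu>)"
  proof (rule nn_integral_mono_AE)
    have "AE x in \<nu>. x \<in> A" by (rule AE_supported) (use supp A in auto)
    then show "AE x in \<nu>. rpot s \<nu> x \<le> ennreal (1 + M * t powr (3/5 * \<beta>)) * rker s t"
    proof eventually_elim
      case (elim x)
      have "rker s (dist x q) \<le> rker s t"
        unfolding q_def using flat_dist_bounds(2)[OF n flat[OF elim] t(1) Ct] s t by (intro rker_antimono) auto
      then show ?case using bound[OF elim] by (meson mult_left_mono order_trans zero_le)
    qed
  qed
  also have "\<dots> = ennreal (1 + M * t powr (3/5 * \<beta>)) * rker s t * emeasure \<nu> UNIV" by (simp add: spO)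
  also have "\<dots> < \<infinity>"
    using t order_le_less_trans[OF O1 ennreal_one_less_top] by (simp add: rker_def ennreal_mult_less_top)
  finally have "(\<integral>\<^sup>+x. rpot s \<nu> x \<partial>\<nu>) < \<infinity>" .
  then show ?thesis using Ofin supp mass bound unfolding M_def by (intro exI[of _ \<nu>]) simp
qed

text \<open>If \<open>W \<le> U\<close> there is nothing to prove, and otherwise
  \<open>U * a\<close> is at most \<open>W * a\<close>. The case split moves a relative error from
  \<open>U\<close> to \<open>W\<close> without dividing or subtracting extended reals.\<close>

lemma absorb_factor:
  fixes W U :: ennreal
  assumes "W \<le> U + U * a + W * b" shows "W \<le> U + W * (a + b)"
proof (cases "W \<le> U")
  case True
  then show ?thesis by (simp add: add_increasing2)
next
  case False
  then have "U * a \<le> W * a" by (intro mult_right_mono) auto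
  then have "U + U * a + W * b \<le> U + W * a + W * b" by (intro add_right_mono add_left_mono)
  with assms have "W \<le> U + W * a + W * b" by (rule order_trans)
  then show ?thesis by (simp only: distrib_left add.assoc)
qed

section \<open>Lower bounds for the equilibrium potential\<close>

text \<open>Testing the variational inequality with the transported measure and exchanging
  potentials bounds \<open>W\<close> times its mass by the potential at \<open>q\<close> times 1
  plus the relative error; the missing mass is added back.\<close>

lemma potential_lower_bound_normal:
  fixes A :: "'a::euclidean_space set"
  assumes dim: "DIM('a) = d + 1" and d: "d \<ge> 1" and s: "0 < s" "real d - 1 \<le> s" "s < real d"
    and A: "compact A" and C: "C \<ge> 1" and \<delta>: "\<delta> > 0" and eq: "equilibrium_measure s A \<mu>"
  shows "\<exists>L>0. \<exists>t1>0. \<forall>x0 n t. flat_at A C \<delta> x0 n \<and> 0 < t \<and> t \<le> t1 \<longrightarrow>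
     wiener_energy s A \<le> rpot s \<mu> (x0 + t *\<^sub>R n) + wiener_energy s A * ennreal (L * t powr (3/5 * (real d - s)))"
proof -
  define \<beta> where "\<beta> = real d - s"
  have \<beta>: "0 < \<beta>" "\<beta> \<le> 1" using s by (auto simp: \<beta>_def)
  have cA: "closed A" using A by (rule compact_imp_closed)
  have bA: "A \<in> sets borel" using cA by simp
  have \<mu>: "prob_space \<mu>" "sets \<mu> = sets borel" "emeasure \<mu> (- A) = 0" and f\<mu>: "finite_measure \<mu>"
    using eq by (auto simp: equilibrium_measure_def prob_measure_on_def prob_space_def)
  note [measurable_cong] = \<mu>(2)
  obtain K where K: "K > 0" and sweep: "\<And>(x0::'a) n t. norm n = 1 \<and> 0 < t \<and> t \<le> 1 \<longrightarrow> (\<exists>N. sweep s d K x0 n t N)"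
    using sweep_exists[OF dim d s] by blast
  define \<delta>1 where "\<delta>1 = min \<delta> (1 / (40 * C))"
  have \<delta>1: "0 < \<delta>1" "\<delta>1 \<le> \<delta>" "40 * C * \<delta>1 \<le> 1" using \<delta> C by (auto simp: \<delta>1_def min_def field_simps)
  define M where "M = 104 * s * exp s * C\<^sup>2 + 12 * s * exp s * K + 12 * 4 powr s * K"
  define K' where "K' = K * (1 + (2 / \<delta>1) powr \<beta>)"
  have MK: "0 < M" "0 < K'" using s K C by (auto simp: M_def K'_def add_pos_pos add_pos_nonneg)
  define W where "W = wiener_energy s A"
  have "W \<le> rpot s \<mu> (x0 + t *\<^sub>R n) + W * ennreal ((M + K') * t powr (3/5 * \<beta>))"
    if fl: "flat_at A C \<delta> x0 n" and t: "0 < t" "t \<le> min 1 ((\<delta>1 / 2) ^ 3)" for x0 n t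
  proof -
    define q where "q = x0 + t *\<^sub>R n"
    have n: "norm n = 1" using fl by (simp add: flat_at_def)
    have "\<exists>N. sweep s d K x0 n t N" using sweep[of n t x0] n t by simp
    then obtain N where sw: "sweep s d K x0 n t N" ..
    obtain \<nu> where \<nu>: "finite_measure \<nu>" "sets \<nu> = sets borel" "emeasure \<nu> (- A) = 0"
      "(\<integral>\<^sup>+x. rpot s \<nu> x \<partial>\<nu>) < \<infinity>" "1 \<le> emeasure \<nu> UNIV + ennreal (K' * t powr \<beta>)"
      and bd: "\<And>x. x \<in> A \<Longrightarrow> rpot s \<nu> x \<le> ennreal (1 + M * t powr (3/5 * \<beta>)) * rker s (dist x q)"
      using transfer_measure[OF cA C fl \<delta>1 s K t(1) _ sw] t unfolding M_def K'_def \<beta>_def q_def by auto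
    define m where "m = ennreal (M * t powr (3/5 * \<beta>))"
    have "W * emeasure \<nu> UNIV \<le> (\<integral>\<^sup>+x. rpot s \<mu> x \<partial>\<nu>)"
      unfolding W_def by (rule equilibrium_variation[OF eq bA \<nu>(1-4)])
    also have "\<dots> = (\<integral>\<^sup>+x. rpot s \<nu> x \<partial>\<mu>)" by (rule rpot_sym[OF f\<mu> \<mu>(2) \<nu>(1,2)])
    also have "\<dots> \<le> (\<integral>\<^sup>+x. (1 + m) * rker s (dist q x) \<partial>\<mu>)"
    proof (rule nn_integral_mono_AE)
      have "AE x in \<mu>. x \<in> A" by (rule AE_supported[OF \<mu>(2,3) bA])
      then show "AE x in \<mu>. rpot s \<nu> x \<le> (1 + m) * rker s (dist q x)"
        by eventually_elim (use bd MK in \<open>simp add: m_def dist_commute ennreal_plus\<close>)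
    qed
    also have "\<dots> = (1 + m) * rpot s \<mu> q" unfolding rpot_def by (rule nn_integral_cmult) measurable
    finally have 1: "W * emeasure \<nu> UNIV \<le> rpot s \<mu> q + rpot s \<mu> q * m" by (simp add: distrib_right mult.commute)
    have "W * 1 \<le> W * (emeasure \<nu> UNIV + ennreal (K' * t powr \<beta>))" by (rule mult_left_mono[OF \<nu>(5)]) simp
    also have "\<dots> \<le> rpot s \<mu> q + rpot s \<mu> q * m + W * ennreal (K' * t powr \<beta>)"
      using 1 by (simp add: distrib_left add_right_mono)
    finally have "W \<le> rpot s \<mu> q + W * (m + ennreal (K' * t powr \<beta>))"
      by (intro absorb_factor) simp
    also have "\<dots> \<le> rpot s \<mu> q + W * ennreal ((M + K') * t powr (3/5 * \<beta>))"
    proof (intro add_left_mono mult_left_mono)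
      have "t powr \<beta> \<le> t powr (3/5 * \<beta>)" using t \<beta> by (intro powr_mono') auto
      then have "K' * t powr \<beta> \<le> K' * t powr (3/5 * \<beta>)" using MK by simp
      then have "m + ennreal (K' * t powr \<beta>) \<le> m + ennreal (K' * t powr (3/5 * \<beta>))"
        by (intro add_left_mono ennreal_leI)
      also have "\<dots> = ennreal ((M + K') * t powr (3/5 * \<beta>))"
        using MK by (simp add: m_def distrib_right flip: ennreal_plus)
      finally show "m + ennreal (K' * t powr \<beta>) \<le> ennreal ((M + K') * t powr (3/5 * \<beta>))" .
    qed simp
    finally show ?thesis by (simp add: q_def)
  qed
  then show ?thesis using MK \<delta>1 unfolding W_def \<beta>_def
    by (intro exI[of _ "M + K'"] conjI exI[of _ "min 1 ((\<delta>1 / 2) ^ 3)"]) auto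
qed

section \<open>From normal points to the tangent sphere\<close>

text \<open>If \<open>z - x\<close> had a tangential part \<open>v\<close>, the point of
  \<open>A\<close> over \<open>x + e *\<^sub>R v\<close> would be closer to \<open>z\<close>: the
  gain is linear in \<open>e\<close>, while the vertical correction costs only order e^2.\<close>

lemma nearest_point_normal:
  fixes A :: "'a::euclidean_space set"
  assumes near: "\<And>y. y \<in> A \<Longrightarrow> dist z x \<le> dist z y" and fl: "flat_at A C \<delta> x n" and \<delta>: "\<delta> > 0" and C: "C \<ge> 0"
  shows "z = x + ((z - x) \<bullet> n) *\<^sub>R n"
proof -
  have n: "norm n = 1" using fl by (simp add: flat_at_def)
  define a where "a = (z - x) \<bullet> n"
  define v where "v = (z - x) - a *\<^sub>R n"
  have vn: "v \<bullet> n = 0" using n by (simp add: v_def a_def inner_diff_left norm_eq_1)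
  have zx: "z - x = v + a *\<^sub>R n" by (simp add: v_def)
  have "v = 0"
  proof (rule ccontr)
    assume v: "v \<noteq> 0"
    \<comment> \<open>Collects the coefficients of the quadratic cost; the last term makes
      \<open>norm (e *\<^sub>R v) \<le> \<delta>\<close> for the step length
      \<open>e = 1 / D\<close>.\<close>
    define D where "D = 1 + 2 * \<bar>a\<bar> * C + C\<^sup>2 * (norm v)\<^sup>2 + norm v / \<delta>"
    have nn: "0 \<le> 2 * \<bar>a\<bar> * C" "0 \<le> C\<^sup>2 * (norm v)\<^sup>2" "0 \<le> norm v / \<delta>" using C \<delta> by auto
    have D: "1 \<le> D" using nn by (simp add: D_def)
    define e where "e = 1 / D"
    have e: "0 < e" "e \<le> 1" using D by (auto simp: e_def)
    have eD: "e * D = 1" using D by (simp add: e_def)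
    have "e * (norm v / \<delta>) \<le> e * D" using e nn by (intro mult_left_mono) (auto simp: D_def)
    then have "e * (norm v / \<delta>) \<le> 1" unfolding eD .
    then have "norm (e *\<^sub>R v) \<le> \<delta>" using e(1) \<delta> by (simp add: pos_divide_le_eq)
    moreover have "(e *\<^sub>R v) \<bullet> n = 0" using vn by simp
    ultimately obtain g where g: "\<bar>g\<bar> \<le> C * (norm (e *\<^sub>R v))\<^sup>2" "x + e *\<^sub>R v + g *\<^sub>R n \<in> A"
      using fl unfolding flat_at_def by blast
    have gb: "\<bar>g\<bar> \<le> C * (e\<^sup>2 * (norm v)\<^sup>2)" using g(1) by (simp add: power_mult_distrib)
    have "(dist z x)\<^sup>2 \<le> (dist z (x + e *\<^sub>R v + g *\<^sub>R n))\<^sup>2" using near[OF g(2)] by (intro power_mono) auto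
    moreover have "(dist z x)\<^sup>2 = (norm v)\<^sup>2 + a\<^sup>2"
      using norm_add_scaleR_sq[OF n, of v a] vn by (simp add: dist_norm zx)
    moreover have "z - (x + e *\<^sub>R v + g *\<^sub>R n) = (1 - e) *\<^sub>R v + (a - g) *\<^sub>R n"
      using zx by (simp add: algebra_simps)
    then have "(dist z (x + e *\<^sub>R v + g *\<^sub>R n))\<^sup>2 = (1 - e)\<^sup>2 * (norm v)\<^sup>2 + (a - g)\<^sup>2"
      using norm_add_scaleR_sq[OF n, of "(1 - e) *\<^sub>R v" "a - g"] vn e by (simp add: dist_norm power_mult_distrib)
    ultimately have "(norm v)\<^sup>2 + a\<^sup>2 \<le> (1 - e)\<^sup>2 * (norm v)\<^sup>2 + (a - g)\<^sup>2" by simp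
    then have 1: "2 * e * (norm v)\<^sup>2 \<le> e\<^sup>2 * (norm v)\<^sup>2 - 2 * a * g + g\<^sup>2" by (simp add: power2_eq_square algebra_simps)
    have "- (2 * a * g) \<le> 2 * \<bar>a\<bar> * \<bar>g\<bar>" using abs_ge_minus_self[of "2 * a * g"] by (simp add: abs_mult)
    also have "\<dots> \<le> 2 * \<bar>a\<bar> * (C * (e\<^sup>2 * (norm v)\<^sup>2))" using gb by (intro mult_left_mono) auto
    finally have 2: "- (2 * a * g) \<le> e\<^sup>2 * (norm v)\<^sup>2 * (2 * \<bar>a\<bar> * C)" by (simp add: mult_ac)
    have "\<bar>g\<bar>\<^sup>2 \<le> (C * (e\<^sup>2 * (norm v)\<^sup>2))\<^sup>2" using gb by (intro power_mono) auto
    then have "g\<^sup>2 \<le> e\<^sup>2 * (norm v)\<^sup>2 * (C\<^sup>2 * (norm v)\<^sup>2) * e\<^sup>2" by (simp add: power2_eq_square mult_ac)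
    also have "\<dots> \<le> e\<^sup>2 * (norm v)\<^sup>2 * (C\<^sup>2 * (norm v)\<^sup>2) * 1" using e by (intro mult_left_mono power_le_one) auto
    finally have 3: "g\<^sup>2 \<le> e\<^sup>2 * (norm v)\<^sup>2 * (C\<^sup>2 * (norm v)\<^sup>2)" by simp
    have "2 * e * (norm v)\<^sup>2 \<le> e\<^sup>2 * (norm v)\<^sup>2 * (1 + 2 * \<bar>a\<bar> * C + C\<^sup>2 * (norm v)\<^sup>2)"
      using 1 2 3 unfolding distrib_left mult_1_right by linarith
    also have "\<dots> \<le> e\<^sup>2 * (norm v)\<^sup>2 * D" using nn by (intro mult_left_mono) (auto simp: D_def)
    also have "\<dots> = (e * D) * (e * (norm v)\<^sup>2)" by (simp add: power2_eq_square)
    finally have "2 * e * (norm v)\<^sup>2 \<le> e * (norm v)\<^sup>2" using eD by simp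
    moreover have "0 < e * (norm v)\<^sup>2" using e v by simp
    ultimately show False by simp
  qed
  then show ?thesis using zx by (simp add: a_def algebra_simps)
qed

text \<open>Moving up along the normal can approach a point of \<open>A\<close> only as far as that
  point rises above the tangent plane, and this height is quadratic. The base height may be 0, so
  points of \<open>A\<close> themselves are included.\<close>

lemma dist_along_normal:
  fixes y x n :: "'a::euclidean_space"
  assumes n: "norm n = 1" and flat: "\<bar>(y - x) \<bullet> n\<bar> \<le> C * (norm (y - x))\<^sup>2" and C: "C \<ge> 0"
    and \<gamma>: "0 \<le> \<gamma>" "\<gamma> \<le> T" and T: "4 * C * T \<le> 1"
  shows "(1 - 4 * C * T) * dist y (x + \<gamma> *\<^sub>R n) \<le> dist y (x + T *\<^sub>R n)"
proof -
  define h where "h = (y - x) \<bullet> n"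
  define V where "V = (norm (y - x))\<^sup>2"
  have V0: "0 \<le> V" by (simp add: V_def)
  have hV: "h \<le> C * V" using flat by (simp add: h_def V_def)
  have D: "(dist y (x + c *\<^sub>R n))\<^sup>2 = V - 2 * (c * h) + c\<^sup>2" for c
    using norm_add_scaleR_sq[OF n, of "y - x" "- c"] by (simp add: dist_norm h_def V_def algebra_simps)
  have CV: "0 \<le> C * V" using C V0 by simp
  have "\<gamma> * h \<le> \<gamma> * (C * V)" using hV \<gamma> by (intro mult_left_mono)
  also have "\<dots> \<le> T * (C * V)" using \<gamma> CV by (intro mult_right_mono)
  also have "\<dots> = (C * T) * V" by simp
  also have "\<dots> \<le> (1/4) * V" using T V0 by (intro mult_right_mono) auto
  finally have "\<gamma> * h \<le> (1/4) * V" .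
  moreover have k: "V \<le> 2 * (V - 2 * a + b)" if "a \<le> (1/4) * V" "0 \<le> b" for a b :: real
  proof -
    have "4 * a \<le> V" using that by simp
    then show ?thesis using that V0 by argo
  qed
  ultimately have V2: "V \<le> 2 * (dist y (x + \<gamma> *\<^sub>R n))\<^sup>2" unfolding D by (intro k) auto
  have "2 * (T - \<gamma>) * h \<le> 2 * (T - \<gamma>) * (C * V)" using hV \<gamma> by (intro mult_left_mono) auto
  also have "\<dots> \<le> 2 * T * (C * V)" using \<gamma> CV by (intro mult_right_mono) auto
  finally have "2 * (T * h) - 2 * (\<gamma> * h) \<le> 2 * C * T * V" by (simp add: algebra_simps)
  moreover have "\<gamma>\<^sup>2 \<le> T\<^sup>2" using \<gamma> by (intro power_mono)
  ultimately have "(dist y (x + \<gamma> *\<^sub>R n))\<^sup>2 - 2 * C * T * V \<le> (dist y (x + T *\<^sub>R n))\<^sup>2" unfolding D by linarith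
  moreover have CT: "0 \<le> C * T" using C \<gamma> by simp
  then have "2 * C * T * V \<le> 2 * C * T * (2 * (dist y (x + \<gamma> *\<^sub>R n))\<^sup>2)" using V2 by (intro mult_left_mono) auto
  ultimately have 1: "(1 - 4 * C * T) * (dist y (x + \<gamma> *\<^sub>R n))\<^sup>2 \<le> (dist y (x + T *\<^sub>R n))\<^sup>2"
    by (simp add: left_diff_distrib)
  have "(1 - 4 * C * T)\<^sup>2 * (dist y (x + \<gamma> *\<^sub>R n))\<^sup>2 \<le> (1 - 4 * C * T) * (dist y (x + \<gamma> *\<^sub>R n))\<^sup>2"
    using T CT by (intro mult_right_mono) (auto simp: power2_eq_square[of "1 - _"] mult_left_le)
  then have "((1 - 4 * C * T) * dist y (x + \<gamma> *\<^sub>R n))\<^sup>2 \<le> (dist y (x + T *\<^sub>R n))\<^sup>2"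
    using 1 by (simp add: power_mult_distrib)
  then show ?thesis by (rule power2_le_imp_le) simp
qed

lemma rpot_le_scaled:
  fixes M :: "'a::euclidean_space measure"
  assumes M: "sets M = sets borel" "emeasure M (- A) = 0" "A \<in> sets borel"
    and s: "0 \<le> s" and w: "0 \<le> w" "w \<le> 1/2" and D: "\<And>y. y \<in> A \<Longrightarrow> (1 - w) * dist y p \<le> dist y q"
  shows "rpot s M q \<le> ennreal (1 + 2 * s * exp s * w) * rpot s M p"
proof -
  note [measurable_cong] = M(1)
  have "AE y in M. y \<in> A" by (rule AE_supported[OF M])
  then have "rpot s M q \<le> (\<integral>\<^sup>+y. ennreal (1 + 2 * s * exp s * w) * rker s (dist p y) \<partial>M)"
    unfolding rpot_def
  proof (intro nn_integral_mono_AE, eventually_elim)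
    case (elim y)
    have "rker s (dist y q) \<le> ennreal ((1 - w) powr (- s)) * rker s (dist y p)"
      using D[OF elim(2)] w s by (intro rker_le_scaled) auto
    also have "\<dots> \<le> ennreal (1 + 2 * s * exp s * w) * rker s (dist y p)"
      using one_minus_powr_le[OF w s] by (intro mult_right_mono ennreal_leI) auto
    finally show ?case by (simp add: dist_commute)
  qed
  also have "\<dots> = ennreal (1 + 2 * s * exp s * w) * rpot s M p"
    unfolding rpot_def by (rule nn_integral_cmult) measurable
  finally show ?thesis .
qed

text \<open>A sphere point at distance \<open>D\<close> from the pole is within order D^2 of
  \<open>A\<close>, and it lies on the normal at its nearest point of \<open>A\<close>. The crude
  bound at height of that order doubles its exponent from 3/5 to 6/5 of \<beta>.\<close>

lemma potential_lower_bound_sphere: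
  fixes A :: "'a::euclidean_space set"
  assumes dim: "DIM('a) = d + 1" and d: "d \<ge> 1" and s: "0 < s" "real d - 1 \<le> s" "s < real d"
    and A: "compact A" and C: "C \<ge> 1" and \<delta>: "\<delta> > 0" and fl: "\<And>x. x \<in> A \<Longrightarrow> \<exists>n. flat_at A C \<delta> x n"
    and eq: "equilibrium_measure s A \<mu>"
  shows "\<exists>L>0. \<forall>x0 n t z. flat_at A C \<delta> x0 n \<and> 0 < t \<and> z \<in> sphere (x0 - n) 1 \<longrightarrow>
     wiener_energy s A \<le> rpot s \<mu> z + wiener_energy s A * ennreal (L * dist z (x0 + t *\<^sub>R n) powr (6/5 * (real d - s)))"
proof -
  define \<beta> where "\<beta> = real d - s"
  have \<beta>: "0 < \<beta>" "\<beta> \<le> 1" using s by (auto simp: \<beta>_def)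
  define W where "W = wiener_energy s A"
  have bA: "A \<in> sets borel" and cA: "closed A" using compact_imp_closed[OF A] by simp_all
  have \<mu>: "prob_space \<mu>" "sets \<mu> = sets borel" "emeasure \<mu> (- A) = 0"
    using eq by (auto simp: equilibrium_measure_def prob_measure_on_def)
  obtain L t1 where L: "L > 0" and t1: "t1 > 0"
    and low: "\<And>x0 n t. flat_at A C \<delta> x0 n \<and> 0 < t \<and> t \<le> t1 \<longrightarrow> W \<le> rpot s \<mu> (x0 + t *\<^sub>R n) + W * ennreal (L * t powr (3/5 * \<beta>))"
    using potential_lower_bound_normal[OF dim d s A C \<delta> eq] unfolding W_def \<beta>_def by blast
  define T1 where "T1 = min t1 (1 / (8 * C))"
  have T1: "0 < T1" "T1 \<le> t1" "8 * C * T1 \<le> 1" using t1 C by (auto simp: T1_def min_def field_simps)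
  define \<epsilon> where "\<epsilon> = min (\<delta> / 2) (sqrt (T1 / (8 * C)))"
  have \<epsilon>: "0 < \<epsilon>" "2 * \<epsilon> \<le> \<delta>" "\<epsilon> \<le> sqrt (T1 / (8 * C))" using \<delta> T1 C by (auto simp: \<epsilon>_def)
  define L1 where "L1 = (8 * s * exp s * C + L) * (8 * C)"
  \<comment> \<open>Makes the error term at least \<open>W\<close> once \<open>D\<close> exceeds
    \<epsilon>, so that the claim is trivial there.\<close>
  define L2 where "L2 = \<epsilon> powr (- (6/5 * \<beta>))"
  have LL: "0 < L1" "0 < L2" using L s C \<epsilon> by (auto simp: L1_def L2_def add_nonneg_pos)
  have "W \<le> rpot s \<mu> z + W * ennreal ((L1 + L2) * dist z (x0 + t *\<^sub>R n) powr (6/5 * \<beta>))"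
    if fx0: "flat_at A C \<delta> x0 n" and t: "0 < t" and z: "z \<in> sphere (x0 - n) 1" for x0 n t z
  proof -
    define q where "q = x0 + t *\<^sub>R n"
    define D where "D = dist z q"
    have n: "norm n = 1" using fx0 by (simp add: flat_at_def)
    have Dt: "t \<le> D"
    proof -
      have "q - (x0 - n) = (1 + t) *\<^sub>R n" by (simp add: q_def algebra_simps)
      then have "dist q (x0 - n) = 1 + t" using n t by (simp add: dist_norm)
      then show ?thesis using dist_triangle[of q "x0 - n" z] z by (simp add: D_def dist_commute)
    qed
    have "dist q x0 = t" using n t by (simp add: q_def dist_norm)
    then have zx: "dist z x0 \<le> 2 * D" using dist_triangle[of z x0 q] Dt by (simp add: D_def)
    have "\<exists>b. b \<le> (L1 + L2) * D powr (6/5 * \<beta>) \<and> W \<le> rpot s \<mu> z + W * ennreal b"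
    proof (cases "D \<le> \<epsilon>")
      case False
      have "\<epsilon> powr (6/5 * \<beta>) \<le> D powr (6/5 * \<beta>)" using False \<epsilon> \<beta> by (intro powr_mono2) auto
      then have "L2 * \<epsilon> powr (6/5 * \<beta>) \<le> L2 * D powr (6/5 * \<beta>)" using LL by (intro mult_left_mono) auto
      moreover have "L2 * \<epsilon> powr (6/5 * \<beta>) = 1" using \<epsilon> by (simp add: L2_def powr_minus)
      ultimately have "1 \<le> L2 * D powr (6/5 * \<beta>)" by simp
      also have "\<dots> \<le> (L1 + L2) * D powr (6/5 * \<beta>)" using LL by (intro mult_right_mono) auto
      finally have "1 \<le> (L1 + L2) * D powr (6/5 * \<beta>)" .
      then show ?thesis by (intro exI[of _ 1]) (simp add: add_increasing)
    next
      case True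
      have D0: "0 < D" using Dt t by simp
      \<comment> \<open>The vertical gap is at most \<open>2 * C * (dist z x0)\<^sup>2\<close>, and
        \<open>dist z x0 \<le> 2 * D\<close>.\<close>
      define T where "T = 8 * C * D\<^sup>2"
      have T0: "0 < T" using D0 C by (simp add: T_def)
      have "D\<^sup>2 \<le> (sqrt (T1 / (8 * C)))\<^sup>2" using True \<epsilon> D0 by (intro power_mono) auto
      also have "\<dots> = T1 / (8 * C)" using T1 C by simp
      finally have TT1: "T \<le> T1" using C by (simp add: T_def field_simps)
      have "1 * T1 \<le> C * T1" using C T1 by (intro mult_right_mono) auto
      then have Tle1: "T \<le> 1" using TT1 T1 by linarith
      have CT: "8 * C * T \<le> 1"
      proof -
        have "8 * C * T \<le> 8 * C * T1" using TT1 C by (intro mult_left_mono) auto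
        then show ?thesis using T1 by linarith
      qed
      have "dist z x0 \<le> \<delta>" using zx True \<epsilon> by simp
      then obtain g where g: "\<bar>g\<bar> \<le> 2 * C * (dist z x0)\<^sup>2" "z + g *\<^sub>R n \<in> A"
        using over_submanifold[OF fx0 C z] by blast
      have "(dist z x0)\<^sup>2 \<le> (2 * D)\<^sup>2" using zx by (intro power_mono) auto
      then have "2 * C * (dist z x0)\<^sup>2 \<le> 2 * C * (2 * D)\<^sup>2" using C by (intro mult_left_mono) auto
      then have gT: "\<bar>g\<bar> \<le> T" using g by (simp add: T_def power_mult_distrib)
      have "A \<noteq> {}" using g by blast
      then obtain x1 where x1: "x1 \<in> A" "\<And>y. y \<in> A \<Longrightarrow> dist z x1 \<le> dist z y"
        using distance_attains_inf[OF cA, of z] by blast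
      obtain n0 where n0: "flat_at A C \<delta> x1 n0" using fl[OF x1(1)] by blast
      define a where "a = (z - x1) \<bullet> n0"
      have za: "z = x1 + a *\<^sub>R n0" unfolding a_def by (rule nearest_point_normal[OF x1(2) n0 \<delta>]) (use C in auto)
      \<comment> \<open>Orients the normal so that \<open>z\<close> has nonnegative height over
        \<open>x1\<close>.\<close>
      define n1 where "n1 = (if a \<ge> 0 then n0 else - n0)"
      have n1: "flat_at A C \<delta> x1 n1" using n0 flat_at_uminus by (auto simp: n1_def)
      have nn1: "norm n1 = 1" using n1 by (simp add: flat_at_def)
      have za1: "z = x1 + \<bar>a\<bar> *\<^sub>R n1" using za by (simp add: n1_def)
      have "\<bar>a\<bar> = dist z x1" using nn1 by (subst za1) (simp add: dist_norm)
      also have "\<dots> \<le> dist z (z + g *\<^sub>R n)" by (rule x1(2)[OF g(2)])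
      also have "\<dots> = \<bar>g\<bar>" using n by (simp add: dist_norm)
      finally have aT: "\<bar>a\<bar> \<le> T" using gT by simp
      \<comment> \<open>Height \<open>T\<close> instead of the actual height of \<open>z\<close>,
        which may be 0 while the crude bound asks for a positive one. The next step descends from
        \<open>T\<close> to \<open>z\<close> at a relative cost of order \<open>T\<close>.\<close>
      have 1: "W \<le> rpot s \<mu> (x1 + T *\<^sub>R n1) + W * ennreal (L * T powr (3/5 * \<beta>))"
        using low n1 T0 TT1 T1 by simp
      have 2: "rpot s \<mu> (x1 + T *\<^sub>R n1) \<le> ennreal (1 + 2 * s * exp s * (4 * C * T)) * rpot s \<mu> z"
      proof (rule rpot_le_scaled[OF \<mu>(2,3) bA])
        fix y assume "y \<in> A"
        then have "\<bar>(y - x1) \<bullet> n1\<bar> \<le> C * (norm (y - x1))\<^sup>2" using n1 by (simp add: flat_at_def)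
        then have "(1 - 4 * C * T) * dist y (x1 + \<bar>a\<bar> *\<^sub>R n1) \<le> dist y (x1 + T *\<^sub>R n1)"
          using C CT aT by (intro dist_along_normal[OF nn1]) auto
        then show "(1 - 4 * C * T) * dist y z \<le> dist y (x1 + T *\<^sub>R n1)" using za1 by simp
      qed (use s C T0 CT in auto)
      have "ennreal (1 + 2 * s * exp s * (4 * C * T)) * rpot s \<mu> z = rpot s \<mu> z + rpot s \<mu> z * ennreal (8 * s * exp s * C * T)"
        using s C T0 by (simp add: ennreal_plus distrib_right distrib_left mult_ac)
      then have "W \<le> rpot s \<mu> z + rpot s \<mu> z * ennreal (8 * s * exp s * C * T) + W * ennreal (L * T powr (3/5 * \<beta>))"
        using 1 2 by (metis add_right_mono order_trans)
      then have "W \<le> rpot s \<mu> z + W * (ennreal (8 * s * exp s * C * T) + ennreal (L * T powr (3/5 * \<beta>)))"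
        by (rule absorb_factor)
      also have "ennreal (8 * s * exp s * C * T) + ennreal (L * T powr (3/5 * \<beta>)) = ennreal (8 * s * exp s * C * T + L * T powr (3/5 * \<beta>))"
        using s C T0 L by simp
      finally have 3: "W \<le> rpot s \<mu> z + W * ennreal (8 * s * exp s * C * T + L * T powr (3/5 * \<beta>))" .
      have "8 * s * exp s * C * T + L * T powr (3/5 * \<beta>) \<le> (L1 + L2) * D powr (6/5 * \<beta>)"
      proof -
        have "T powr 1 \<le> T powr (3/5 * \<beta>)" using T0 Tle1 \<beta> by (intro powr_mono') auto
        then have "8 * s * exp s * C * T \<le> 8 * s * exp s * C * T powr (3/5 * \<beta>)" using T0 s C by (intro mult_left_mono) auto
        then have "8 * s * exp s * C * T + L * T powr (3/5 * \<beta>) \<le> (8 * s * exp s * C + L) * T powr (3/5 * \<beta>)"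
          by (simp add: distrib_right)
        also have "\<dots> = (8 * s * exp s * C + L) * ((8 * C) powr (3/5 * \<beta>) * D powr (6/5 * \<beta>))"
        proof -
          have "D\<^sup>2 = D powr 2" using D0 by simp
          then have "(D\<^sup>2) powr (3/5 * \<beta>) = D powr (2 * (3/5 * \<beta>))" by (simp only: powr_powr)
          then show ?thesis by (simp add: T_def powr_mult)
        qed
        also have "\<dots> \<le> (8 * s * exp s * C + L) * ((8 * C) * D powr (6/5 * \<beta>))"
        proof -
          have "(8 * C) powr (3/5 * \<beta>) \<le> (8 * C) powr 1" using C \<beta> by (intro powr_mono) auto
          then show ?thesis using C s L by (intro mult_left_mono mult_right_mono) auto
        qed
        also have "\<dots> = L1 * D powr (6/5 * \<beta>)" by (simp add: L1_def)
        also have "\<dots> \<le> (L1 + L2) * D powr (6/5 * \<beta>)" using LL by (intro mult_right_mono) auto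
        finally show ?thesis .
      qed
      then show ?thesis using 3 by blast
    qed
    then obtain b where b: "b \<le> (L1 + L2) * D powr (6/5 * \<beta>)" "W \<le> rpot s \<mu> z + W * ennreal b" by blast
    have "rpot s \<mu> z + W * ennreal b \<le> rpot s \<mu> z + W * ennreal ((L1 + L2) * D powr (6/5 * \<beta>))"
      using b(1) by (intro add_left_mono mult_left_mono ennreal_leI) auto
    then show ?thesis using order_trans[OF b(2)] unfolding D_def q_def by blast
  qed
  then show ?thesis using LL unfolding W_def \<beta>_def by (intro exI[of _ "L1 + L2"]) auto
qed

text \<open>The bound on the sphere is integrated against the swept measure itself, with no
  transport. The moment of order 6/5 of \<beta> is of order \<open>t powr \<beta>\<close>, the same
  order as the mass deficit.\<close>

lemma potential_lower_bound_sharp: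
  fixes A :: "'a::euclidean_space set"
  assumes dim: "DIM('a) = d + 1" and d: "d \<ge> 1" and s: "0 < s" "real d - 1 \<le> s" "s < real d"
    and A: "compact A" and C: "C \<ge> 1" and \<delta>: "\<delta> > 0" and fl: "\<And>x. x \<in> A \<Longrightarrow> \<exists>n. flat_at A C \<delta> x n"
    and eq: "equilibrium_measure s A \<mu>"
  shows "\<exists>L>0. \<exists>t1>0. \<forall>x0 n t. flat_at A C \<delta> x0 n \<and> 0 < t \<and> t \<le> t1 \<longrightarrow>
     wiener_energy s A \<le> rpot s \<mu> (x0 + t *\<^sub>R n) + wiener_energy s A * ennreal (L * t powr (real d - s))"
proof -
  define \<beta> where "\<beta> = real d - s"
  have \<beta>: "0 < \<beta>" "\<beta> \<le> 1" using s by (auto simp: \<beta>_def)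
  define W where "W = wiener_energy s A"
  have bA: "A \<in> sets borel" using compact_imp_closed[OF A] by simp
  have \<mu>: "prob_space \<mu>" "sets \<mu> = sets borel" "emeasure \<mu> (- A) = 0" and f\<mu>: "finite_measure \<mu>"
    using eq by (auto simp: equilibrium_measure_def prob_measure_on_def prob_space_def)
  note [measurable_cong] = \<mu>(2)
  have m\<mu> [measurable]: "rpot s \<mu> \<in> borel_measurable borel" by (rule rpot_measurable[OF f\<mu> \<mu>(2)])
  obtain K where K: "K > 0" and sweep: "\<And>(x0::'a) n t. norm n = 1 \<and> 0 < t \<and> t \<le> 1 \<longrightarrow> (\<exists>N. sweep s d K x0 n t N)"
    using sweep_exists[OF dim d s] by blast
  obtain L where L: "L > 0" and low: "\<And>x0 n t z. flat_at A C \<delta> x0 n \<and> 0 < t \<and> z \<in> sphere (x0 - n) 1 \<longrightarrow>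
     W \<le> rpot s \<mu> z + W * ennreal (L * dist z (x0 + t *\<^sub>R n) powr (6/5 * \<beta>))"
    using potential_lower_bound_sphere[OF dim d s A C \<delta> fl eq] unfolding W_def \<beta>_def by blast
  \<comment> \<open>A point of \<open>A\<close> deviates from the sphere, in squared distance to its
    centre, by at most \<open>1 + 2 * C\<close> times the square of \<open>dist x x0\<close>; the 4
    converts \<open>dist x x0\<close> into \<open>dist x q\<close>.\<close>
  define B where "B = 4 * (1 + 2 * C)"
  have B: "0 < B" "4 * C \<le> B" "1 \<le> B" using C by (auto simp: B_def)
  \<comment> \<open>Guarantees \<open>6 * B * t \<le> 1\<close>, the smallness condition in
    \<open>sweep_rpot_near\<close>.\<close>
  define t1 where "t1 = 1 / (6 * B)"
  have t1: "0 < t1" using B by (simp add: t1_def)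
  define L' where "L' = K * B + K + L * K"
  have L': "0 < L'" using K B L by (simp add: L'_def add_pos_pos)
  have "W \<le> rpot s \<mu> (x0 + t *\<^sub>R n) + W * ennreal (L' * t powr \<beta>)"
    if f0: "flat_at A C \<delta> x0 n" and t: "0 < t" "t \<le> t1" for x0 n t
  proof -
    define q where "q = x0 + t *\<^sub>R n"
    have n: "norm n = 1" and flat: "\<And>x. x \<in> A \<Longrightarrow> \<bar>(x - x0) \<bullet> n\<bar> \<le> C * (norm (x - x0))\<^sup>2"
      using f0 by (auto simp: flat_at_def)
    have Bt: "6 * B * t \<le> 1" using t B by (simp add: t1_def field_simps)
    have "1 * t \<le> B * t" "4 * C * t \<le> B * t" using t B by (intro mult_right_mono; simp)+
    then have tt: "t \<le> 1" "4 * C * t \<le> 1" using Bt B t by linarith+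
    have "\<exists>N. sweep s d K x0 n t N" using sweep[of n t x0] n t tt by simp
    then obtain N where sw: "sweep s d K x0 n t N" ..
    have fN: "finite_measure N" and sN [measurable_cong]: "sets N = sets borel" using sweep_finite[OF sw] sweep_sets[OF sw] by auto
    have spN: "space N = UNIV" by (simp add: sets_eq_imp_space_eq[OF sN])
    have "AE z in N. z \<in> sphere (x0 - n) 1" by (rule AE_supported[OF sN sweep_support[OF sw]]) simp
    then have "(\<integral>\<^sup>+z. W \<partial>N) \<le> (\<integral>\<^sup>+z. rpot s \<mu> z + (W * ennreal L) * ennreal (dist z q powr (6/5 * \<beta>)) \<partial>N)"
    proof (intro nn_integral_mono_AE, eventually_elim)
      case (elim z)
      then show ?case using low[of x0 n t z] f0 t L by (simp add: q_def ennreal_mult mult.assoc)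
    qed
    also have "\<dots> = (\<integral>\<^sup>+z. rpot s \<mu> z \<partial>N) + (W * ennreal L) * (\<integral>\<^sup>+z. ennreal (dist z q powr (6/5 * \<beta>)) \<partial>N)"
      by (subst nn_integral_add, measurable) (subst nn_integral_cmult, measurable)
    also have "\<dots> \<le> (\<integral>\<^sup>+z. rpot s \<mu> z \<partial>N) + (W * ennreal L) * ennreal (K * t powr \<beta>)"
      using sweep_moment_high[OF sw] unfolding q_def \<beta>_def by (intro add_left_mono mult_left_mono) auto
    also have "(\<integral>\<^sup>+z. rpot s \<mu> z \<partial>N) = (\<integral>\<^sup>+x. rpot s N x \<partial>\<mu>)" by (rule rpot_sym[OF f\<mu> \<mu>(2) fN sN])
    also have "\<dots> \<le> (\<integral>\<^sup>+x. ennreal (1 + K * B * t) * rker s (dist q x) \<partial>\<mu>)"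
    proof (rule nn_integral_mono_AE)
      have "AE x in \<mu>. x \<in> A" by (rule AE_supported[OF \<mu>(2,3) bA])
      then show "AE x in \<mu>. rpot s N x \<le> ennreal (1 + K * B * t) * rker s (dist q x)"
      proof eventually_elim
        case (elim x)
        note fb = flat_dist_bounds[OF n flat[OF elim] t(1) tt(2), folded q_def]
        have "(dist x x0 / 2)\<^sup>2 \<le> (dist x q)\<^sup>2" using fb(1) by (intro power_mono) auto
        then have d4: "(dist x x0)\<^sup>2 \<le> 4 * (dist x q)\<^sup>2" by (simp add: power_divide)
        have "(dist x (x0 - n))\<^sup>2 - 1 = (dist x x0)\<^sup>2 + 2 * ((x - x0) \<bullet> n)"
          using norm_add_scaleR_sq[OF n, of "x - x0" 1] by (simp add: dist_norm algebra_simps)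
        also have "\<bar>\<dots>\<bar> \<le> (1 + 2 * C) * (dist x x0)\<^sup>2"
        proof -
          have "\<bar>(dist x x0)\<^sup>2 + 2 * ((x - x0) \<bullet> n)\<bar> \<le> \<bar>(dist x x0)\<^sup>2\<bar> + 2 * \<bar>(x - x0) \<bullet> n\<bar>"
            using abs_triangle_ineq[of "(dist x x0)\<^sup>2" "2 * ((x - x0) \<bullet> n)"] by simp
          then show ?thesis using flat[OF elim] by (simp add: dist_norm distrib_right)
        qed
        also have "\<dots> \<le> (1 + 2 * C) * (4 * (dist x q)\<^sup>2)" using d4 C by (intro mult_left_mono) auto
        also have "\<dots> = B * (dist x q)\<^sup>2" by (simp add: B_def)
        finally have "\<bar>(dist x (x0 - n))\<^sup>2 - 1\<bar> \<le> B * (dist x q)\<^sup>2" .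
        moreover have "x \<noteq> q" using fb(2) t by auto
        ultimately show ?case
          using sweep_rpot_near[OF sw, of x B] Bt B unfolding q_def by (simp add: dist_commute)
      qed
    qed
    also have "\<dots> = ennreal (1 + K * B * t) * rpot s \<mu> q" unfolding rpot_def by (rule nn_integral_cmult) measurable
    finally have 1: "W * emeasure N UNIV \<le> ennreal (1 + K * B * t) * rpot s \<mu> q + (W * ennreal L) * ennreal (K * t powr \<beta>)"
      by (simp add: spN add_right_mono)
    have "W * 1 \<le> W * (emeasure N UNIV + ennreal (K * t powr \<beta>))"
      using sweep_mass[OF sw] unfolding \<beta>_def by (rule mult_left_mono) simp
    also have "\<dots> = W * emeasure N UNIV + W * ennreal (K * t powr \<beta>)" by (rule distrib_left)
    also have "\<dots> \<le> ennreal (1 + K * B * t) * rpot s \<mu> q + (W * ennreal L) * ennreal (K * t powr \<beta>) + W * ennreal (K * t powr \<beta>)"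
      by (intro add_right_mono 1)
    also have "\<dots> = rpot s \<mu> q + rpot s \<mu> q * ennreal (K * B * t) + W * (ennreal L * ennreal (K * t powr \<beta>) + ennreal (K * t powr \<beta>))"
    proof -
      have "ennreal (1 + K * B * t) = 1 + ennreal (K * B * t)" using K B t by (simp add: ennreal_plus)
      then show ?thesis by (simp only: distrib_right distrib_left mult_1_left mult_ac add_ac)
    qed
    finally have "W \<le> rpot s \<mu> q + rpot s \<mu> q * ennreal (K * B * t) + W * (ennreal L * ennreal (K * t powr \<beta>) + ennreal (K * t powr \<beta>))"
      by (simp only: mult_1_right)
    then have "W \<le> rpot s \<mu> q + W * (ennreal (K * B * t) + (ennreal L * ennreal (K * t powr \<beta>) + ennreal (K * t powr \<beta>)))"
      by (rule absorb_factor)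
    also have "\<dots> \<le> rpot s \<mu> q + W * ennreal (L' * t powr \<beta>)"
    proof (intro add_left_mono mult_left_mono)
      have "t powr 1 \<le> t powr \<beta>" using t tt \<beta> by (intro powr_mono') auto
      then have tb: "K * B * t \<le> K * B * t powr \<beta>" using t K B by (intro mult_left_mono) auto
      have "ennreal (K * B * t) + (ennreal L * ennreal (K * t powr \<beta>) + ennreal (K * t powr \<beta>)) =
        ennreal (K * B * t + (L * (K * t powr \<beta>) + K * t powr \<beta>))"
        using K B L t by (simp add: ennreal_mult[symmetric] ennreal_plus[symmetric] del: ennreal_plus)
      also have "\<dots> \<le> ennreal (L' * t powr \<beta>)"
        using tb by (intro ennreal_leI) (simp add: L'_def distrib_right)
      finally show "ennreal (K * B * t) + (ennreal L * ennreal (K * t powr \<beta>) + ennreal (K * t powr \<beta>)) \<le> ennreal (L' * t powr \<beta>)" .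
    qed simp
    finally show ?thesis by (simp add: q_def)
  qed
  then show ?thesis using L' t1 unfolding W_def \<beta>_def by (intro exI[of _ L'] conjI exI[of _ t1]) auto
qed

section \<open>From the potential to the measure of balls\<close>

text \<open>Raising the pole from \<open>x0\<close> to \<open>q\<close> lowers the kernel by a
  definite multiple of \<open>t powr (- s)\<close> on the ball of radius \<open>t\<close>, and
  elsewhere raises it at most by a factor 1+O(t). The ball therefore weighs at most the drop of the
  potential, of order \<open>t powr \<beta>\<close>, times \<open>t powr s\<close>.\<close>

lemma equilibrium_ball_bound:
  fixes A :: "'a::euclidean_space set"
  assumes dim: "DIM('a) = d + 1" and d: "d \<ge> 1" and s: "0 < s" "real d - 1 \<le> s" "s < real d"
    and A: "compact A" and C: "C \<ge> 1" and \<delta>: "\<delta> > 0" and fl: "\<And>x. x \<in> A \<Longrightarrow> \<exists>n. flat_at A C \<delta> x n"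
    and eq: "equilibrium_measure s A \<mu>"
  shows "\<exists>c>0. \<exists>t1>0. \<forall>x t. x \<in> A \<and> rpot s \<mu> x \<le> wiener_energy s A \<and> 0 < t \<and> t \<le> t1 \<longrightarrow>
     measure \<mu> (ball x t) \<le> c * t ^ d"
proof -
  define \<beta> where "\<beta> = real d - s"
  have \<beta>: "0 < \<beta>" "\<beta> \<le> 1" using s by (auto simp: \<beta>_def)
  have bA: "A \<in> sets borel" using compact_imp_closed[OF A] by simp
  have Wfin: "wiener_energy s A < \<infinity>" using eq by (simp add: equilibrium_measure_def)
  obtain w where w: "wiener_energy s A = ennreal w" "0 \<le> w" using Wfin by (cases "wiener_energy s A") auto
  have \<mu>: "prob_space \<mu>" "sets \<mu> = sets borel" "emeasure \<mu> (- A) = 0"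
    using eq by (auto simp: equilibrium_measure_def prob_measure_on_def)
  interpret prob_space \<mu> by (rule \<mu>(1))
  note [measurable_cong] = \<mu>(2)
  have ae: "AE x in \<mu>. x \<in> A" by (rule AE_supported[OF \<mu>(2,3) bA])
  obtain L t0 where L: "L > 0" and t0: "t0 > 0"
    and low: "\<And>x0 n t. flat_at A C \<delta> x0 n \<and> 0 < t \<and> t \<le> t0 \<longrightarrow> ennreal w \<le> rpot s \<mu> (x0 + t *\<^sub>R n) + ennreal w * ennreal (L * t powr \<beta>)"
    using potential_lower_bound_sharp[OF dim d s A C \<delta> fl eq] unfolding w \<beta>_def by blast
  define t1 where "t1 = min t0 (1 / (4 * C))"
  have t1: "0 < t1" "t1 \<le> t0" "4 * C * t1 \<le> 1" using t0 C by (auto simp: t1_def min_def field_simps)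
  \<comment> \<open>For \<open>r < t\<close> the squared distance to \<open>q\<close> is at least
    r^2/2+t^2, hence at least (36/25)r^2, so the distance grows by a factor of at least 6/5.\<close>
  define \<kappa> where "\<kappa> = (6/5::real) powr (- s)"
  have \<kappa>: "0 < \<kappa>" "\<kappa> < 1" using s by (auto simp: \<kappa>_def powr_less_one)
  define E where "E = 4 * s * exp s * C"
  have E: "0 < E" using s C by (simp add: E_def)
  define c where "c = w * (E + L) / (1 - \<kappa>)"
  have main: "measure \<mu> (ball x0 t) \<le> c * t ^ d"
    if x0: "x0 \<in> A" "rpot s \<mu> x0 \<le> ennreal w" and t: "0 < t" "t \<le> t1" for x0 t
  proof -
    obtain n where f0: "flat_at A C \<delta> x0 n" using fl[OF x0(1)] by blast
    have n: "norm n = 1" and flat: "\<And>x. x \<in> A \<Longrightarrow> \<bar>(x - x0) \<bullet> n\<bar> \<le> C * (norm (x - x0))\<^sup>2"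
      using f0 by (auto simp: flat_at_def)
    define q where "q = x0 + t *\<^sub>R n"
    have "4 * C * t \<le> 4 * C * t1" using t C by (intro mult_left_mono) auto
    then have Ct: "4 * C * t \<le> 1" using t1 by linarith
    \<comment> \<open>The guaranteed drop of the potential caused by the mass in the ball.\<close>
    define X where "X = ennreal ((1 - \<kappa>) * t powr (- s)) * emeasure \<mu> (ball x0 t)"
    have "rpot s \<mu> q + X = (\<integral>\<^sup>+x. rker s (dist q x) + ennreal ((1 - \<kappa>) * t powr (- s)) * indicator (ball x0 t) x \<partial>\<mu>)"
      unfolding rpot_def X_def
      by (subst nn_integral_add, measurable) (subst nn_integral_cmult_indicator, auto simp: \<mu>(2))
    also have "\<dots> \<le> (\<integral>\<^sup>+x. ennreal (1 + E * t) * rker s (dist x0 x) \<partial>\<mu>)"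
    proof (rule nn_integral_mono_AE, use ae in eventually_elim)
      case (elim x)
      define r where "r = dist x x0"
      have r0: "0 \<le> r" by (simp add: r_def)
      have sq: "(1 - 2 * C * t) * r\<^sup>2 + t\<^sup>2 \<le> (dist x q)\<^sup>2"
        using flat_dist_sq[OF n flat[OF elim] t(1)] by (simp add: r_def q_def)
      show ?case
      proof (cases "r < t")
        case False
        define e where "e = 2 * C * t"
        have e: "0 \<le> e" "e \<le> 1/2" using C t Ct by (auto simp: e_def)
        have "(1 - e)\<^sup>2 * r\<^sup>2 \<le> (1 - e) * r\<^sup>2"
          using e by (intro mult_right_mono) (auto simp: power2_eq_square mult_left_le)
        then have "((1 - e) * r)\<^sup>2 \<le> (dist x q)\<^sup>2" using sq zero_le_power2[of t] unfolding power_mult_distrib e_def by linarith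
        then have "(1 - e) * r \<le> dist x q" by (rule power2_le_imp_le) simp
        then have "rker s (dist x q) \<le> ennreal ((1 - e) powr (- s)) * rker s r"
          using e s r0 by (intro rker_le_scaled) auto
        also have "\<dots> \<le> ennreal (1 + E * t) * rker s r"
          using one_minus_powr_le[OF e, of s] s by (intro mult_right_mono ennreal_leI) (auto simp: E_def e_def mult_ac)
        finally show ?thesis using False by (simp add: r_def dist_commute)
      next
        case True
        have "(1/2) * r\<^sup>2 \<le> (1 - 2 * C * t) * r\<^sup>2" using Ct by (intro mult_right_mono) auto
        moreover have "r\<^sup>2 \<le> t\<^sup>2" using True r0 by (intro power_mono) auto
        ultimately have "(36/25) * r\<^sup>2 \<le> (dist x q)\<^sup>2" using sq zero_le_power2[of r] by linarith
        then have "((6/5) * r)\<^sup>2 \<le> (dist x q)\<^sup>2" by (simp add: power_mult_distrib power2_eq_square)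
        then have "(6/5) * r \<le> dist x q" by (rule power2_le_imp_le) simp
        then have 1: "rker s (dist x q) \<le> ennreal \<kappa> * rker s r"
          unfolding \<kappa>_def using s r0 by (intro rker_le_scaled) auto
        have "ennreal (t powr (- s)) \<le> rker s r"
          using rker_antimono[of s r t] True r0 s t by (simp add: rker_def[of s t])
        then have "ennreal (1 - \<kappa>) * ennreal (t powr (- s)) \<le> ennreal (1 - \<kappa>) * rker s r" by (rule mult_left_mono) simp
        then have "rker s (dist x q) + ennreal ((1 - \<kappa>) * t powr (- s)) \<le> ennreal \<kappa> * rker s r + ennreal (1 - \<kappa>) * rker s r"
          using 1 \<kappa> by (intro add_mono) (auto simp: ennreal_mult)
        also have "\<dots> = ennreal (\<kappa> + (1 - \<kappa>)) * rker s r"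
          using \<kappa> by (subst ennreal_plus) (auto simp: distrib_right)
        also have "\<dots> \<le> ennreal (1 + E * t) * rker s r" using E t by (intro mult_right_mono ennreal_leI) auto
        finally show ?thesis using True by (simp add: r_def dist_commute)
      qed
    qed
    also have "\<dots> = ennreal (1 + E * t) * rpot s \<mu> x0" unfolding rpot_def by (rule nn_integral_cmult) measurable
    also have "\<dots> \<le> ennreal (1 + E * t) * ennreal w" by (rule mult_left_mono[OF x0(2)]) simp
    finally have UX: "rpot s \<mu> q + X \<le> ennreal ((1 + E * t) * w)" using E t w by (simp add: ennreal_mult)
    then have "rpot s \<mu> q \<noteq> top" by (auto simp: top_unique)
    then obtain u where u: "rpot s \<mu> q = ennreal u" "0 \<le> u" by (cases "rpot s \<mu> q") auto
    have X: "X = ennreal ((1 - \<kappa>) * t powr (- s) * measure \<mu> (ball x0 t))"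
      using \<kappa> by (simp add: X_def emeasure_eq_measure ennreal_mult)
    have 1: "u + (1 - \<kappa>) * t powr (- s) * measure \<mu> (ball x0 t) \<le> (1 + E * t) * w"
    proof -
      define Y where "Y = (1 - \<kappa>) * t powr (- s) * measure \<mu> (ball x0 t)"
      have "ennreal (u + Y) = ennreal u + ennreal Y" using u \<kappa> by (intro ennreal_plus) (auto simp: Y_def)
      then have "ennreal (u + Y) \<le> ennreal ((1 + E * t) * w)" using UX by (simp only: X u(1) Y_def)
      moreover have "0 \<le> (1 + E * t) * w" using E t w by simp
      ultimately show ?thesis unfolding Y_def[symmetric] using ennreal_le_iff by blast
    qed
    have "ennreal w \<le> ennreal u + ennreal w * ennreal (L * t powr \<beta>)"
      using low[of x0 n t] f0 t t1 u by (simp add: q_def)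
    also have "\<dots> = ennreal (u + w * (L * t powr \<beta>))" using u w L by (simp add: ennreal_plus ennreal_mult)
    finally have 2: "w \<le> u + w * (L * t powr \<beta>)" using u w L by (subst (asm) ennreal_le_iff) auto
    have "1 * t1 \<le> 4 * C * t1" using C t1 by (intro mult_right_mono) auto
    then have "t \<le> 1" using t t1 by linarith
    then have "t powr 1 \<le> t powr \<beta>" using t \<beta> by (intro powr_mono') auto
    then have "E * t * w \<le> E * t powr \<beta> * w" using E w t by (intro mult_right_mono mult_left_mono) auto
    then have "(1 - \<kappa>) * t powr (- s) * measure \<mu> (ball x0 t) \<le> w * (E + L) * t powr \<beta>"
      using 1 2 by (simp add: algebra_simps)
    then have "t powr s * ((1 - \<kappa>) * t powr (- s) * measure \<mu> (ball x0 t)) \<le> t powr s * (w * (E + L) * t powr \<beta>)"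
      by (intro mult_left_mono) auto
    moreover have "t powr s * ((1 - \<kappa>) * t powr (- s) * measure \<mu> (ball x0 t)) = (1 - \<kappa>) * measure \<mu> (ball x0 t)"
      using t by (simp add: powr_minus)
    moreover have "t powr s * (w * (E + L) * t powr \<beta>) = w * (E + L) * t ^ d"
    proof -
      have "t powr s * t powr \<beta> = t powr real d" by (simp add: \<beta>_def flip: powr_add)
      then show ?thesis using t by (simp add: powr_realpow mult_ac)
    qed
    ultimately show ?thesis using \<kappa> by (simp add: c_def field_simps)
  qed
  have "measure \<mu> (ball x0 t) \<le> (c + 1) * t ^ d" if "x0 \<in> A" "rpot s \<mu> x0 \<le> ennreal w" "0 < t" "t \<le> t1" for x0 t
  proof -
    have "c * t ^ d \<le> (c + 1) * t ^ d" using that by (intro mult_right_mono) auto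
    then show ?thesis using main[OF that] by simp
  qed
  moreover have "0 < c + 1" using w E L \<kappa> by (simp add: c_def add_nonneg_pos)
  ultimately show ?thesis using t1 unfolding w by blast
qed

theorem corollary2p9:
  fixes A :: "'a::euclidean_space set" and d :: nat and s :: real and \<mu> :: "'a measure"
  assumes "d \<ge> 1" and "DIM('a) = d + 1"
    and "compact A" and "smooth_submanifold d A"
    and "s > 0" and "real d - 1 \<le> s" and "s < real d"
    and "equilibrium_measure s A \<mu>"
  shows "uniformly_upper_regular d A \<mu>"
proof -
  obtain C \<delta> where C: "C \<ge> 1" and \<delta>: "\<delta> > 0" and fl: "\<And>x. x \<in> A \<Longrightarrow> \<exists>n. flat_at A C \<delta> x n"
    using compact_submanifold_flat[OF assms(4,2,3)] by blast
  have bA: "A \<in> sets borel" using compact_imp_closed[OF assms(3)] by simp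
  have \<mu>: "prob_space \<mu>" "sets \<mu> = sets borel" "emeasure \<mu> (- A) = 0" and f\<mu>: "finite_measure \<mu>"
    using assms(8) by (auto simp: equilibrium_measure_def prob_measure_on_def prob_space_def)
  interpret prob_space \<mu> by (rule \<mu>(1))
  obtain c t1 where c: "c > 0" and t1: "t1 > 0"
    and bd: "\<And>x t. x \<in> A \<and> rpot s \<mu> x \<le> wiener_energy s A \<and> 0 < t \<and> t \<le> t1 \<longrightarrow> measure \<mu> (ball x t) \<le> c * t ^ d"
    using equilibrium_ball_bound[OF assms(2,1,5,6,7,3) C \<delta> fl assms(8)] by blast
  \<comment> \<open>The factor \<open>2 ^ d\<close> pays for recentring at twice the radius; the
    second term covers radii above \<open>t1 / 2\<close>, where the measure is at most 1.\<close>
  define c' where "c' = c * 2 ^ d + (2 / t1) ^ d"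
  have "measure \<mu> (ball x r) \<le> c' * r ^ d" if x: "x \<in> A" and r: "r > 0" for x r
  proof (cases "2 * r \<le> t1")
    case True
    \<comment> \<open>The bound on balls is available only at points where the potential is at most
      the energy. Either the ball contains such a point of \<open>A\<close> and is recentred there,
      or it is null because almost every point is of this kind.\<close>
    show ?thesis
    proof (cases "\<exists>x1\<in>A \<inter> ball x r. rpot s \<mu> x1 \<le> wiener_energy s A")
      case True
      then obtain x1 where x1: "x1 \<in> A" "dist x x1 < r" "rpot s \<mu> x1 \<le> wiener_energy s A" by auto
      have "ball x r \<subseteq> ball x1 (2 * r)"
      proof
        fix z assume "z \<in> ball x r"
        then show "z \<in> ball x1 (2 * r)" using x1 dist_triangle[of x1 z x] by (simp add: dist_commute)
      qed
      then have "measure \<mu> (ball x r) \<le> measure \<mu> (ball x1 (2 * r))"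
        by (intro finite_measure_mono) (auto simp: \<mu>(2))
      also have "\<dots> \<le> c * (2 * r) ^ d" using bd[of x1 "2 * r"] x1 r \<open>2 * r \<le> t1\<close> by simp
      also have "\<dots> \<le> c' * r ^ d" using t1 r by (simp add: c'_def power_mult_distrib distrib_right)
      finally show ?thesis .
    next
      case False
      have "AE y in \<mu>. y \<in> A" by (rule AE_supported[OF \<mu>(2,3) bA])
      with equilibrium_potential_le[OF assms(8) bA] have "AE y in \<mu>. y \<notin> ball x r"
        by eventually_elim (use False in blast)
      then have "emeasure \<mu> (ball x r) = 0"
        by (subst (asm) AE_iff_measurable[where N="ball x r"]) (auto simp: \<mu>(2) sets_eq_imp_space_eq[OF \<mu>(2)])
      then have "measure \<mu> (ball x r) = 0" by (simp add: measure_def)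
      then show ?thesis using c t1 r by (simp add: c'_def)
    qed
  next
    case False
    have "1 \<le> (2 * r / t1) ^ d" using False t1 by (intro one_le_power) auto
    also have "\<dots> = (2 / t1) ^ d * r ^ d" by (simp add: power_divide power_mult_distrib)
    also have "\<dots> \<le> c' * r ^ d" using c r by (intro mult_right_mono) (auto simp: c'_def)
    finally show ?thesis using prob_le_1[of "ball x r"] by linarith
  qed
  then show ?thesis unfolding uniformly_upper_regular_def by blast
qed

end
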